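(* Suppose $\frac{a_{\max}}{a_{\min}} \in L^r(\Gamma;\mathbb{R})$ for some $r>1$. Let $\bar f^{(M)} \in L^{2;(M)}(\Gamma;H^{-1}(\mathcal D;\mathbb R))$ be the truncated deterministic representation of a given stochastic forcing term. Then: (1) There exists a unique $u^* \in L^{2;(M)}(\Gamma;H_0^1(\mathcal D;\mathbb R))$ such that $$\bar B^{(M)}_{a_{\min}^{-1}}(u^*,\bar v^{(M)}) = \bar F^{(M)}_{a_{\min}^{-1}}(\bar v^{(M)}) \quad\text{for all } \bar v^{(M)} \in L^{2;(M)}(\Gamma;H_0^1(\mathcal D;\mathbb R)). \qquad ( * )$$ (2) The Ritz energy functional $\bar{\mathcal E}^{(M)}_{a_{\min}^{-1}} : L^{2;(M)}(\Gamma;H_0^1(\mathcal D;\mathbb R)) \to \mathbb R$ defined by $$\bar{\mathcal E}^{(M)}_{a_{\min}^{-1}}(\bar u^{(M)}) := \tfrac12 \bar B^{(M)}_{a_{\min}^{-1}}(\bar u^{(M)},\bar u^{(M)}) - \bar F^{(M)}_{a_{\min}^{-1}}(\bar u^{(M)})$$ has a unique minimum, and the corresponding minimizer $$u^* = \operatorname*{arg\,min}_{\bar u^{(M)} \in L^{2;(M)}(\Gamma;H_0^1(\mathcal D;\mathbb R))} \bar{\mathcal E}^{(M)}_{a_{\min}^{-1}}(\bar u^{(M)})$$ is the unique stochastic Galerkin approximation of the weighted stochastic weak formulation, i.e. the solution of $( * )$.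
   Context: Domain and function spaces. $(\Omega,\mathcal A,P)$ is a complete probability space and $\mathcal D\subset\mathbb R^d$, $d \in \mathbb{N}$, is an open, bounded, connected domain with Lipschitz boundary; $\lambda^d$ is Lebesgue measure. $H_0^1(\mathcal D;\mathbb R)$ carries the norm $\|\phi\|_{H_0^1}=(\int_{\mathcal D}\|\nabla\phi\|_2^2\,d\lambda^d)^{1/2}$, and $H^{-1}(\mathcal D;\mathbb R)$ is its dual; for $\psi\in H^{-1}$, $\phi\in H^1_0$ the expression $\int_{\mathcal D}\psi(x)\phi(x)\,d\lambda^d(x)$ denotes the dual pairing. $L^2(\Omega;E)$, $L^2(\Gamma;E)$ denote Lebesgue–Bochner spaces (with respect to $P$ and to $\mu$ below). Underlying random variables. $Y=(Y_1,\dots,Y_N):\Omega\to\Gamma=\Gamma_1\times\dots\times\Gamma_N$ with $Y_n:\Omega\to\Gamma_n\subset\mathbb R$ ($\Gamma_n$ Borel) independent continuous random variables with laws $\mu_n$; $\mu=\bigotimes_{n=1}^N\mu_n$ is the law of $Y$. Each $Y_n$ has finite moments of all orders, and each $\mu_n$ is determinate (uniquely determined by its moments). For each $n$, $(p_{n,i})_{i\in\mathbb N_0}$ is the orthonormal polynomial basis of $L^2(\Gamma_n;\mathbb R)$ with respect to $\mu_n$, with $\deg p_{n,i}=i$ and $p_{n,0}\equiv1$. The tensor products $p_\nu(y)=\prod_n p_{n,\nu_n}(y_n)$, $\nu\in\mathbb N_0^N$, form an orthonormal basis of $L^2(\Gamma;\mathbb R)$, and are enumerated as $(p_k)_{k\in\mathbb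 N_0}$ in graded lexicographic order (first by total degree $|\nu|=\nu_1+\dots+\nu_N$, then lexicographically). Fix a maximal total degree $P\in\mathbb N_0$ and let $M+1=\frac{(N+P)!}{N!P!}$, so $p_0,\dots,p_M$ are exactly the basis polynomials of total degree at most $P$. For a separable Hilbert space $H$, $L^{2;(M)}(\Gamma;H)=\{\sum_{k=0}^M h_k p_k : h_k\in H\}\subset L^2(\Gamma;H)$, with the norm of $L^2(\Gamma;H)$. For $g\in L^2(\Gamma;H)$ with expansion $g=\sum_{k\in\mathbb N_0} g_kp_k$, its truncation is $g^{(M)}=\sum_{k=0}^M g_kp_k$. Data. $a:\Omega\times\mathcal D\to\mathbb R$ is a measurable random field (the stochastic diffusion coefficient) with $a\in L^2(\Omega;L^\infty(\mathcal D;\mathbb R))$, and $a_{\min},a_{\max}:\Omega\to\mathbb R$ are $\sigma(a)$-measurable random variables with $a_{\min}^{-1}\in L^p(\Omega;\mathbb R)$ for every $p\in(0,\infty)$ and $0<a_{\min}(\omega)\le a(\omega,x)\le a_{\max}(\omega)<\infty$ for $P$-a.e. $\omega$ and $\lambda^d$-a.e. $x$. The stochastic forcing term satisfies $f\in L^2(\Omega;H^{-1}(\mathcal D;\mathbb R))$. These are driven by $Y$: $a(\omega,x)=\bar a(Y(\omega),x)$, $f(\omega,x)=\bar f(Y(\omega),x)$, and likewise $a_{\min},a_{\max},a_{\min}^{-1}$ are regarded as functions $\bar a_{\min},\bar a_{\max},\bar a_{\min}^{\,-1}$ of $y\in\Gamma$ (the bar is omitted when convenient). Set $\bar{\mathbf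 a}(y,x):=\bar a(y,x)/\bar a_{\min}(y)$, which is taken to lie in $L^2(\Gamma;L^2(\mathcal D;\mathbb R))$, with truncation $\bar{\mathbf a}^{(M)}$; $(\bar a_{\min}^{\,-1})^{(M)}$ is the truncation of $\bar a_{\min}^{\,-1}\in L^2(\Gamma;\mathbb R)$. Standing assumption on truncation. The truncation $\bar a^{(M)}$ of $\bar a$ satisfies the same kind of assumption as $a$: $\bar a^{(M)}\in L^2(\Gamma;L^\infty(\mathcal D;\mathbb R))$ and it is bounded below and above, a.e., by positive finite $\sigma(\bar a^{(M)})$-measurable functions of $y$, with the reciprocal of the lower bound in $L^p(\Gamma;\mathbb R)$ for all $p\in(0,\infty)$. Weighted stochastic weak formulation. For $f\in L^2_{a_{\min}^{-2}}(\Omega;H^{-1}(\mathcal D;\mathbb R))$ (i.e. $\int_\Omega\|f(\omega)\|_{H^{-1}}^2a_{\min}(\omega)^{-2}\,dP(\omega)<\infty$), this is the problem of finding $u\in L^2_{a/a_{\min}}(\Omega;H_0^1(\mathcal D;\mathbb R))$ with $\int_\Omega\int_{\mathcal D}\frac{a}{a_{\min}}\nabla u\cdot\nabla v\,d\lambda^d\,dP=\int_\Omega\int_{\mathcal D}\frac{1}{a_{\min}}f\,v\,d\lambda^d\,dP$ for every $v\in L^2_{a/a_{\min}}(\Omega;H_0^1(\mathcal D;\mathbb R))$, where $L^2_{a/a_{\min}}(\Omega;H_0^1(\mathcal D;\mathbb R))$ is the space of strongly measurable $\phi:\Omega\to H_0^1(\mathcal D;\mathbb R)$ with $\int_\Omega\int_{\mathcal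 D}\|\nabla\phi\|_2^2\frac{a}{a_{\min}}\,d\lambda^d\,dP<\infty$. Its stochastic Galerkin approximation is the problem $( * )$. Truncated weighted forms. For $\bar u^{(M)},\bar v^{(M)}\in L^{2;(M)}(\Gamma;H_0^1(\mathcal D;\mathbb R))$, $$\bar B^{(M)}_{a_{\min}^{-1}}(\bar u^{(M)},\bar v^{(M)})=\int_\Gamma\int_{\mathcal D}\bar{\mathbf a}^{(M)}(y,x)\,\nabla\bar u^{(M)}(y,x)\cdot\nabla\bar v^{(M)}(y,x)\,d\lambda^d(x)\,d\mu(y),$$ $$\bar F^{(M)}_{a_{\min}^{-1}}(\bar v^{(M)})=\int_\Gamma\int_{\mathcal D}(\bar a_{\min}^{\,-1})^{(M)}(y)\,\bar f^{(M)}(y,x)\,\bar v^{(M)}(y,x)\,d\lambda^d(x)\,d\mu(y).$$ Gradients are with respect to $x$.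
   Formalization: The standing assumption on truncation is imposed also on the truncation of the weighted coefficient a/a_min (not only on that of a), since otherwise the weighted form can be indefinite or singular and both parts of the claim fail. *)

theory Defs
  imports "HOL-Probability.Probability" "HOL-Computational_Algebra.Polynomial"
begin

section \<open>Domains and Sobolev spaces\<close>

text \<open>
  Functions on a domain \<open>D\<close> are represented by total functions whose values outside \<open>D\<close> are
  irrelevant; elements of Lebesgue and Sobolev spaces are representatives, and the equality of
  such elements is equality almost everywhere (\<open>L2_eq\<close> below).
\<close>

text \<open>Near every boundary point \<open>D\<close> is the strict epigraph of a Lipschitz function in some
  direction \<open>e\<close>; the graph function is evaluated at the projection onto the complement of \<open>e\<close>.\<close>

definition lipschitz_boundary :: "'a::euclidean_space set \<Rightarrow> bool" where
  "lipschitz_boundary D \<longleftrightarrow>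
     (\<forall>z\<in>frontier D. \<exists>e \<gamma> L r. norm e = 1 \<and> r > 0 \<and> L-lipschitz_on UNIV (\<gamma> :: 'a \<Rightarrow> real) \<and>
        D \<inter> ball z r = {x \<in> ball z r. \<gamma> (x - (x \<bullet> e) *\<^sub>R e) < x \<bullet> e})"

definition lipschitz_domain :: "'a::euclidean_space set \<Rightarrow> bool" where
  "lipschitz_domain D \<longleftrightarrow>
     open D \<and> bounded D \<and> connected D \<and> D \<noteq> {} \<and> lipschitz_boundary D"

fun Ck :: "nat \<Rightarrow> ('a::euclidean_space \<Rightarrow> real) \<Rightarrow> bool" where
  "Ck 0 \<phi> = continuous_on UNIV \<phi>"
| "Ck (Suc k) \<phi> = ((\<forall>x. \<phi> differentiable (at x)) \<and>
     (\<forall>i\<in>Basis. Ck k (\<lambda>x. frechet_derivative \<phi> (at x) i)))"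

definition test_functions :: "'a::euclidean_space set \<Rightarrow> ('a \<Rightarrow> real) set" where
  "test_functions D =
     {\<phi>. (\<forall>k. Ck k \<phi>) \<and> compact (closure {x. \<phi> x \<noteq> 0}) \<and> closure {x. \<phi> x \<noteq> 0} \<subseteq> D}"

definition L2_on ::
    "'a::euclidean_space set \<Rightarrow> ('a \<Rightarrow> 'b::{real_normed_vector, second_countable_topology}) set" where
  "L2_on D = {u \<in> borel_measurable (lebesgue_on D).
                integrable (lebesgue_on D) (\<lambda>x. (norm (u x))\<^sup>2)}"

definition L2_norm ::
    "'a::euclidean_space set \<Rightarrow> ('a \<Rightarrow> 'b::{real_normed_vector, second_countable_topology}) \<Rightarrow> real" where
  "L2_norm D u = sqrt (\<integral>x. (norm (u x))\<^sup>2 \<partial>lebesgue_on D)"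

definition Linf_on :: "'a::euclidean_space set \<Rightarrow> ('a \<Rightarrow> real) set" where
  "Linf_on D = {u \<in> borel_measurable (lebesgue_on D).
                  esssup (lebesgue_on D) (\<lambda>x. ereal \<bar>u x\<bar>) < \<infinity>}"

definition Linf_norm :: "'a::euclidean_space set \<Rightarrow> ('a \<Rightarrow> real) \<Rightarrow> real" where
  "Linf_norm D u = real_of_ereal (esssup (lebesgue_on D) (\<lambda>x. ereal \<bar>u x\<bar>))"

definition is_weak_gradient ::
    "'a::euclidean_space set \<Rightarrow> ('a \<Rightarrow> real) \<Rightarrow> ('a \<Rightarrow> 'a) \<Rightarrow> bool" where
  "is_weak_gradient D u g \<longleftrightarrow>
     (\<forall>\<phi>\<in>test_functions D. \<forall>i\<in>Basis.
        (\<integral>x. u x * frechet_derivative \<phi> (at x) i \<partial>lebesgue_on D) =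
        - (\<integral>x. (g x \<bullet> i) * \<phi> x \<partial>lebesgue_on D))"

definition H1 :: "'a::euclidean_space set \<Rightarrow> ('a \<Rightarrow> real) set" where
  "H1 D = {u \<in> L2_on D. \<exists>g\<in>L2_on D. is_weak_gradient D u g}"

text \<open>A representative of the weak gradient, which is unique almost everywhere in \<open>D\<close>.\<close>

definition wgrad :: "'a::euclidean_space set \<Rightarrow> ('a \<Rightarrow> real) \<Rightarrow> 'a \<Rightarrow> 'a" where
  "wgrad D u = (SOME g. g \<in> L2_on D \<and> is_weak_gradient D u g)"

definition H1_norm :: "'a::euclidean_space set \<Rightarrow> ('a \<Rightarrow> real) \<Rightarrow> real" where
  "H1_norm D u = sqrt ((L2_norm D u)\<^sup>2 + (L2_norm D (wgrad D u))\<^sup>2)"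

definition H01 :: "'a::euclidean_space set \<Rightarrow> ('a \<Rightarrow> real) set" where
  "H01 D = {u \<in> H1 D. \<exists>\<phi>. (\<forall>n. \<phi> n \<in> test_functions D) \<and>
                          (\<lambda>n. H1_norm D (\<lambda>x. \<phi> n x - u x)) \<longlonglongrightarrow> 0}"

definition H01_norm :: "'a::euclidean_space set \<Rightarrow> ('a \<Rightarrow> real) \<Rightarrow> real" where
  "H01_norm D u = L2_norm D (wgrad D u)"

text \<open>The dual space; the dual pairing of \<open>\<psi>\<close> and \<open>u\<close> is the application \<open>\<psi> u\<close>.\<close>

definition Hm1 :: "'a::euclidean_space set \<Rightarrow> (('a \<Rightarrow> real) \<Rightarrow> real) set" where
  "Hm1 D = {\<psi>. (\<forall>u\<in>H01 D. \<forall>v\<in>H01 D. \<psi> (\<lambda>x. u x + v x) = \<psi> u + \<psi> v) \<and>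
               (\<forall>c. \<forall>u\<in>H01 D. \<psi> (\<lambda>x. c * u x) = c * \<psi> u) \<and>
               (\<exists>C. \<forall>u\<in>H01 D. \<bar>\<psi> u\<bar> \<le> C * H01_norm D u)}"

definition Hm1_norm :: "'a::euclidean_space set \<Rightarrow> (('a \<Rightarrow> real) \<Rightarrow> real) \<Rightarrow> real" where
  "Hm1_norm D \<psi> = (SUP u\<in>{u \<in> H01 D. H01_norm D u \<le> 1}. \<bar>\<psi> u\<bar>)"

section \<open>Lebesgue and Lebesgue--Bochner spaces over a measure space\<close>

definition Lp_real :: "'w measure \<Rightarrow> real \<Rightarrow> ('w \<Rightarrow> real) set" where
  "Lp_real Q q = {g \<in> borel_measurable Q. integrable Q (\<lambda>w. \<bar>g w\<bar> powr q)}"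

text \<open>
  \<open>L\<^sup>2(Q; S)\<close> for a normed space whose elements are (represented by) real functions forming
  the set \<open>S\<close> and whose norm is \<open>nrm\<close>: strongly measurable, i.e. almost everywhere the limit
  of \<open>S\<close>-valued simple functions, with square-integrable norm. Such a limit is in general only
  measurable for the completion of \<open>Q\<close>.
\<close>

definition bochner_L2 ::
    "'w measure \<Rightarrow> ('z \<Rightarrow> real) set \<Rightarrow> (('z \<Rightarrow> real) \<Rightarrow> real) \<Rightarrow> ('w \<Rightarrow> 'z \<Rightarrow> real) set" where
  "bochner_L2 Q S nrm =
     {g. (AE w in Q. g w \<in> S) \<and>
         (\<exists>s. (\<forall>i. simple_function Q (s i) \<and> (\<forall>w\<in>space Q. s i w \<in> S)) \<and>
              (AE w in Q. (\<lambda>i. nrm (\<lambda>z. s i w z - g w z)) \<longlonglongrightarrow> 0)) \<and>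
         integrable (completion Q) (\<lambda>w. (nrm (g w))\<^sup>2)}"

text \<open>The \<open>\<sigma>\<close>-algebra generated by the random field \<open>b\<close>, i.e. by all \<open>b(\<cdot>, x)\<close>.\<close>

definition field_sigma :: "'w measure \<Rightarrow> 'a set \<Rightarrow> ('w \<Rightarrow> 'a \<Rightarrow> real) \<Rightarrow> 'w measure" where
  "field_sigma Q D b =
     sigma (space Q) {(\<lambda>w. b w x) -` B \<inter> space Q | x B. x \<in> D \<and> B \<in> sets borel}"

definition diffusion_field ::
    "'w measure \<Rightarrow> 'a::euclidean_space set \<Rightarrow> ('w \<Rightarrow> 'a \<Rightarrow> real) \<Rightarrow>
     ('w \<Rightarrow> real) \<Rightarrow> ('w \<Rightarrow> real) \<Rightarrow> bool" where
  "diffusion_field Q D b bmin bmax \<longleftrightarrow>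
     (\<lambda>(w, x). b w x) \<in> borel_measurable (Q \<Otimes>\<^sub>M lebesgue_on D) \<and>
     b \<in> bochner_L2 Q (Linf_on D) (Linf_norm D) \<and>
     bmin \<in> borel_measurable (field_sigma Q D b) \<and>
     bmax \<in> borel_measurable (field_sigma Q D b) \<and>
     (\<forall>q>0. (\<lambda>w. inverse (bmin w)) \<in> Lp_real Q q) \<and>
     (AE w in Q. AE x in lebesgue_on D. 0 < bmin w \<and> bmin w \<le> b w x \<and> b w x \<le> bmax w)"

section \<open>Polynomial chaos\<close>

definition determinate :: "real measure \<Rightarrow> bool" where
  "determinate m \<longleftrightarrow>
     (\<forall>m'. sets m' = sets borel \<and>
           (\<forall>k. integrable m' (\<lambda>t. t ^ k) \<and> (\<integral>t. t ^ k \<partial>m') = (\<integral>t. t ^ k \<partial>m))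
           \<longrightarrow> m' = m)"

definition orthonormal_poly_basis :: "real measure \<Rightarrow> (nat \<Rightarrow> real poly) \<Rightarrow> bool" where
  "orthonormal_poly_basis m p \<longleftrightarrow>
     p 0 = 1 \<and> (\<forall>i. degree (p i) = i) \<and>
     (\<forall>i j. (\<integral>t. poly (p i) t * poly (p j) t \<partial>m) = (if i = j then 1 else 0)) \<and>
     (\<forall>g\<in>borel_measurable m. integrable m (\<lambda>t. (g t)\<^sup>2) \<longrightarrow>
        (\<forall>i. (\<integral>t. g t * poly (p i) t \<partial>m) = 0) \<longrightarrow> (AE t in m. g t = 0))"

text \<open>The first argument of the next definitions is the number \<open>N\<close> of random variables, which are
  indexed by \<open>0, \<dots>, N - 1\<close>.\<close>

definition multi_indices :: "nat \<Rightarrow> (nat \<Rightarrow> nat) set" where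
  "multi_indices N = {..<N} \<rightarrow>\<^sub>E UNIV"

definition grlex_less :: "nat \<Rightarrow> (nat \<Rightarrow> nat) \<Rightarrow> (nat \<Rightarrow> nat) \<Rightarrow> bool" where
  "grlex_less N \<nu> \<kappa> \<longleftrightarrow>
     (\<Sum>n<N. \<nu> n) < (\<Sum>n<N. \<kappa> n) \<or>
     (\<Sum>n<N. \<nu> n) = (\<Sum>n<N. \<kappa> n) \<and> (\<exists>n<N. (\<forall>m<n. \<nu> m = \<kappa> m) \<and> \<nu> n < \<kappa> n)"

definition grlex_enumeration :: "nat \<Rightarrow> (nat \<Rightarrow> nat \<Rightarrow> nat) \<Rightarrow> bool" where
  "grlex_enumeration N \<alpha> \<longleftrightarrow>
     bij_betw \<alpha> UNIV (multi_indices N) \<and> (\<forall>k l. k < l \<longrightarrow> grlex_less N (\<alpha> k) (\<alpha> l))"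

definition tensor_poly :: "nat \<Rightarrow> (nat \<Rightarrow> nat \<Rightarrow> real poly) \<Rightarrow> (nat \<Rightarrow> nat) \<Rightarrow> (nat \<Rightarrow> real) \<Rightarrow> real" where
  "tensor_poly N p \<nu> y = (\<Prod>n<N. poly (p n (\<nu> n)) (y n))"

text \<open>Below, \<open>pc k\<close> is the \<open>k\<close>-th element of an orthonormal basis of \<open>L\<^sup>2(\<mu>)\<close>. The coefficients
  use the completion of \<open>\<mu>\<close> for the same reason as in \<open>bochner_L2\<close>; for \<open>\<mu>\<close>-measurable \<open>g\<close> this
  makes no difference.\<close>

definition truncation ::
    "'w measure \<Rightarrow> (nat \<Rightarrow> 'w \<Rightarrow> real) \<Rightarrow> nat \<Rightarrow> ('w \<Rightarrow> real) \<Rightarrow> 'w \<Rightarrow> real" where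
  "truncation \<mu> pc M g y = (\<Sum>k\<le>M. (\<integral>t. g t * pc k t \<partial>completion \<mu>) * pc k y)"

text \<open>The coefficients of a function with values in a space of real functions are computed
  pointwise: for fixed \<open>x\<close> if \<open>g y\<close> is a function on the domain, and by testing with a fixed
  element \<open>z\<close> of the predual if \<open>g y\<close> is a functional.\<close>

definition truncation_fun ::
    "'w measure \<Rightarrow> (nat \<Rightarrow> 'w \<Rightarrow> real) \<Rightarrow> nat \<Rightarrow> ('w \<Rightarrow> 'z \<Rightarrow> real) \<Rightarrow> 'w \<Rightarrow> 'z \<Rightarrow> real" where
  "truncation_fun \<mu> pc M g y z = truncation \<mu> pc M (\<lambda>t. g t z) y"

definition L2M :: "(nat \<Rightarrow> 'w \<Rightarrow> real) \<Rightarrow> nat \<Rightarrow> ('z \<Rightarrow> real) set \<Rightarrow> ('w \<Rightarrow> 'z \<Rightarrow> real) set" where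
  "L2M pc M S = {(\<lambda>y z. \<Sum>k\<le>M. h k z * pc k y) | h. \<forall>k\<le>M. h k \<in> S}"

definition L2_eq ::
    "'w measure \<Rightarrow> 'a::euclidean_space set \<Rightarrow> ('w \<Rightarrow> 'a \<Rightarrow> real) \<Rightarrow> ('w \<Rightarrow> 'a \<Rightarrow> real) \<Rightarrow> bool" where
  "L2_eq \<mu> D u v \<longleftrightarrow> (AE y in \<mu>. AE x in lebesgue_on D. u y x = v y x)"

section \<open>Stochastic Galerkin problem\<close>

text \<open>\<open>b\<close>, \<open>c\<close> and \<open>g\<close> are the truncations of the weighted diffusion coefficient, of the reciprocal
  lower bound and of the forcing term.\<close>

definition form_B ::
    "'w measure \<Rightarrow> 'a::euclidean_space set \<Rightarrow> ('w \<Rightarrow> 'a \<Rightarrow> real) \<Rightarrow>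
     ('w \<Rightarrow> 'a \<Rightarrow> real) \<Rightarrow> ('w \<Rightarrow> 'a \<Rightarrow> real) \<Rightarrow> real" where
  "form_B \<mu> D b u v =
     (\<integral>y. (\<integral>x. b y x * (wgrad D (u y) x \<bullet> wgrad D (v y) x) \<partial>lebesgue_on D) \<partial>\<mu>)"

definition form_F ::
    "'w measure \<Rightarrow> ('w \<Rightarrow> real) \<Rightarrow> ('w \<Rightarrow> ('a \<Rightarrow> real) \<Rightarrow> real) \<Rightarrow> ('w \<Rightarrow> 'a \<Rightarrow> real) \<Rightarrow> real" where
  "form_F \<mu> c g v = (\<integral>y. c y * g y (v y) \<partial>\<mu>)"

definition galerkin_solution ::
    "('u \<Rightarrow> 'u \<Rightarrow> real) \<Rightarrow> ('u \<Rightarrow> real) \<Rightarrow> 'u set \<Rightarrow> 'u \<Rightarrow> bool" where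
  "galerkin_solution B F V u \<longleftrightarrow> u \<in> V \<and> (\<forall>v\<in>V. B u v = F v)"

definition ritz_energy :: "('u \<Rightarrow> 'u \<Rightarrow> real) \<Rightarrow> ('u \<Rightarrow> real) \<Rightarrow> 'u \<Rightarrow> real" where
  "ritz_energy B F u = 1 / 2 * B u u - F u"

end

theory Submission
  imports Defs
begin

text \<open>
  In the coefficients \<open>h\<^sub>0, \<dots>, h\<^sub>M\<close> of the ansatz space the problem lives on \<open>(H\<^sup>1\<^sub>0)\<^bsup>M+1\<^esup>\<close>. This is a
  Hilbert space for the gradient norm by the Poincare inequality and the completeness of \<open>L\<^sup>2\<close>. The
  form is bounded because the essential supremum of the coefficient is square integrable and
  polynomials in \<open>Y\<close> have moments of all orders. It is coercive although its weight degenerates: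
  by orthonormality \<open>h\<^sub>k = \<integral> u p\<^sub>k d\<mu>\<close>, so that the Cauchy--Schwarz inequality with weight \<open>b\<^sub>m\<^sub>i\<^sub>n\<close> gives
  \<open>\<parallel>h\<^sub>k\<parallel>\<^sup>2 \<le> \<integral> b\<^sub>m\<^sub>i\<^sub>n \<parallel>u\<parallel>\<^sup>2 d\<mu> \<cdot> \<integral> p\<^sub>k\<^sup>2 / b\<^sub>m\<^sub>i\<^sub>n d\<mu>\<close>. The solution is the limit of a minimising sequence of
  the energy, which is Cauchy by the parallelogram identity.
\<close>

section \<open>Smooth bump functions\<close>

text \<open>The formal obstacle is that \<open>wgrad\<close> is a chosen representative, picked anew
  for every parameter \<open>y\<close>: it is linear only a.e. in x, and nothing is known about
  joint measurability of \<open>wgrad D (u y) x\<close>. Both points are settled by replacing the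
  gradient of an ansatz function a.e. by the finite sum of the gradients of its coefficients. That
  replacement needs uniqueness of weak gradients, hence the fundamental lemma of the calculus of
  variations, hence explicit smooth functions of compact support. A second obstacle is that the
  essential supremum of the coefficient is only known to be measurable for the completion of \<mu>.
  Upper estimates are therefore made over the completion and carried back for integrands that are
  measurable for \<mu>. The ansatz space is never given a norm. The energy seminorm is compared in
  both directions with the gradient norms of the M + 1 coefficients, so completeness reduces to that
  of \<open>H01 D\<close>. Uniqueness means equality a.e. of representatives, in accordance with a
  form that is definite only modulo null sets.\<close>

lemma Ck_SucI:
  assumes "\<And>x. (\<phi> has_derivative \<phi>' x) (at x)" and "\<And>i. i \<in> Basis \<Longrightarrow> Ck k (\<lambda>x. \<phi>' x i)"
  shows "Ck (Suc k) \<phi>"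
proof -
  have "frechet_derivative \<phi> (at x) = \<phi>' x" for x
    using assms(1) frechet_derivative_at by metis
  then show ?thesis
    using assms by (auto simp: differentiable_def)
qed

lemma Ck_continuous: "Ck k \<phi> \<Longrightarrow> continuous_on UNIV \<phi>"
  by (cases k) (auto simp: differentiable_imp_continuous_on differentiable_on_def
      differentiable_at_imp_differentiable_on)

lemma Ck_Suc: "Ck (Suc k) \<phi> \<Longrightarrow> Ck k \<phi>"
proof (induction k arbitrary: \<phi>)
  case 0
  then show ?case using Ck_continuous[of "Suc 0"] by auto
next
  case (Suc k)
  then show ?case by auto
qed

lemma Ck_const: "Ck k (\<lambda>x. c)"
proof (induction k arbitrary: c)
  case (Suc k)
  show ?case by (rule Ck_SucI[where \<phi>' = "\<lambda>_ _. 0"]) (auto intro: Suc)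
qed auto

lemma Ck_add: "Ck k \<phi> \<Longrightarrow> Ck k \<psi> \<Longrightarrow> Ck k (\<lambda>x. \<phi> x + \<psi> x)"
proof (induction k arbitrary: \<phi> \<psi>)
  case 0
  then show ?case by (auto intro: continuous_on_add)
next
  case (Suc k)
  show ?case
    by (rule Ck_SucI[where \<phi>' = "\<lambda>x i. frechet_derivative \<phi> (at x) i + frechet_derivative \<psi> (at x) i"])
      (use Suc in \<open>auto intro!: has_derivative_add simp: frechet_derivative_works[symmetric]\<close>)
qed

lemma Ck_mult: "Ck k \<phi> \<Longrightarrow> Ck k \<psi> \<Longrightarrow> Ck k (\<lambda>x. \<phi> x * \<psi> x)"
proof (induction k arbitrary: \<phi> \<psi>)
  case 0
  then show ?case by (auto intro: continuous_on_mult)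
next
  case (Suc k)
  have *: "Ck k \<phi>" "Ck k \<psi>" using Suc.prems by (blast intro: Ck_Suc)+
  show ?case
    by (rule Ck_SucI[where \<phi>' = "\<lambda>x i. \<phi> x * frechet_derivative \<psi> (at x) i
          + frechet_derivative \<phi> (at x) i * \<psi> x"])
      (use Suc * in \<open>auto intro!: has_derivative_mult Ck_add simp: frechet_derivative_works[symmetric]\<close>)
qed

lemma Ck_prod: "(\<And>i. i \<in> A \<Longrightarrow> Ck k (\<phi> i)) \<Longrightarrow> Ck k (\<lambda>x. \<Prod>i\<in>A. \<phi> i x)"
  by (induction A rule: infinite_finite_induct) (auto intro: Ck_const Ck_mult)

text \<open>Dividing by powers of \<open>t\<close> makes the family closed under differentiation.\<close>

definition flat :: "nat \<Rightarrow> real \<Rightarrow> real" where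
  "flat m t = (if t > 0 then exp (- 1 / t) / t ^ m else 0)"

lemma flat_eq_mult: "flat m t = t * flat (Suc m) t"
  by (auto simp: flat_def)

text \<open>For positive t the single term of index \<open>Suc m\<close> in the series of
  \<open>exp (1 / t)\<close> outweighs the division by \<open>t ^ m\<close> with one power of t to
  spare. This linear decay, for every m, is what controls the behaviour at 0.\<close>

lemma abs_flat_le: "\<bar>flat m t\<bar> \<le> fact (Suc m) * \<bar>t\<bar>"
proof (cases "t > 0")
  case True
  have "(1 / t) ^ Suc m / fact (Suc m) \<le> exp (1 / t)"
  proof -
    have s: "(\<lambda>n. (1 / t) ^ n / fact n) sums exp (1 / t)"
      using exp_converges[of "1 / t"] by (simp add: divide_inverse mult.commute)
    have "sum (\<lambda>n. (1 / t) ^ n / fact n) {Suc m} \<le> (\<Sum>n. (1 / t) ^ n / fact n)"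
      using s True by (intro sum_le_suminf) (auto simp: sums_iff)
    then show ?thesis using s by (simp add: sums_iff)
  qed
  then have "exp (- (1 / t)) \<le> fact (Suc m) * t ^ Suc m"
    using True by (simp add: exp_minus field_simps del: fact_Suc power_Suc)
  then show ?thesis using True by (simp add: flat_def field_simps del: fact_Suc)
next
  case False
  then have "flat m t = 0" by (simp add: flat_def)
  then show ?thesis by (simp del: fact_Suc)
qed

lemma flat_has_derivative:
  "(flat m has_real_derivative flat (m + 2) t - m * flat (m + 1) t) (at t)"
proof -
  consider "t > 0" | "t < 0" | "t = 0" by linarith
  then show ?thesis
  proof cases
    case 1
    have "((\<lambda>t. exp (- 1 / t) / t ^ m) has_real_derivative flat (m + 2) t - m * flat (m + 1) t) (at t)"
    proof (cases m)
      case 0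
      then show ?thesis using 1
        by (auto intro!: derivative_eq_intros simp: flat_def field_simps power2_eq_square)
    next
      case (Suc n)
      then have "t ^ m = t * t ^ (m - Suc 0)" by simp
      then show ?thesis using 1
        by (auto intro!: derivative_eq_intros simp: flat_def field_simps power2_eq_square)
    qed
    then show ?thesis
      by (rule has_field_derivative_transform_within_open[where S = "{0<..}"])
        (use 1 in \<open>auto simp: flat_def\<close>)
  next
    case 2
    have "((\<lambda>t. 0) has_real_derivative flat (m + 2) t - m * flat (m + 1) t) (at t)"
      using 2 by (auto simp: flat_def)
    then show ?thesis
      by (rule has_field_derivative_transform_within_open[where S = "{..<0}"])
        (use 2 in \<open>auto simp: flat_def\<close>)
  next
    case 3
    \<comment> \<open>At the origin the difference quotient of \<open>flat m\<close> is exactly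
      \<open>flat (Suc m)\<close>, so the linear bound one index higher gives the derivative
      0.\<close>
    have "(flat (Suc m) \<longlongrightarrow> 0) (at 0)"
    proof (rule Lim_null_comparison)
      show "\<forall>\<^sub>F h in at 0. norm (flat (Suc m) h) \<le> fact (Suc (Suc m)) * \<bar>h\<bar>"
        using abs_flat_le[of "Suc m"] by (auto simp del: fact_Suc)
      show "((\<lambda>h::real. fact (Suc (Suc m)) * \<bar>h\<bar>) \<longlongrightarrow> 0) (at 0)"
        by (auto intro!: tendsto_eq_intros)
    qed
    moreover have "flat (Suc m) h = (flat m (0 + h) - flat m 0) / h" if "h \<noteq> 0" for h
      using that flat_eq_mult[of m h] by (auto simp: flat_def)
    ultimately have "((\<lambda>h. (flat m (0 + h) - flat m 0) / h) \<longlongrightarrow> 0) (at 0)"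
      by (subst Lim_cong_within[where g = "flat (Suc m)"]) auto
    then show ?thesis using 3 by (simp add: DERIV_def flat_def)
  qed
qed

text \<open>The index m has to vary in the induction, since differentiation raises it by one and by
  two. The affine argument is the shape of the factors of \<open>bump\<close>.\<close>

lemma Ck_flat: "Ck k (\<lambda>x::'a::euclidean_space. flat m (c + x \<bullet> e))"
proof (induction k arbitrary: m)
  case 0
  have "continuous_on UNIV (flat m)"
    using DERIV_isCont[OF flat_has_derivative] by (simp add: continuous_at_imp_continuous_on)
  then show ?case
    by (auto intro!: continuous_on_compose2[of UNIV "flat m"] continuous_intros)
next
  case (Suc k)
  have "((\<lambda>x::'a. flat m (c + x \<bullet> e)) has_derivative
      (\<lambda>h. (flat (m + 2) (c + x \<bullet> e) + (- real m) * flat (m + 1) (c + x \<bullet> e)) * (h \<bullet> e))) (at x)" for x :: 'a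
  proof -
    have "((\<lambda>x. c + x \<bullet> e) has_derivative (\<lambda>h. h \<bullet> e)) (at x)"
      by (auto intro!: derivative_eq_intros)
    from has_derivative_compose[OF this flat_has_derivative[unfolded has_field_derivative_def]]
    show ?thesis by simp
  qed
  moreover have "Ck k (\<lambda>x::'a. (flat (m + 2) (c + x \<bullet> e) + (- real m) * flat (m + 1) (c + x \<bullet> e)) * (i \<bullet> e))" for i
    by (intro Ck_add Ck_mult Suc Ck_const)
  ultimately show ?case
    by (rule Ck_SucI)
qed

text \<open>Each coordinate contributes one ramp for either face of the box. The scale n steepens
  the ramps: at a point of the open box every factor has the form \<open>exp (- 1 / (t * n))\<close>
  with fixed positive t, so the functions tend pointwise to the indicator of
  \<open>box a b\<close>.\<close>

definition bump :: "'a::euclidean_space \<Rightarrow> 'a \<Rightarrow> nat \<Rightarrow> 'a \<Rightarrow> real" where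
  "bump a b n x = (\<Prod>i\<in>Basis. flat 0 ((x \<bullet> i - a \<bullet> i) * n) * flat 0 ((b \<bullet> i - x \<bullet> i) * n))"

lemma Ck_bump: "Ck k (bump a b n)"
proof -
  have 1: "(x \<bullet> i - a \<bullet> i) * n = - (a \<bullet> i) * n + x \<bullet> (n *\<^sub>R i)"
    and 2: "(b \<bullet> i - x \<bullet> i) * n = (b \<bullet> i) * n + x \<bullet> (- real n *\<^sub>R i)" for x i :: 'a
    by (auto simp: algebra_simps)
  show ?thesis
    unfolding bump_def 1 2 by (intro Ck_prod Ck_mult Ck_flat)
qed

lemma flat_0_bounds: "0 \<le> flat 0 t" "flat 0 t \<le> 1"
  by (auto simp: flat_def)

lemma bump_bounds: "0 \<le> bump a b n x" "bump a b n x \<le> 1"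
  unfolding bump_def by (auto intro!: prod_nonneg prod_le_1 mult_le_one simp: flat_0_bounds)

lemma bump_eq_0: "x \<notin> box a b \<Longrightarrow> bump a b n x = 0"
proof -
  assume "x \<notin> box a b"
  then obtain i where "i \<in> Basis" "\<not> (a \<bullet> i < x \<bullet> i \<and> x \<bullet> i < b \<bullet> i)"
    by (auto simp: box_def)
  then show ?thesis
    by (auto simp: bump_def flat_def prod_zero_iff zero_less_mult_iff not_less intro!: bexI[of _ i])
qed

lemma bump_tendsto: "(\<lambda>n. bump a b n x) \<longlonglongrightarrow> indicator (box a b) x"
proof (cases "x \<in> box a b")
  case True
  have "(\<lambda>n. flat 0 (t * real n)) \<longlonglongrightarrow> 1" if "t > 0" for t
  proof -
    have "(\<lambda>n. exp (- (1 / t) / real n)) \<longlonglongrightarrow> exp 0"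
      by (intro tendsto_exp lim_const_over_n)
    moreover have "\<forall>\<^sub>F n in sequentially. exp (- (1 / t) / real n) = flat 0 (t * real n)"
      using eventually_gt_at_top[of 0] by eventually_elim (use that in \<open>auto simp: flat_def\<close>)
    ultimately show ?thesis using tendsto_cong by force
  qed
  then have "(\<lambda>n. bump a b n x) \<longlonglongrightarrow> (\<Prod>i\<in>(Basis :: 'a set). 1 * 1)"
    unfolding bump_def using True by (intro tendsto_prod tendsto_mult) (auto simp: box_def)
  then show ?thesis using True by simp
qed (simp add: bump_eq_0)

lemma bump_in_test_functions:
  assumes "cbox a b \<subseteq> D" shows "bump a b n \<in> test_functions D"
proof -
  have "closure {x. bump a b n x \<noteq> 0} \<subseteq> cbox a b"
    using bump_eq_0[of _ a b n] box_subset_cbox[of a b] by (intro closure_minimal) auto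
  moreover from this have "compact (closure {x. bump a b n x \<noteq> 0})"
    by (meson bounded_cbox bounded_subset closed_closure compact_eq_bounded_closed)
  ultimately show ?thesis
    using assms Ck_bump[of _ a b n] by (auto simp: test_functions_def)
qed

section \<open>Integration by parts and the fundamental lemma\<close>

text \<open>Moves integrals over D, taken with the completed measure, to Borel integrals over the
  whole space, where translation invariance is at hand.\<close>

lemma integral_lebesgue_on_eq_lborel:
  fixes h :: "'a::euclidean_space \<Rightarrow> real"
  assumes "D \<in> sets lebesgue" "h \<in> borel_measurable borel" "\<And>x. x \<notin> D \<Longrightarrow> h x = 0"
  shows "(\<integral>x. h x \<partial>lebesgue_on D) = (\<integral>x. h x \<partial>lborel)"
proof -
  have "(\<integral>x. h x \<partial>lebesgue_on D) = (\<integral>x. indicator D x *\<^sub>R h x \<partial>lebesgue)"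
    using assms by (intro integral_restrict_space) auto
  also have "(\<lambda>x. indicator D x *\<^sub>R h x) = h"
    using assms(3) by (auto simp: fun_eq_iff indicator_def)
  also have "(\<integral>x. h x \<partial>lebesgue) = (\<integral>x. h x \<partial>lborel)"
    using assms by (intro integral_completion) auto
  finally show ?thesis .
qed

lemma integrable_compact_support:
  fixes h :: "'a::euclidean_space \<Rightarrow> real"
  assumes h: "continuous_on UNIV h" and K: "compact K" "\<And>x. x \<notin> K \<Longrightarrow> h x = 0"
  shows "integrable lborel h"
proof -
  have "integrable lborel (\<lambda>x. indicator K x *\<^sub>R h x)"
    using K(1) h by (intro borel_integrable_compact) (auto intro: continuous_on_subset)
  also have "(\<lambda>x. indicator K x *\<^sub>R h x) = h"
    using K(2) by (auto simp: fun_eq_iff indicator_def)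
  finally show ?thesis .
qed

lemma integrable_lebesgue_on_lborel:
  fixes h :: "'a::euclidean_space \<Rightarrow> real"
  assumes "D \<in> sets lebesgue" "integrable lborel h"
  shows "integrable (lebesgue_on D) h"
proof -
  have "integrable lebesgue h"
    using assms(2) by (simp add: integrable_completion)
  from integrable_mult_indicator[OF assms(1) this] show ?thesis
    using assms(1) by (simp add: integrable_restrict_space)
qed

lemma frechet_derivative_outside_support:
  assumes "closed K" "\<And>x. x \<notin> K \<Longrightarrow> g x = (0::real)" "x \<notin> K"
  shows "frechet_derivative g (at x) e = 0"
proof -
  have "(g has_derivative (\<lambda>_. 0)) (at x)"
    by (rule has_derivative_transform_within_open[where f = "\<lambda>_. 0" and s = "- K"])
      (use assms in auto)
  then show ?thesis by (metis frechet_derivative_at)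
qed

text \<open>By translation invariance every difference quotient of g has integral 0, and dominated
  convergence carries this over to the partial derivative.\<close>

lemma integral_partial_derivative_eq_0:
  fixes g :: "'a::euclidean_space \<Rightarrow> real"
  assumes g: "Ck (Suc 0) g" and K: "compact K" "\<And>x. x \<notin> K \<Longrightarrow> g x = 0" and e: "e \<in> Basis"
  shows "(\<integral>x. frechet_derivative g (at x) e \<partial>lborel) = 0"
proof -
  define g' where "g' x = frechet_derivative g (at x) e" for x
  define d where "d n x = (g (x + inverse (real (Suc n)) *\<^sub>R e) - g x) * real (Suc n)" for n x
  have cont: "continuous_on UNIV g'" using g e by (simp add: g'_def)
  have contg: "continuous_on UNIV g" using g by (rule Ck_continuous)
  have [measurable]: "g \<in> borel_measurable borel" "g' \<in> borel_measurable borel"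
    using cont contg by (auto intro: borel_measurable_continuous_onI)
  have g'0: "g' x = 0" if "x \<notin> K" for x
    using that frechet_derivative_outside_support[OF compact_imp_closed[OF K(1)] K(2)]
    by (auto simp: g'_def)
  have "bounded (g' ` K)"
    using K(1) cont by (meson compact_continuous_image compact_imp_bounded continuous_on_subset top_greatest)
  then obtain b where b: "\<And>x. x \<in> K \<Longrightarrow> \<bar>g' x\<bar> \<le> b" "b > 0"
    by (auto simp: bounded_pos)
  have b': "\<bar>g' x\<bar> \<le> b" for x
    using b g'0[of x] by (cases "x \<in> K") auto
  obtain R where R: "\<And>x. x \<in> K \<Longrightarrow> norm x \<le> R"
    using compact_imp_bounded[OF K(1)] by (auto simp: bounded_iff)
  have deriv: "((\<lambda>t. g (x + t *\<^sub>R e)) has_real_derivative g' (x + t *\<^sub>R e)) (at t)" for x t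
  proof -
    have *: "(g has_derivative frechet_derivative g (at (x + t *\<^sub>R e))) (at (x + t *\<^sub>R e))"
      using g by (simp add: frechet_derivative_works)
    then have lin: "linear (frechet_derivative g (at (x + t *\<^sub>R e)))"
      using has_derivative_linear by blast
    have "((\<lambda>t. x + t *\<^sub>R e) has_derivative (\<lambda>h. h *\<^sub>R e)) (at t)"
      by (auto intro!: derivative_eq_intros)
    from has_derivative_compose[OF this *] show ?thesis
      by (simp add: has_field_derivative_def g'_def linear_cmul[OF lin] mult_commute_abs)
  qed
  have int: "integrable lborel g"
    using contg K by (rule integrable_compact_support)
  have int_shift: "integrable lborel (\<lambda>x. g (x + c))"
    and shift: "(\<integral>x. g (x + c) \<partial>lborel) = (\<integral>x. g x \<partial>lborel)" for c
  proof -
    have "integrable (distr lborel borel ((+) c)) g" using int by (simp add: lborel_distr_plus)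
    then show "integrable lborel (\<lambda>x. g (x + c))"
      by (subst (asm) integrable_distr_eq) (auto simp: add.commute)
    have "(\<integral>x. g x \<partial>lborel) = (\<integral>x. g x \<partial>distr lborel borel ((+) c))" by (simp add: lborel_distr_plus)
    also have "\<dots> = (\<integral>x. g (x + c) \<partial>lborel)" by (subst integral_distr) (auto simp: add.commute)
    finally show "(\<integral>x. g (x + c) \<partial>lborel) = (\<integral>x. g x \<partial>lborel)" by simp
  qed
  have d0: "(\<integral>x. d n x \<partial>lborel) = 0" for n
    unfolding d_def using int int_shift shift by simp
  \<comment> \<open>The shifts have length at most 1. Outside the ball of radius
    \<open>R + 1\<close> both points of the quotient therefore miss K, and inside it the mean value
    theorem bounds the quotient by the bound b of the derivative.\<close>
  have dbound: "\<bar>d n x\<bar> \<le> b * indicator (cball 0 (R + 1)) x" for n x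
  proof (cases "norm x \<le> R + 1")
    case True
    have "\<exists>z. z > 0 \<and> z < inverse (real (Suc n)) \<and>
        g (x + inverse (real (Suc n)) *\<^sub>R e) - g (x + 0 *\<^sub>R e) = (inverse (real (Suc n)) - 0) * g' (x + z *\<^sub>R e)"
      by (rule MVT2) (auto intro: deriv)
    then obtain z where "g (x + inverse (real (Suc n)) *\<^sub>R e) - g x = inverse (real (Suc n)) * g' (x + z *\<^sub>R e)"
      by auto
    then have "d n x = g' (x + z *\<^sub>R e)"
      unfolding d_def by simp
    then show ?thesis using b' True by simp
  next
    case False
    have "norm x \<le> norm (x + inverse (real (Suc n)) *\<^sub>R e) + norm (inverse (real (Suc n)) *\<^sub>R e)"
      by (metis add_diff_cancel_right' norm_triangle_sub norm_minus_commute norm_triangle_ineq4)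
    moreover have "norm (inverse (real (Suc n)) *\<^sub>R e) \<le> 1"
      using e by (simp add: inverse_le_1_iff)
    ultimately have "\<not> norm x \<le> R" "\<not> norm (x + inverse (real (Suc n)) *\<^sub>R e) \<le> R"
      using False by linarith+
    then have "x \<notin> K" "x + inverse (real (Suc n)) *\<^sub>R e \<notin> K"
      using R by blast+
    then show ?thesis using b K(2) by (simp add: d_def)
  qed
  have dlim: "(\<lambda>n. d n x) \<longlonglongrightarrow> g' x" for x
  proof -
    have "((\<lambda>h. (g (x + h *\<^sub>R e) - g x) / h) \<longlongrightarrow> g' x) (at 0)"
      using deriv[of x 0] by (simp add: DERIV_def)
    moreover have "filterlim (\<lambda>n. inverse (real (Suc n))) (at 0) sequentially"
      unfolding filterlim_at using LIMSEQ_inverse_real_of_nat by auto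
    ultimately have "((\<lambda>n. (g (x + inverse (real (Suc n)) *\<^sub>R e) - g x) / inverse (real (Suc n))) \<longlonglongrightarrow> g' x)"
      by (rule filterlim_compose)
    then show ?thesis by (simp add: d_def field_simps)
  qed
  have "(\<lambda>n. \<integral>x. d n x \<partial>lborel) \<longlonglongrightarrow> (\<integral>x. g' x \<partial>lborel)"
  proof (rule integral_dominated_convergence[where w = "\<lambda>x. b * indicator (cball 0 (R + 1)) x"])
    show "integrable lborel (\<lambda>x. b * indicator (cball 0 (R + 1)) x :: real)"
      using emeasure_lborel_cball_finite[of 0 "R + 1"]
      by (intro integrable_mult_right integrable_real_indicator) auto
    show "d n \<in> borel_measurable lborel" for n unfolding d_def by measurable
  qed (auto simp: dlim dbound)
  then show ?thesis using d0 LIMSEQ_unique[OF _ tendsto_const[of 0]] by (auto simp: g'_def)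
qed

lemma test_functionsD:
  assumes "\<phi> \<in> test_functions D"
  shows "Ck k \<phi>" "x \<notin> D \<Longrightarrow> \<phi> x = 0" "\<phi> differentiable (at x)" "continuous_on UNIV \<phi>"
    "e \<in> Basis \<Longrightarrow> continuous_on UNIV (\<lambda>x. frechet_derivative \<phi> (at x) e)"
proof -
  show *: "Ck k \<phi>" for k
    using assms by (auto simp: test_functions_def)
  show "x \<notin> D \<Longrightarrow> \<phi> x = 0"
    using assms closure_subset[of "{x. \<phi> x \<noteq> 0}"] by (auto simp: test_functions_def)
  show "\<phi> differentiable (at x)" "e \<in> Basis \<Longrightarrow> continuous_on UNIV (\<lambda>x. frechet_derivative \<phi> (at x) e)"
    using *[of "Suc 0"] by auto
  show "continuous_on UNIV \<phi>" using *[of 0] by simp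
qed

lemma test_functions_support:
  assumes "\<phi> \<in> test_functions D"
  obtains K where "compact K" "K \<subseteq> D" "\<And>x. x \<notin> K \<Longrightarrow> \<phi> x = 0"
    "\<And>x e. x \<notin> K \<Longrightarrow> frechet_derivative \<phi> (at x) e = 0"
proof -
  let ?K = "closure {x. \<phi> x \<noteq> 0}"
  have 0: "\<phi> x = 0" if "x \<notin> ?K" for x
    using that closure_subset[of "{x. \<phi> x \<noteq> 0}"] by blast
  show ?thesis
  proof
    show "compact ?K" "?K \<subseteq> D" using assms unfolding test_functions_def by blast+
    show "frechet_derivative \<phi> (at x) e = 0" if "x \<notin> ?K" for x e
      using frechet_derivative_outside_support[OF closed_closure 0 that] .
  qed (rule 0)
qed

lemma frechet_derivative_mult:
  fixes \<phi> \<psi> :: "'a::real_normed_vector \<Rightarrow> real"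
  assumes "\<phi> differentiable (at x)" "\<psi> differentiable (at x)"
  shows "frechet_derivative (\<lambda>x. \<phi> x * \<psi> x) (at x) e =
    \<phi> x * frechet_derivative \<psi> (at x) e + frechet_derivative \<phi> (at x) e * \<psi> x"
proof -
  have "((\<lambda>x. \<phi> x * \<psi> x) has_derivative
      (\<lambda>e. \<phi> x * frechet_derivative \<psi> (at x) e + frechet_derivative \<phi> (at x) e * \<psi> x)) (at x)"
    using assms by (intro has_derivative_mult) (auto simp: frechet_derivative_works[symmetric])
  from frechet_derivative_at[OF this, symmetric] show ?thesis by simp
qed

text \<open>The product inherits the compact support of \<psi>, so its partial derivative has
  integral 0. The asymmetric assumptions admit \<open>x \<bullet> e * \<phi>\<close> as the other
  factor in the Poincare estimate.\<close>

lemma integration_by_parts_lborel: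
  fixes \<phi> \<psi> :: "'a::euclidean_space \<Rightarrow> real"
  assumes \<phi>: "Ck (Suc 0) \<phi>" and \<psi>: "\<psi> \<in> test_functions D" and e: "e \<in> Basis"
  shows "(\<integral>x. \<phi> x * frechet_derivative \<psi> (at x) e \<partial>lborel) =
    - (\<integral>x. frechet_derivative \<phi> (at x) e * \<psi> x \<partial>lborel)"
proof -
  note \<psi>' = test_functionsD[OF \<psi>]
  obtain K where K: "compact K" "\<And>x. x \<notin> K \<Longrightarrow> \<psi> x = 0"
    "\<And>x e. x \<notin> K \<Longrightarrow> frechet_derivative \<psi> (at x) e = 0"
    using test_functions_support[OF \<psi>] by metis
  have "continuous_on UNIV (\<lambda>x. frechet_derivative \<phi> (at x) e)"
    using \<phi> e by auto
  then have int: "integrable lborel (\<lambda>x. \<phi> x * frechet_derivative \<psi> (at x) e)"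
    "integrable lborel (\<lambda>x. frechet_derivative \<phi> (at x) e * \<psi> x)"
    using \<psi>'(4,5) e Ck_continuous[OF \<phi>] K
    by (auto intro!: integrable_compact_support[where K = K] continuous_on_mult)
  have "0 = (\<integral>x. frechet_derivative (\<lambda>x. \<phi> x * \<psi> x) (at x) e \<partial>lborel)"
    using \<psi>'(1) e K by (intro integral_partial_derivative_eq_0[where K = K, symmetric] Ck_mult \<phi>) auto
  also have "\<dots> = (\<integral>x. \<phi> x * frechet_derivative \<psi> (at x) e + frechet_derivative \<phi> (at x) e * \<psi> x \<partial>lborel)"
    using \<psi>'(3) \<phi> by (subst frechet_derivative_mult) auto
  also have "\<dots> = (\<integral>x. \<phi> x * frechet_derivative \<psi> (at x) e \<partial>lborel) + (\<integral>x. frechet_derivative \<phi> (at x) e * \<psi> x \<partial>lborel)"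
    using int by simp
  finally show ?thesis by simp
qed

definition grad :: "('a::euclidean_space \<Rightarrow> real) \<Rightarrow> 'a \<Rightarrow> 'a" where
  "grad \<phi> x = (\<Sum>i\<in>Basis. frechet_derivative \<phi> (at x) i *\<^sub>R i)"

lemma grad_inner: "i \<in> Basis \<Longrightarrow> grad \<phi> x \<bullet> i = frechet_derivative \<phi> (at x) i"
  by (simp add: grad_def inner_sum_left inner_Basis if_distrib[of "\<lambda>t. _ * t"] sum.delta cong: if_cong)

lemma continuous_grad: "\<phi> \<in> test_functions D \<Longrightarrow> continuous_on UNIV (grad \<phi>)"
  unfolding grad_def by (intro continuous_intros test_functionsD)

lemma integrable_test_function:
  assumes \<phi>: "\<phi> \<in> test_functions D"
  shows "integrable lborel (\<lambda>x. (\<phi> x)\<^sup>2)" "integrable lborel (\<lambda>x. (norm (grad \<phi> x))\<^sup>2)"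
proof -
  obtain K where K: "compact K" "\<And>x. x \<notin> K \<Longrightarrow> \<phi> x = 0"
    "\<And>x e. x \<notin> K \<Longrightarrow> frechet_derivative \<phi> (at x) e = 0"
    using test_functions_support[OF \<phi>] by metis
  have "grad \<phi> x = 0" if "x \<notin> K" for x using K(3)[OF that] by (simp add: grad_def)
  then show "integrable lborel (\<lambda>x. (\<phi> x)\<^sup>2)" "integrable lborel (\<lambda>x. (norm (grad \<phi> x))\<^sup>2)"
    using K continuous_grad[OF \<phi>] test_functionsD(4)[OF \<phi>]
    by (auto intro!: integrable_compact_support[where K = K] continuous_on_power continuous_on_norm)
qed

lemma is_weak_gradient_grad:
  assumes D: "D \<in> sets lebesgue" and \<phi>: "\<phi> \<in> test_functions D"
  shows "is_weak_gradient D \<phi> (grad \<phi>)"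
  unfolding is_weak_gradient_def
proof (intro ballI)
  fix \<psi> and e :: 'a assume \<psi>: "\<psi> \<in> test_functions D" and e: "e \<in> Basis"
  have [measurable]: "\<phi> \<in> borel_measurable borel" "\<psi> \<in> borel_measurable borel"
    "(\<lambda>x. frechet_derivative \<phi> (at x) e) \<in> borel_measurable borel"
    "(\<lambda>x. frechet_derivative \<psi> (at x) e) \<in> borel_measurable borel"
    using test_functionsD(4,5)[OF \<phi>] test_functionsD(4,5)[OF \<psi>] e
    by (auto intro!: borel_measurable_continuous_onI)
  show "(\<integral>x. \<phi> x * frechet_derivative \<psi> (at x) e \<partial>lebesgue_on D) = - (\<integral>x. grad \<phi> x \<bullet> e * \<psi> x \<partial>lebesgue_on D)"
    using integration_by_parts_lborel[OF test_functionsD(1)[OF \<phi>] \<psi> e] e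
    by (simp add: grad_inner)
      (subst (1 2) integral_lebesgue_on_eq_lborel, use D test_functionsD(2)[OF \<phi>] test_functionsD(2)[OF \<psi>] in auto)
qed

lemma Ck_inner: "Ck k (\<lambda>x. x \<bullet> e)"
proof (cases k)
  case (Suc j)
  show ?thesis unfolding Suc
    by (rule Ck_SucI[where \<phi>' = "\<lambda>_ h. h \<bullet> e"]) (auto intro!: derivative_eq_intros Ck_const)
qed (auto intro!: continuous_intros)

text \<open>The coordinate \<open>x \<bullet> e\<close> has derivative 1 in direction e, so
  integration by parts expresses the integral of the square of \<phi> through
  \<open>x \<bullet> e\<close>, \<phi> and its derivative. Young's inequality leaves half of the
  square to be absorbed on the left, and \<open>\<bar>x \<bullet> e\<bar> \<le> R\<close> gives the
  constant \<open>4 * R\<^sup>2\<close>.\<close>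

lemma poincare_test_function_lborel:
  fixes \<phi> :: "'a::euclidean_space \<Rightarrow> real"
  assumes \<phi>: "\<phi> \<in> test_functions D" and R: "\<And>x. x \<in> D \<Longrightarrow> norm x \<le> R" and R0: "0 \<le> R"
  shows "(\<integral>x. (\<phi> x)\<^sup>2 \<partial>lborel) \<le> 4 * R\<^sup>2 * (\<integral>x. (norm (grad \<phi> x))\<^sup>2 \<partial>lborel)"
proof -
  obtain e :: 'a where e: "e \<in> Basis" using nonempty_Basis by blast
  note \<phi>' = test_functionsD[OF \<phi>]
  let ?d = "\<lambda>x. frechet_derivative \<phi> (at x) e"
  obtain K where K: "compact K" "\<And>x. x \<notin> K \<Longrightarrow> \<phi> x = 0"
    using test_functions_support[OF \<phi>] by metis
  have "integrable lborel (\<lambda>x. (x \<bullet> e) * \<phi> x * ?d x)"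
    using \<phi>'(4,5) e K
    by (intro integrable_compact_support[where K = K] continuous_on_mult continuous_intros) auto
  note int = integrable_test_function[OF \<phi>] this
  have d: "frechet_derivative (\<lambda>x. x \<bullet> e * \<phi> x) (at x) e = (x \<bullet> e) * ?d x + \<phi> x" for x
  proof -
    have "frechet_derivative (\<lambda>x. x \<bullet> e) (at x) = (\<lambda>h. h \<bullet> e)"
      by (intro frechet_derivative_at[symmetric]) (auto intro!: derivative_eq_intros)
    then show ?thesis
      using e \<phi>'(3) by (subst frechet_derivative_mult) (auto simp: inner_same_Basis)
  qed
  have "(\<integral>x. (x \<bullet> e) * \<phi> x * ?d x \<partial>lborel) =
      - (\<integral>x. ((x \<bullet> e) * ?d x + \<phi> x) * \<phi> x \<partial>lborel)"
    using integration_by_parts_lborel[OF Ck_mult[OF Ck_inner \<phi>'(1)] \<phi> e, of e] unfolding d by simp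
  also have "(\<integral>x. ((x \<bullet> e) * ?d x + \<phi> x) * \<phi> x \<partial>lborel) =
      (\<integral>x. (x \<bullet> e) * \<phi> x * ?d x + (\<phi> x)\<^sup>2 \<partial>lborel)"
    by (simp add: algebra_simps power2_eq_square)
  also have "\<dots> = (\<integral>x. (x \<bullet> e) * \<phi> x * ?d x \<partial>lborel) + (\<integral>x. (\<phi> x)\<^sup>2 \<partial>lborel)"
    using int by simp
  finally have "(\<integral>x. (\<phi> x)\<^sup>2 \<partial>lborel) = (\<integral>x. - 2 * ((x \<bullet> e) * \<phi> x * ?d x) \<partial>lborel)"
    by simp
  also have "\<dots> \<le> (\<integral>x. (\<phi> x)\<^sup>2 / 2 + 2 * R\<^sup>2 * (norm (grad \<phi> x))\<^sup>2 \<partial>lborel)"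
  proof (intro integral_mono)
    fix x
    show "- 2 * ((x \<bullet> e) * \<phi> x * ?d x) \<le> (\<phi> x)\<^sup>2 / 2 + 2 * R\<^sup>2 * (norm (grad \<phi> x))\<^sup>2"
    proof (cases "x \<in> D")
      case True
      have "\<bar>x \<bullet> e\<bar> \<le> R" using Basis_le_norm[OF e, of x] R[OF True] by simp
      moreover have "\<bar>?d x\<bar> \<le> norm (grad \<phi> x)"
        using Basis_le_norm[OF e, of "grad \<phi> x"] by (simp add: grad_inner e)
      ultimately have "\<bar>x \<bullet> e\<bar> * \<bar>?d x\<bar> \<le> R * norm (grad \<phi> x)" by (intro mult_mono) (auto simp: R0)
      then have "((x \<bullet> e) * ?d x)\<^sup>2 \<le> (R * norm (grad \<phi> x))\<^sup>2"
        by (metis abs_ge_zero abs_mult power2_abs power_mono)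
      \<comment> \<open>The factor 2 in the square is the Young weight for which the square of
        \<phi> comes out with coefficient 1/2.\<close>
      moreover have "0 \<le> (\<phi> x + 2 * ((x \<bullet> e) * ?d x))\<^sup>2" by simp
      ultimately show ?thesis by (simp add: power2_eq_square algebra_simps)
    next
      case False
      then show ?thesis using \<phi>'(2) by simp
    qed
  qed (use int in simp_all)
  also have "\<dots> = (\<integral>x. (\<phi> x)\<^sup>2 \<partial>lborel) / 2 + 2 * R\<^sup>2 * (\<integral>x. (norm (grad \<phi> x))\<^sup>2 \<partial>lborel)"
    using int by simp
  finally show ?thesis by simp
qed

text \<open>Bumps tend to indicators of boxes, so g has integral 0 over every box with closure in D.
  Boxes are an intersection-stable generator of the Borel sets; hence, locally, the integrals of g
  over all measurable sets vanish, and so does g a.e.\<close>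

lemma fundamental_lemma_calculus_of_variations:
  fixes g :: "'a::euclidean_space \<Rightarrow> real"
  assumes D: "open D" and g: "integrable (lebesgue_on D) g"
    and test: "\<And>\<phi>. \<phi> \<in> test_functions D \<Longrightarrow> (\<integral>x. g x * \<phi> x \<partial>lebesgue_on D) = 0"
  shows "AE x in lebesgue_on D. g x = 0"
proof -
  have DS: "D \<in> sets lebesgue" using D by simp
  define G where "G x = indicator D x * g x" for x
  have G: "integrable lebesgue G"
    using g DS unfolding G_def by (simp add: integrable_restrict_space)
  have [measurable]: "G \<in> borel_measurable lebesgue" using G by simp
  have box0: "(\<integral>x. indicator (box a b) x * G x \<partial>lebesgue) = 0" if "cbox a b \<subseteq> D" for a b
  proof -
    have [measurable]: "bump a b n \<in> borel_measurable lebesgue" for n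
      using Ck_continuous[OF Ck_bump[of 0 a b n]]
      by (intro measurable_completion) (simp add: borel_measurable_continuous_onI)
    have "(\<lambda>n. \<integral>x. bump a b n x * G x \<partial>lebesgue) \<longlonglongrightarrow> (\<integral>x. indicator (box a b) x * G x \<partial>lebesgue)"
    proof (rule integral_dominated_convergence[where w = "\<lambda>x. \<bar>G x\<bar>"])
      show "AE x in lebesgue. norm (bump a b n x * G x) \<le> \<bar>G x\<bar>" for n
        using bump_bounds[of a b n] by (intro AE_I2) (auto simp: abs_mult intro!: mult_left_le_one_le)
      show "(\<lambda>x. indicator (box a b) x * G x) \<in> borel_measurable lebesgue"
        using integrable_mult_indicator[OF _ G, of "box a b"] by simp
    qed (use G in \<open>auto intro!: tendsto_mult bump_tendsto\<close>)
    moreover have "(\<integral>x. bump a b n x * G x \<partial>lebesgue) = 0" for n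
      using test[OF bump_in_test_functions[OF that, of n]] DS
      by (simp add: integral_restrict_space G_def mult_ac)
    ultimately show ?thesis by (simp add: LIMSEQ_const_iff)
  qed
  have loc: "negligible {x \<in> D \<inter> box a b. g x \<noteq> 0}" if ab: "cbox a b \<subseteq> D" for a b
  proof -
    \<comment> \<open>Cutting g down to one box with closure in D lets the induction over sets run
      on the whole space: H has total integral 0, which serves the complements, and every box meets
      the fixed one in a box to which \<open>box0\<close> applies.\<close>
    define H where "H x = indicator (box a b) x * G x" for x
    have H: "integrable lebesgue H"
      using integrable_mult_indicator[OF _ G, of "box a b"] unfolding H_def by simp
    have [measurable]: "H \<in> borel_measurable lebesgue" using H by simp
    have intA: "integrable lebesgue (\<lambda>x. indicator A x * H x)" if "A \<in> sets lebesgue" for A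
      using integrable_mult_indicator[OF that H] by simp
    have "(\<integral>x. indicator A x * H x \<partial>lebesgue) = 0" if "A \<in> sigma_sets UNIV (range (\<lambda>(a, b). box a b))" for A :: "'a set"
    proof (rule sigma_sets_induct_disjoint[OF _ _ that])
      show "Int_stable (range (\<lambda>(a, b). box a b :: 'a set))"
      proof -
        have "box c d \<in> range (\<lambda>(a, b). box a b)" for c d :: 'a
          by (rule range_eqI[of _ _ "(c, d)"]) simp
        then show ?thesis by (auto intro!: Int_stableI simp: box_Int_box)
      qed
      show "(\<integral>x. indicator A x * H x \<partial>lebesgue) = 0" if A: "A \<in> range (\<lambda>(a, b). box a b)" for A
      proof -
        obtain c d where cd: "A = box c d" using A by auto
        obtain a' b' where ab': "box c d \<inter> box a b = box a' b'" "cbox c d \<inter> cbox a b = cbox a' b'"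
          using box_Int_box[of c d a b] Int_interval[of c d a b] by blast
        have "(\<integral>x. indicator A x * H x \<partial>lebesgue) = (\<integral>x. indicator (box a' b') x * G x \<partial>lebesgue)"
          unfolding cd H_def ab'(1)[symmetric] by (simp add: indicator_inter_arith mult_ac)
        also have "\<dots> = 0" using ab ab' by (intro box0) auto
        finally show ?thesis .
      qed
      have borelS: "A \<in> sets lebesgue" if "A \<in> sigma_sets UNIV (range (\<lambda>(a, b). box a b))" for A :: "'a set"
        using that by (intro sets_completionI_sets) (simp add: borel_eq_box)
      have "(\<integral>x. H x \<partial>lebesgue) = 0" unfolding H_def by (rule box0[OF ab])
      then show "(\<integral>x. indicator (UNIV - A) x * H x \<partial>lebesgue) = 0"
        if "A \<in> sigma_sets UNIV (range (\<lambda>(a, b). box a b))" "(\<integral>x. indicator A x * H x \<partial>lebesgue) = 0" for A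
      proof -
        have "(\<lambda>x. indicator (UNIV - A) x * H x) = (\<lambda>x. H x - indicator A x * H x)"
          by (auto simp: fun_eq_iff indicator_def)
        then show ?thesis
          using that(2) H intA[OF borelS[OF that(1)]] \<open>(\<integral>x. H x \<partial>lebesgue) = 0\<close> by simp
      qed
      show "(\<integral>x. indicator (\<Union>i. A i) x * H x \<partial>lebesgue) = 0"
        if "disjoint_family A" "range A \<subseteq> sigma_sets UNIV (range (\<lambda>(a, b). box a b))"
          "\<And>i::nat. (\<integral>x. indicator (A i) x * H x \<partial>lebesgue) = 0" for A
      proof -
        have AS: "A i \<in> sets lebesgue" for i using that(2) by (intro borelS) auto
        then have US: "(\<Union>i. A i) \<in> sets lebesgue" by auto
        have "set_lebesgue_integral lebesgue (\<Union>i. A i) H = (\<Sum>i. set_lebesgue_integral lebesgue (A i) H)"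
          using AS that(1) intA[OF US]
          by (intro lebesgue_integral_countable_add) (auto simp: disjoint_family_on_def set_integrable_def)
        then show ?thesis using that(3) by (simp add: set_lebesgue_integral_def)
      qed
    qed auto
    then have borel0: "(\<integral>x. indicator A x * H x \<partial>lebesgue) = 0" if "A \<in> sets borel" for A
      using that by (simp add: borel_eq_box)
    have "AE x in lebesgue. H x = 0"
    proof (rule density_unique_real)
      fix A :: "'a set" assume A: "A \<in> sets lebesgue"
      \<comment> \<open>The induction covers Borel sets only; a Lebesgue set agrees with its Borel
        main part up to a null set.\<close>
      have S: "main_part lborel A \<in> sets borel" using main_part_sets[OF A] by simp
      have "AE x in lebesgue. x \<in> main_part lborel A \<longleftrightarrow> x \<in> A"
        using AE_in_main_part[OF A] by (rule AE_completion)
      then have "AE x in lebesgue. indicator A x * H x = indicator (main_part lborel A) x * H x"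
        by eventually_elim (auto simp: indicator_def)
      then have "(\<integral>x. indicator A x * H x \<partial>lebesgue) = (\<integral>x. indicator (main_part lborel A) x * H x \<partial>lebesgue)"
        using intA[of A] intA[of "main_part lborel A"] A S by (intro integral_cong_AE) auto
      then show "(LINT x:A|lebesgue. H x) = (LINT x:A|lebesgue. 0)"
        using borel0[OF S] by (simp add: set_lebesgue_integral_def)
    qed (use H in auto)
    then have "{x \<in> space lebesgue. H x \<noteq> 0} \<in> null_sets lebesgue"
      by (simp add: completion.AE_iff_null_sets)
    then have "negligible {x. H x \<noteq> 0}" by (simp add: negligible_iff_null_sets)
    then show ?thesis
      by (rule negligible_subset) (auto simp: H_def G_def)
  qed
  \<comment> \<open>Negligibility is a local property, so it is enough to have one box around each
    point of D.\<close>
  have "negligible {x \<in> D. g x \<noteq> 0}"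
    unfolding locally_negligible_alt[of "{x \<in> D. g x \<noteq> 0}"]
  proof
    fix x assume x: "x \<in> {x \<in> D. g x \<noteq> 0}"
    then have "x \<in> D" by simp
    obtain a b where ab: "cbox a b \<subseteq> D" "x \<in> box a b"
      by (rule open_contains_cbox[OF D \<open>x \<in> D\<close>]) (rule that)
    have "{x \<in> D. g x \<noteq> 0} \<inter> box a b = {x \<in> D \<inter> box a b. g x \<noteq> 0}" by auto
    then show "\<exists>U. openin (top_of_set {x \<in> D. g x \<noteq> 0}) U \<and> x \<in> U \<and> negligible U"
    proof (intro exI conjI)
      show "openin (top_of_set {x \<in> D. g x \<noteq> 0}) ({x \<in> D. g x \<noteq> 0} \<inter> box a b)"
        unfolding openin_open by (intro exI[of _ "box a b"]) (simp add: open_box)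
      show "negligible ({x \<in> D. g x \<noteq> 0} \<inter> box a b)"
        using loc[OF ab(1)] \<open>_ = {x \<in> D \<inter> box a b. g x \<noteq> 0}\<close> by simp
    qed (use x ab in auto)
  qed
  then have "AE x in lebesgue. x \<notin> {x \<in> D. g x \<noteq> 0}"
    by (intro AE_not_in) (simp add: negligible_iff_null_sets)
  then show ?thesis
    using DS by (subst AE_restrict_space_iff) auto
qed

section \<open>Weak gradients and the Poincare inequality\<close>

text \<open>The discriminant criterion. It yields the Cauchy-Schwarz inequality in L2 and for the
  energy form, and also the approximate variational equation along a minimising sequence. The case c
  = 0 matters because that form is only semidefinite.\<close>

lemma quadratic_nonneg_imp_le:
  fixes a b c :: real
  assumes nonneg: "\<And>t. 0 \<le> a + 2 * t * b + t\<^sup>2 * c" and c: "0 \<le> c"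
  shows "b\<^sup>2 \<le> a * c"
proof (cases "c = 0")
  case True
  have "b = 0"
  proof (rule ccontr)
    assume b: "b \<noteq> 0"
    \<comment> \<open>At this t the affine expression \<open>a + 2 * t * b\<close> takes the value
      -1.\<close>
    define t where "t = - (a + 1) / (2 * b)"
    have "2 * t * b = - (a + 1)" using b by (simp add: t_def)
    moreover have "0 \<le> a + 2 * t * b" using nonneg[of t] True by simp
    ultimately show False by linarith
  qed
  then show ?thesis using True by simp
next
  case False
  then have "0 \<le> c * (a + 2 * (- b / c) * b + (- b / c)\<^sup>2 * c)"
    using nonneg[of "- b / c"] c by (intro mult_nonneg_nonneg) auto
  also have "\<dots> = a * c - b\<^sup>2" using False by (simp add: field_simps power2_eq_square)
  finally show ?thesis by simp
qed

lemma norm_add_power2_le: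
  fixes a b :: "'b::real_normed_vector"
  shows "(norm (a + b))\<^sup>2 \<le> 2 * (norm a)\<^sup>2 + 2 * (norm b)\<^sup>2"
proof -
  have "(norm (a + b))\<^sup>2 \<le> (norm a + norm b)\<^sup>2"
    by (intro power_mono norm_triangle_ineq) simp
  also have "\<dots> \<le> 2 * (norm a)\<^sup>2 + 2 * (norm b)\<^sup>2"
    using zero_le_power2[of "norm a - norm b"] by (simp add: power2_eq_square algebra_simps)
  finally show ?thesis .
qed

lemma abs_mult_le_sum_squares: "\<bar>x * y\<bar> \<le> x\<^sup>2 + (y :: real)\<^sup>2"
  using sum_squares_bound[of "\<bar>x\<bar>" "\<bar>y\<bar>"] mult_nonneg_nonneg[of "\<bar>x\<bar>" "\<bar>y\<bar>"] unfolding abs_mult power2_abs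
  by linarith

section \<open>Square-integrable functions on a bounded domain\<close>

locale bounded_domain =
  fixes D :: "'a::euclidean_space set"
  assumes open_D: "open D" and bounded_D: "bounded D" and nonempty_D: "D \<noteq> {}"
begin

lemma D_sets [measurable, simp]: "D \<in> sets lebesgue"
  using open_D by simp

lemma finite_D: "finite_measure (lebesgue_on D)"
proof
  have "emeasure lebesgue D < \<infinity>"
    using bounded_set_imp_lmeasurable[OF bounded_D] open_D by (auto simp: fmeasurable_def)
  then show "emeasure (lebesgue_on D) (space (lebesgue_on D)) \<noteq> \<infinity>"
    by (simp add: emeasure_restrict_space space_restrict_space)
qed

sublocale DM: finite_measure "lebesgue_on D" by (rule finite_D)

text \<open>A nonempty open set is not negligible. Without this, a statement holding a.e. in D would
  say nothing about quantities that depend on y alone.\<close>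

lemma emeasure_D_pos: "emeasure (lebesgue_on D) (space (lebesgue_on D)) \<noteq> 0"
proof
  assume "emeasure (lebesgue_on D) (space (lebesgue_on D)) = 0"
  then have "negligible D"
    by (simp add: emeasure_restrict_space space_restrict_space negligible_iff_null_sets null_sets_def)
  then show False using open_not_negligible[OF open_D nonempty_D] by simp
qed

lemma L2_onD:
  assumes "u \<in> L2_on D"
  shows "u \<in> borel_measurable (lebesgue_on D)" "integrable (lebesgue_on D) (\<lambda>x. (norm (u x))\<^sup>2)"
  using assms by (auto simp: L2_on_def)

lemma L2_norm_power2: "(L2_norm D u)\<^sup>2 = (\<integral>x. (norm (u x))\<^sup>2 \<partial>lebesgue_on D)"
  by (simp add: L2_norm_def integral_nonneg_AE)

lemma L2_norm_nonneg: "0 \<le> L2_norm D u"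
  by (simp add: L2_norm_def integral_nonneg_AE)

text \<open>Squared norms with the constant 2 take the place of the triangle inequality from here
  on; limits and Cauchy sequences do not feel the factor.\<close>

lemma L2_add:
  fixes u v :: "'a \<Rightarrow> 'b::euclidean_space"
  assumes "u \<in> L2_on D" "v \<in> L2_on D"
  shows "(\<lambda>x. u x + v x) \<in> L2_on D"
    and "(L2_norm D (\<lambda>x. u x + v x))\<^sup>2 \<le> 2 * (L2_norm D u)\<^sup>2 + 2 * (L2_norm D v)\<^sup>2"
proof -
  note [measurable] = L2_onD(1)[OF assms(1)] L2_onD(1)[OF assms(2)]
  note int = L2_onD(2)[OF assms(1)] L2_onD(2)[OF assms(2)]
  have int2: "integrable (lebesgue_on D) (\<lambda>x. 2 * (norm (u x))\<^sup>2 + 2 * (norm (v x))\<^sup>2)"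
    using int by simp
  have int3: "integrable (lebesgue_on D) (\<lambda>x. (norm (u x + v x))\<^sup>2)"
    using int2 by (rule Bochner_Integration.integrable_bound) (auto simp: norm_add_power2_le)
  then show "(\<lambda>x. u x + v x) \<in> L2_on D"
    by (simp add: L2_on_def)
  have "(L2_norm D (\<lambda>x. u x + v x))\<^sup>2 \<le> (\<integral>x. 2 * (norm (u x))\<^sup>2 + 2 * (norm (v x))\<^sup>2 \<partial>lebesgue_on D)"
    unfolding L2_norm_power2 by (intro integral_mono int3 int2 norm_add_power2_le)
  then show "(L2_norm D (\<lambda>x. u x + v x))\<^sup>2 \<le> 2 * (L2_norm D u)\<^sup>2 + 2 * (L2_norm D v)\<^sup>2"
    using int by (simp add: L2_norm_power2)
qed

lemma L2_scale:
  fixes u :: "'a \<Rightarrow> 'b::euclidean_space"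
  assumes "u \<in> L2_on D"
  shows "(\<lambda>x. c *\<^sub>R u x) \<in> L2_on D" and "(L2_norm D (\<lambda>x. c *\<^sub>R u x))\<^sup>2 = c\<^sup>2 * (L2_norm D u)\<^sup>2"
  using L2_onD[OF assms] by (auto simp: L2_on_def power_mult_distrib L2_norm_power2)

lemma L2_scale_real:
  "u \<in> L2_on D \<Longrightarrow> (\<lambda>x. c * u x :: real) \<in> L2_on D"
  using L2_scale[of u c] by simp

lemma L2_diff:
  fixes u v :: "'a \<Rightarrow> 'b::euclidean_space"
  assumes "u \<in> L2_on D" "v \<in> L2_on D"
  shows "(\<lambda>x. u x - v x) \<in> L2_on D"
  using L2_add(1)[OF assms(1) L2_scale(1)[OF assms(2), of "- 1"]] by simp

lemma L2_norm_triangle: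
  fixes u v w :: "'a \<Rightarrow> 'b::euclidean_space"
  assumes "u \<in> L2_on D" "v \<in> L2_on D" "w \<in> L2_on D"
  shows "(L2_norm D (\<lambda>x. u x - w x))\<^sup>2 \<le> 2 * (L2_norm D (\<lambda>x. u x - v x))\<^sup>2 + 2 * (L2_norm D (\<lambda>x. v x - w x))\<^sup>2"
  using L2_add(2)[OF L2_diff[OF assms(1,2)] L2_diff[OF assms(2,3)]] by simp

lemma L2_norm_minus_commute:
  "L2_norm D (\<lambda>x. u x - v x) = L2_norm D (\<lambda>x. v x - u x :: 'b::euclidean_space)"
  by (simp add: L2_norm_def norm_minus_commute)

lemma L2_norm_cong_AE:
  fixes u v :: "'a \<Rightarrow> 'b::euclidean_space"
  assumes "u \<in> L2_on D" "v \<in> L2_on D" "AE x in lebesgue_on D. u x = v x"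
  shows "L2_norm D u = L2_norm D v"
proof -
  have [measurable]: "u \<in> borel_measurable (lebesgue_on D)" "v \<in> borel_measurable (lebesgue_on D)"
    using assms L2_onD by blast+
  show ?thesis
    unfolding L2_norm_def by (intro arg_cong[where f = sqrt] integral_cong_AE) (use assms(3) in auto)
qed

lemma L2_inner:
  fixes u v :: "'a \<Rightarrow> 'b::euclidean_space"
  assumes "u \<in> L2_on D" "v \<in> L2_on D"
  shows "integrable (lebesgue_on D) (\<lambda>x. u x \<bullet> v x)"
proof -
  note [measurable] = L2_onD(1)[OF assms(1)] L2_onD(1)[OF assms(2)]
  have "integrable (lebesgue_on D) (\<lambda>x. (norm (u x))\<^sup>2 + (norm (v x))\<^sup>2)"
    using L2_onD(2)[OF assms(1)] L2_onD(2)[OF assms(2)] by simp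
  then show ?thesis
  proof (rule Bochner_Integration.integrable_bound)
    have "norm (u x \<bullet> v x) \<le> norm ((norm (u x))\<^sup>2 + (norm (v x))\<^sup>2)" for x
      using Cauchy_Schwarz_ineq2[of "u x" "v x"] sum_squares_bound[of "norm (u x)" "norm (v x)"]
        mult_nonneg_nonneg[OF norm_ge_zero norm_ge_zero, of "u x" "v x"]
      by (simp add: power2_eq_square del: mult_nonneg_nonneg)
    then show "AE x in lebesgue_on D. norm (u x \<bullet> v x) \<le> norm ((norm (u x))\<^sup>2 + (norm (v x))\<^sup>2)" by simp
  qed measurable
qed

lemma L2_inner_real:
  fixes u v :: "'a \<Rightarrow> real"
  assumes "u \<in> L2_on D" "v \<in> L2_on D"
  shows "integrable (lebesgue_on D) (\<lambda>x. u x * v x)"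
  using L2_inner[OF assms] by simp

lemma L2_component:
  fixes u :: "'a \<Rightarrow> 'b::euclidean_space"
  assumes "u \<in> L2_on D" "i \<in> Basis"
  shows "(\<lambda>x. u x \<bullet> i) \<in> L2_on D"
proof -
  note [measurable] = L2_onD(1)[OF assms(1)]
  have le: "(u x \<bullet> i)\<^sup>2 \<le> (norm (u x))\<^sup>2" for x
    using Basis_le_norm[OF assms(2), of "u x"] abs_le_square_iff[of "u x \<bullet> i" "norm (u x)"] by simp
  have "integrable (lebesgue_on D) (\<lambda>x. (norm (u x \<bullet> i))\<^sup>2)"
    using L2_onD(2)[OF assms(1)]
  proof (rule Bochner_Integration.integrable_bound)
    show "AE x in lebesgue_on D. norm ((norm (u x \<bullet> i))\<^sup>2) \<le> norm ((norm (u x))\<^sup>2)"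
      using le by (intro AE_I2) simp
  qed measurable
  then show ?thesis by (simp add: L2_on_def)
qed

lemma L2_Cauchy_Schwarz:
  fixes u v :: "'a \<Rightarrow> 'b::euclidean_space"
  assumes "u \<in> L2_on D" "v \<in> L2_on D"
  shows "\<bar>\<integral>x. u x \<bullet> v x \<partial>lebesgue_on D\<bar> \<le> L2_norm D u * L2_norm D v"
proof -
  have "(\<integral>x. u x \<bullet> v x \<partial>lebesgue_on D)\<^sup>2 \<le> (L2_norm D u)\<^sup>2 * (L2_norm D v)\<^sup>2"
  proof (rule quadratic_nonneg_imp_le)
    fix t :: real
    have "0 \<le> (L2_norm D (\<lambda>x. u x + t *\<^sub>R v x))\<^sup>2" by simp
    also have "\<dots> = (\<integral>x. (norm (u x))\<^sup>2 + 2 * t * (u x \<bullet> v x) + t\<^sup>2 * (norm (v x))\<^sup>2 \<partial>lebesgue_on D)"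
      unfolding L2_norm_power2 power2_norm_eq_inner
      by (intro Bochner_Integration.integral_cong) (auto simp: algebra_simps inner_commute power2_eq_square)
    also have "\<dots> = (L2_norm D u)\<^sup>2 + 2 * t * (\<integral>x. u x \<bullet> v x \<partial>lebesgue_on D) + t\<^sup>2 * (L2_norm D v)\<^sup>2"
      using L2_onD(2)[OF assms(1)] L2_onD(2)[OF assms(2)] L2_inner[OF assms] by (simp add: L2_norm_power2)
    finally show "0 \<le> (L2_norm D u)\<^sup>2 + 2 * t * (\<integral>x. u x \<bullet> v x \<partial>lebesgue_on D) + t\<^sup>2 * (L2_norm D v)\<^sup>2" .
  qed simp
  then show ?thesis
    using L2_norm_nonneg by (metis abs_le_square_iff abs_mult abs_of_nonneg power_mult_distrib)
qed

lemma L2_integrable: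
  assumes "u \<in> L2_on D"
  shows "integrable (lebesgue_on D) (u :: 'a \<Rightarrow> real)"
proof -
  \<comment> \<open>The constant 1 is square integrable because D has finite measure.\<close>
  have "(\<lambda>_. 1 :: real) \<in> L2_on D" by (simp add: L2_on_def)
  from L2_inner_real[OF assms this] show ?thesis by simp
qed

lemma continuous_L2:
  assumes "integrable lborel (\<lambda>x. (norm (u x))\<^sup>2)" "continuous_on UNIV u"
  shows "u \<in> L2_on D"
proof -
  have "u \<in> borel_measurable lebesgue"
    using assms(2) by (intro measurable_completion) (simp add: borel_measurable_continuous_onI)
  then have "u \<in> borel_measurable (lebesgue_on D)" by (rule measurable_restrict_space1)
  then show ?thesis
    using integrable_lebesgue_on_lborel[OF D_sets assms(1)] by (simp add: L2_on_def)
qed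

lemma test_function_L2:
  assumes "\<phi> \<in> test_functions D"
  shows "\<phi> \<in> L2_on D" "grad \<phi> \<in> L2_on D"
    "e \<in> Basis \<Longrightarrow> (\<lambda>x. frechet_derivative \<phi> (at x) e) \<in> L2_on D"
proof -
  show "\<phi> \<in> L2_on D"
    using integrable_test_function(1)[OF assms] test_functionsD(4)[OF assms]
    by (intro continuous_L2) simp_all
  show *: "grad \<phi> \<in> L2_on D"
    using integrable_test_function(2)[OF assms] continuous_grad[OF assms]
    by (intro continuous_L2) simp_all
  show "e \<in> Basis \<Longrightarrow> (\<lambda>x. frechet_derivative \<phi> (at x) e) \<in> L2_on D"
    using L2_component[OF *, of e] by (simp add: grad_inner)
qed

text \<open>Each component of the difference is orthogonal to all test functions, so the fundamental
  lemma applies. This removes the arbitrariness of the choice in \<open>wgrad\<close> up to null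
  sets.\<close>

lemma weak_gradient_unique:
  assumes "g \<in> L2_on D" "g' \<in> L2_on D" "is_weak_gradient D u g" "is_weak_gradient D u g'"
  shows "AE x in lebesgue_on D. g x = g' x"
proof -
  have "AE x in lebesgue_on D. g x \<bullet> i - g' x \<bullet> i = 0" if i: "i \<in> Basis" for i
  proof (rule fundamental_lemma_calculus_of_variations[OF open_D])
    note gi = L2_component[OF assms(1) i] L2_component[OF assms(2) i]
    show "integrable (lebesgue_on D) (\<lambda>x. g x \<bullet> i - g' x \<bullet> i)"
      using gi by (intro Bochner_Integration.integrable_diff L2_integrable)
    fix \<phi> assume \<phi>: "\<phi> \<in> test_functions D"
    have "(\<integral>x. (g x \<bullet> i) * \<phi> x \<partial>lebesgue_on D) = (\<integral>x. (g' x \<bullet> i) * \<phi> x \<partial>lebesgue_on D)"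
      using assms(3,4) \<phi> i by (simp add: is_weak_gradient_def)
    then show "(\<integral>x. (g x \<bullet> i - g' x \<bullet> i) * \<phi> x \<partial>lebesgue_on D) = 0"
      using gi[THEN L2_inner_real, OF test_function_L2(1)[OF \<phi>]] by (simp add: left_diff_distrib)
  qed
  then have "AE x in lebesgue_on D. \<forall>i\<in>Basis. g x \<bullet> i - g' x \<bullet> i = 0"
    by (intro AE_finite_allI) auto
  then show ?thesis
    by eventually_elim (auto intro: euclidean_eqI)
qed

lemma wgradD:
  assumes "u \<in> H1 D"
  shows "wgrad D u \<in> L2_on D" "is_weak_gradient D u (wgrad D u)"
proof -
  have "\<exists>g. g \<in> L2_on D \<and> is_weak_gradient D u g"
    using assms by (auto simp: H1_def)
  from someI_ex[OF this] show "wgrad D u \<in> L2_on D" "is_weak_gradient D u (wgrad D u)"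
    by (auto simp: wgrad_def)
qed

text \<open>The rule by which \<open>wgrad\<close> is computed later: exhibit some square-integrable
  weak gradient, and the chosen one agrees with it a.e.\<close>

lemma H1I:
  assumes "u \<in> L2_on D" "g \<in> L2_on D" "is_weak_gradient D u g"
  shows "u \<in> H1 D" "AE x in lebesgue_on D. wgrad D u x = g x"
proof -
  show *: "u \<in> H1 D" using assms by (auto simp: H1_def)
  show "AE x in lebesgue_on D. wgrad D u x = g x"
    using wgradD[OF *] assms by (intro weak_gradient_unique) auto
qed

lemma H1_L2: "u \<in> H1 D \<Longrightarrow> u \<in> L2_on D"
  by (simp add: H1_def)

lemma is_weak_gradient_add:
  assumes "u \<in> L2_on D" "v \<in> L2_on D" "g \<in> L2_on D" "g' \<in> L2_on D"
    "is_weak_gradient D u g" "is_weak_gradient D v g'"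
  shows "is_weak_gradient D (\<lambda>x. u x + v x) (\<lambda>x. g x + g' x)"
  unfolding is_weak_gradient_def
proof (intro ballI)
  fix \<phi> and i :: 'a assume \<phi>: "\<phi> \<in> test_functions D" and i: "i \<in> Basis"
  note int = assms(1,2)[THEN L2_inner_real, OF test_function_L2(3)[OF \<phi> i]]
    assms(3,4)[THEN L2_component, OF i, THEN L2_inner_real, OF test_function_L2(1)[OF \<phi>]]
  show "(\<integral>x. (u x + v x) * frechet_derivative \<phi> (at x) i \<partial>lebesgue_on D) =
      - (\<integral>x. (g x + g' x) \<bullet> i * \<phi> x \<partial>lebesgue_on D)"
    using int assms(5,6) \<phi> i by (simp add: is_weak_gradient_def distrib_right inner_add_left)
qed

lemma is_weak_gradient_scale:
  assumes "is_weak_gradient D u g"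
  shows "is_weak_gradient D (\<lambda>x. c * u x) (\<lambda>x. c *\<^sub>R g x)"
  using assms by (auto simp: is_weak_gradient_def mult.assoc)

lemma H1_add:
  assumes "u \<in> H1 D" "v \<in> H1 D"
  shows "(\<lambda>x. u x + v x) \<in> H1 D"
    "AE x in lebesgue_on D. wgrad D (\<lambda>x. u x + v x) x = wgrad D u x + wgrad D v x"
proof -
  note L2 = assms[THEN H1_L2] assms[THEN wgradD(1)]
  note H1I = H1I[OF L2_add(1)[OF L2(1,2)] L2_add(1)[OF L2(3,4)] is_weak_gradient_add[OF L2 assms[THEN wgradD(2)]]]
  show "(\<lambda>x. u x + v x) \<in> H1 D"
    "AE x in lebesgue_on D. wgrad D (\<lambda>x. u x + v x) x = wgrad D u x + wgrad D v x"
    by (rule H1I)+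
qed

lemma H1_scale:
  assumes "u \<in> H1 D"
  shows "(\<lambda>x. c * u x) \<in> H1 D"
    "AE x in lebesgue_on D. wgrad D (\<lambda>x. c * u x) x = c *\<^sub>R wgrad D u x"
proof -
  note H1I = H1I[OF L2_scale_real[OF H1_L2[OF assms]] L2_scale(1)[OF wgradD(1)[OF assms]]
      is_weak_gradient_scale[OF wgradD(2)[OF assms]]]
  show "(\<lambda>x. c * u x) \<in> H1 D"
    "AE x in lebesgue_on D. wgrad D (\<lambda>x. c * u x) x = c *\<^sub>R wgrad D u x"
    by (rule H1I)+
qed

lemma H1_diff:
  assumes "u \<in> H1 D" "v \<in> H1 D"
  shows "(\<lambda>x. u x - v x) \<in> H1 D"
    "AE x in lebesgue_on D. wgrad D (\<lambda>x. u x - v x) x = wgrad D u x - wgrad D v x"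
proof -
  have eq: "(\<lambda>x. u x + (- 1) * v x) = (\<lambda>x. u x - v x)" by simp
  show "(\<lambda>x. u x - v x) \<in> H1 D"
    using H1_add(1)[OF assms(1) H1_scale(1)[OF assms(2), of "- 1"]] by (simp only: eq)
  show "AE x in lebesgue_on D. wgrad D (\<lambda>x. u x - v x) x = wgrad D u x - wgrad D v x"
    using H1_add(2)[OF assms(1) H1_scale(1)[OF assms(2), of "- 1"]] H1_scale(2)[OF assms(2), of "- 1"]
    unfolding eq by eventually_elim simp
qed

lemma test_function_H1:
  assumes "\<phi> \<in> test_functions D"
  shows "\<phi> \<in> H1 D" "AE x in lebesgue_on D. wgrad D \<phi> x = grad \<phi> x"
  using H1I[OF test_function_L2(1,2)[OF assms] is_weak_gradient_grad[OF D_sets assms]] by blast+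

text \<open>A test function and its classical gradient vanish off D, so their norms over D are norms
  over the whole space, and the classical gradient stands in for \<open>wgrad\<close>.\<close>

lemma poincare_test_function:
  "\<exists>C\<ge>0. \<forall>\<phi>\<in>test_functions D. (L2_norm D \<phi>)\<^sup>2 \<le> C * (L2_norm D (wgrad D \<phi>))\<^sup>2"
proof -
  obtain R where R: "0 < R" "\<And>x. x \<in> D \<Longrightarrow> norm x \<le> R"
    using bounded_D by (auto simp: bounded_pos)
  have "(L2_norm D \<phi>)\<^sup>2 \<le> (4 * R\<^sup>2) * (L2_norm D (wgrad D \<phi>))\<^sup>2" if \<phi>: "\<phi> \<in> test_functions D" for \<phi>
  proof -
    obtain K where K: "K \<subseteq> D" "\<And>x. x \<notin> K \<Longrightarrow> \<phi> x = 0" "\<And>x e. x \<notin> K \<Longrightarrow> frechet_derivative \<phi> (at x) e = 0"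
      using test_functions_support[OF \<phi>] by metis
    have "x \<notin> K" if "x \<notin> D" for x using K(1) that by blast
    then have "grad \<phi> x = 0" "\<phi> x = 0" if "x \<notin> D" for x using K(2,3) that by (simp_all add: grad_def)
    moreover have [measurable]: "grad \<phi> \<in> borel_measurable borel" "\<phi> \<in> borel_measurable borel"
      using continuous_grad[OF \<phi>] test_functionsD(4)[OF \<phi>] by (auto intro: borel_measurable_continuous_onI)
    ultimately have "(\<integral>x. (norm (grad \<phi> x))\<^sup>2 \<partial>lborel) = (L2_norm D (grad \<phi>))\<^sup>2"
      "(\<integral>x. (\<phi> x)\<^sup>2 \<partial>lborel) = (L2_norm D \<phi>)\<^sup>2"
      unfolding L2_norm_power2 by (auto intro!: integral_lebesgue_on_eq_lborel[symmetric])
    moreover have "L2_norm D (grad \<phi>) = L2_norm D (wgrad D \<phi>)"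
      using test_function_H1(2)[OF \<phi>] by (intro L2_norm_cong_AE test_function_L2 wgradD test_function_H1 \<phi>) auto
    ultimately show ?thesis
      using poincare_test_function_lborel[OF \<phi> R(2)] R(1) by simp
  qed
  then show ?thesis by (intro exI[of _ "4 * R\<^sup>2"]) auto
qed

text \<open>The norm in the definition involves the chosen gradient of a difference. Linearity a.e.
  replaces it by a difference of gradients, and squaring splits the norm into two separate
  limits.\<close>

lemma H01_iff:
  "u \<in> H01 D \<longleftrightarrow> u \<in> H1 D \<and> (\<exists>\<phi>. (\<forall>n. \<phi> n \<in> test_functions D) \<and>
     (\<lambda>n. (L2_norm D (\<lambda>x. \<phi> n x - u x))\<^sup>2) \<longlonglongrightarrow> 0 \<and>
     (\<lambda>n. (L2_norm D (\<lambda>x. wgrad D (\<phi> n) x - wgrad D u x))\<^sup>2) \<longlonglongrightarrow> 0)"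
proof (cases "u \<in> H1 D")
  case True
  have "((\<lambda>n. H1_norm D (\<lambda>x. \<phi> n x - u x)) \<longlonglongrightarrow> 0) \<longleftrightarrow>
      (\<lambda>n. (L2_norm D (\<lambda>x. \<phi> n x - u x))\<^sup>2) \<longlonglongrightarrow> 0 \<and>
      (\<lambda>n. (L2_norm D (\<lambda>x. wgrad D (\<phi> n) x - wgrad D u x))\<^sup>2) \<longlonglongrightarrow> 0"
    if \<phi>: "\<And>n. \<phi> n \<in> test_functions D" for \<phi>
  proof -
    let ?a = "\<lambda>n. (L2_norm D (\<lambda>x. \<phi> n x - u x))\<^sup>2"
    let ?b = "\<lambda>n. (L2_norm D (\<lambda>x. wgrad D (\<phi> n) x - wgrad D u x))\<^sup>2"
    have "L2_norm D (wgrad D (\<lambda>x. \<phi> n x - u x)) = L2_norm D (\<lambda>x. wgrad D (\<phi> n) x - wgrad D u x)" for n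
      using H1_diff[OF test_function_H1(1)[OF \<phi>[of n]] True] test_function_H1(1)[OF \<phi>[of n]] True
      by (intro L2_norm_cong_AE wgradD L2_diff) auto
    then have eq: "H1_norm D (\<lambda>x. \<phi> n x - u x) = sqrt (?a n + ?b n)" for n
      by (simp add: H1_norm_def)
    have "(\<lambda>n. ?a n + ?b n) \<longlonglongrightarrow> 0" if "(\<lambda>n. sqrt (?a n + ?b n)) \<longlonglongrightarrow> 0"
      using tendsto_power[OF that, of 2] by simp
    moreover have "?a \<longlonglongrightarrow> 0" "?b \<longlonglongrightarrow> 0" if "(\<lambda>n. ?a n + ?b n) \<longlonglongrightarrow> 0"
      by (rule tendsto_sandwich[OF _ _ tendsto_const that], simp, simp)+
    moreover have "(\<lambda>n. sqrt (?a n + ?b n)) \<longlonglongrightarrow> 0" if "?a \<longlonglongrightarrow> 0" "?b \<longlonglongrightarrow> 0"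
      using tendsto_real_sqrt[OF tendsto_add[OF that]] by simp
    ultimately show ?thesis unfolding eq by blast
  qed
  then show ?thesis using True by (auto simp: H01_def)
qed (simp add: H01_def)

lemma H01_H1: "u \<in> H01 D \<Longrightarrow> u \<in> H1 D"
  by (simp add: H01_def)

lemma test_function_H01: "\<phi> \<in> test_functions D \<Longrightarrow> \<phi> \<in> H01 D"
  unfolding H01_iff by (intro conjI exI[of _ "\<lambda>_. \<phi>"] allI) (simp_all add: L2_norm_def test_function_H1(1))

lemma zero_H01: "(\<lambda>x. 0) \<in> H01 D"
  by (rule test_function_H01) (simp add: test_functions_def Ck_const)

lemma test_functions_add_scale:
  assumes "\<phi> \<in> test_functions D" "\<psi> \<in> test_functions D"
  shows "(\<lambda>x. \<phi> x + c * \<psi> x) \<in> test_functions D"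
proof -
  have "{x. \<phi> x + c * \<psi> x \<noteq> 0} \<subseteq> {x. \<phi> x \<noteq> 0} \<union> {x. \<psi> x \<noteq> 0}" by auto
  from closure_mono[OF this] have *: "closure {x. \<phi> x + c * \<psi> x \<noteq> 0} \<subseteq> closure {x. \<phi> x \<noteq> 0} \<union> closure {x. \<psi> x \<noteq> 0}"
    by (simp add: closure_Un)
  have "compact (closure {x. \<phi> x \<noteq> 0} \<union> closure {x. \<psi> x \<noteq> 0})"
    using assms by (intro compact_Un) (auto simp: test_functions_def)
  then have "compact (closure {x. \<phi> x + c * \<psi> x \<noteq> 0})"
    using * by (meson bounded_subset closed_closure compact_eq_bounded_closed)
  moreover have "Ck k (\<lambda>x. \<phi> x + c * \<psi> x)" for k
    using assms by (intro Ck_add Ck_mult Ck_const) (auto simp: test_functions_def)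
  moreover have "closure {x. \<phi> x + c * \<psi> x \<noteq> 0} \<subseteq> D"
    using * assms by (auto simp: test_functions_def)
  ultimately show ?thesis by (simp add: test_functions_def)
qed

lemma H1_add_scale:
  assumes "u \<in> H1 D" "v \<in> H1 D"
  shows "(\<lambda>x. u x + c * v x) \<in> H1 D"
    "AE x in lebesgue_on D. wgrad D (\<lambda>x. u x + c * v x) x = wgrad D u x + c *\<^sub>R wgrad D v x"
proof -
  show "(\<lambda>x. u x + c * v x) \<in> H1 D" by (intro H1_add H1_scale assms)
  show "AE x in lebesgue_on D. wgrad D (\<lambda>x. u x + c * v x) x = wgrad D u x + c *\<^sub>R wgrad D v x"
    using H1_add(2)[OF assms(1) H1_scale(1)[OF assms(2), of c]] H1_scale(2)[OF assms(2), of c]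
    by eventually_elim simp
qed

text \<open>The combination \<open>u x + c * v x\<close> covers sums, multiples and differences at
  once, and is the pattern of the ternary operation in the abstract minimisation.\<close>

lemma H01_add_scale:
  assumes "u \<in> H01 D" "v \<in> H01 D"
  shows "(\<lambda>x. u x + c * v x) \<in> H01 D"
proof -
  obtain \<phi> where \<phi>: "\<And>n. \<phi> n \<in> test_functions D" "(\<lambda>n. (L2_norm D (\<lambda>x. \<phi> n x - u x))\<^sup>2) \<longlonglongrightarrow> 0"
    "(\<lambda>n. (L2_norm D (\<lambda>x. wgrad D (\<phi> n) x - wgrad D u x))\<^sup>2) \<longlonglongrightarrow> 0" and u: "u \<in> H1 D"
    using assms(1) by (auto simp: H01_iff)
  obtain \<psi> where \<psi>: "\<And>n. \<psi> n \<in> test_functions D" "(\<lambda>n. (L2_norm D (\<lambda>x. \<psi> n x - v x))\<^sup>2) \<longlonglongrightarrow> 0"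
    "(\<lambda>n. (L2_norm D (\<lambda>x. wgrad D (\<psi> n) x - wgrad D v x))\<^sup>2) \<longlonglongrightarrow> 0" and v: "v \<in> H1 D"
    using assms(2) by (auto simp: H01_iff)
  \<comment> \<open>The range type is left open because the claim is applied twice, to the functions
    and to their gradients.\<close>
  have lim: "(\<lambda>n. (L2_norm D (h n))\<^sup>2) \<longlonglongrightarrow> 0"
    if "\<And>n. f n \<in> L2_on D" "\<And>n. g n \<in> L2_on D" "(\<lambda>n. (L2_norm D (f n))\<^sup>2) \<longlonglongrightarrow> 0"
      "(\<lambda>n. (L2_norm D (g n))\<^sup>2) \<longlonglongrightarrow> 0" "\<And>n. L2_norm D (h n) = L2_norm D (\<lambda>x. f n x + c *\<^sub>R g n x)"
    for f g h :: "nat \<Rightarrow> 'a \<Rightarrow> 'b::euclidean_space"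
  proof (rule tendsto_sandwich[OF _ _ tendsto_const])
    show "(\<lambda>n. 2 * (L2_norm D (f n))\<^sup>2 + 2 * (c\<^sup>2 * (L2_norm D (g n))\<^sup>2)) \<longlonglongrightarrow> 0"
      using that by (auto intro!: tendsto_eq_intros)
    show "\<forall>\<^sub>F n in sequentially. (L2_norm D (h n))\<^sup>2 \<le> 2 * (L2_norm D (f n))\<^sup>2 + 2 * (c\<^sup>2 * (L2_norm D (g n))\<^sup>2)"
      using L2_add(2)[OF that(1) L2_scale(1)[OF that(2)]] that(5) L2_scale(2)[OF that(2)] by auto
  qed auto
  have H: "\<phi> n \<in> H1 D" "\<psi> n \<in> H1 D" for n
    using test_function_H1(1) \<phi>(1) \<psi>(1) by blast+
  show ?thesis
    unfolding H01_iff
  proof (intro conjI exI allI)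
    show "(\<lambda>x. u x + c * v x) \<in> H1 D" using u v by (rule H1_add_scale)
    show "(\<lambda>x. \<phi> n x + c * \<psi> n x) \<in> test_functions D" for n
      using \<phi>(1) \<psi>(1) by (rule test_functions_add_scale)
    show "(\<lambda>n. (L2_norm D (\<lambda>x. (\<phi> n x + c * \<psi> n x) - (u x + c * v x)))\<^sup>2) \<longlonglongrightarrow> 0"
      by (rule lim[OF _ _ \<phi>(2) \<psi>(2)]) (intro L2_diff H1_L2 H u v, intro L2_diff H1_L2 H u v, simp add: algebra_simps)
    have grad_eq: "L2_norm D (\<lambda>x. wgrad D (\<lambda>x. \<phi> n x + c * \<psi> n x) x - wgrad D (\<lambda>x. u x + c * v x) x) =
        L2_norm D (\<lambda>x. (wgrad D (\<phi> n) x - wgrad D u x) + c *\<^sub>R (wgrad D (\<psi> n) x - wgrad D v x))" for n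
    proof (rule L2_norm_cong_AE)
      show "AE x in lebesgue_on D. wgrad D (\<lambda>x. \<phi> n x + c * \<psi> n x) x - wgrad D (\<lambda>x. u x + c * v x) x =
          (wgrad D (\<phi> n) x - wgrad D u x) + c *\<^sub>R (wgrad D (\<psi> n) x - wgrad D v x)"
        using H1_add_scale(2)[OF H[of n], of c] H1_add_scale(2)[OF u v, of c]
        by eventually_elim (simp add: algebra_simps)
      show "(\<lambda>x. wgrad D (\<lambda>x. \<phi> n x + c * \<psi> n x) x - wgrad D (\<lambda>x. u x + c * v x) x) \<in> L2_on D"
        by (intro L2_diff wgradD(1) H1_add_scale(1) u v H)
      show "(\<lambda>x. (wgrad D (\<phi> n) x - wgrad D u x) + c *\<^sub>R (wgrad D (\<psi> n) x - wgrad D v x)) \<in> L2_on D"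
        by (intro L2_diff L2_add(1) L2_scale(1) wgradD(1) u v H)
    qed
    show "(\<lambda>n. (L2_norm D (\<lambda>x. wgrad D (\<lambda>x. \<phi> n x + c * \<psi> n x) x - wgrad D (\<lambda>x. u x + c * v x) x))\<^sup>2) \<longlonglongrightarrow> 0"
      by (intro lim[OF _ _ \<phi>(3) \<psi>(3)] L2_diff wgradD(1) H u v grad_eq)
  qed
qed

lemma H01_scale: "u \<in> H01 D \<Longrightarrow> (\<lambda>x. c * u x) \<in> H01 D"
  using H01_add_scale[OF zero_H01, of u c] by simp

lemma H01_diff: "u \<in> H01 D \<Longrightarrow> v \<in> H01 D \<Longrightarrow> (\<lambda>x. u x - v x) \<in> H01 D"
  using H01_add_scale[of u v "- 1"] by simp

text \<open>The estimate passes to the limit along approximating test functions. Going from u to its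
  approximants and back costs the factor 2 twice, which turns C into \<open>4 * C\<close>.\<close>

lemma poincare:
  "\<exists>C\<ge>0. \<forall>u\<in>H01 D. (L2_norm D u)\<^sup>2 \<le> C * (H01_norm D u)\<^sup>2"
proof -
  obtain C where C: "C \<ge> 0" "\<And>\<phi>. \<phi> \<in> test_functions D \<Longrightarrow> (L2_norm D \<phi>)\<^sup>2 \<le> C * (L2_norm D (wgrad D \<phi>))\<^sup>2"
    using poincare_test_function by blast
  have "(L2_norm D u)\<^sup>2 \<le> 4 * C * (H01_norm D u)\<^sup>2" if "u \<in> H01 D" for u
  proof -
    obtain \<phi> where \<phi>: "\<And>n. \<phi> n \<in> test_functions D" "(\<lambda>n. (L2_norm D (\<lambda>x. \<phi> n x - u x))\<^sup>2) \<longlonglongrightarrow> 0"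
      "(\<lambda>n. (L2_norm D (\<lambda>x. wgrad D (\<phi> n) x - wgrad D u x))\<^sup>2) \<longlonglongrightarrow> 0" and u: "u \<in> H1 D"
      using \<open>u \<in> H01 D\<close> by (auto simp: H01_iff)
    note H = test_function_H1(1)[OF \<phi>(1)]
    let ?a = "\<lambda>n. (L2_norm D (\<lambda>x. \<phi> n x - u x))\<^sup>2"
    let ?b = "\<lambda>n. (L2_norm D (\<lambda>x. wgrad D (\<phi> n) x - wgrad D u x))\<^sup>2"
    have "(L2_norm D u)\<^sup>2 \<le> 2 * (C * (2 * (H01_norm D u)\<^sup>2 + 2 * ?b n)) + 2 * ?a n" for n
    proof -
      have "(L2_norm D u)\<^sup>2 \<le> 2 * (L2_norm D (\<phi> n))\<^sup>2 + 2 * ?a n"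
        using L2_add(2)[OF H1_L2[OF H[of n]] L2_diff[OF H1_L2[OF u] H1_L2[OF H[of n]]]]
          L2_norm_minus_commute[of u "\<phi> n"] by simp
      moreover have "(L2_norm D (wgrad D (\<phi> n)))\<^sup>2 \<le> 2 * (H01_norm D u)\<^sup>2 + 2 * ?b n"
        using L2_add(2)[OF wgradD(1)[OF u] L2_diff[OF wgradD(1)[OF H[of n]] wgradD(1)[OF u]]]
        by (simp add: H01_norm_def)
      then have "C * (L2_norm D (wgrad D (\<phi> n)))\<^sup>2 \<le> C * (2 * (H01_norm D u)\<^sup>2 + 2 * ?b n)"
        using C(1) by (rule mult_left_mono)
      ultimately show ?thesis using C(2)[OF \<phi>(1)[of n]] by linarith
    qed
    moreover have "(\<lambda>n. 2 * (C * (2 * (H01_norm D u)\<^sup>2 + 2 * ?b n)) + 2 * ?a n) \<longlonglongrightarrow>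
        2 * (C * (2 * (H01_norm D u)\<^sup>2 + 2 * 0)) + 2 * 0"
      using \<phi> by (intro tendsto_intros)
    ultimately have "(L2_norm D u)\<^sup>2 \<le> 2 * (C * (2 * (H01_norm D u)\<^sup>2 + 2 * 0)) + 2 * 0"
      by (intro LIMSEQ_le_const) auto
    then show ?thesis by simp
  qed
  then show ?thesis using C(1) by (intro exI[of _ "4 * C"]) auto
qed

end

section \<open>Completeness and the Riesz representation\<close>

context bounded_domain
begin

text \<open>The Riesz-Fischer argument. A subsequence with geometrically small steps has a.e.
  summable increments, because on a set of finite measure the L2 norm of an increment controls its
  integral. The pointwise limit along this subsequence is the limit in L2.\<close>

lemma L2_complete:
  fixes u :: "nat \<Rightarrow> 'a \<Rightarrow> 'b::euclidean_space"
  assumes u: "\<And>n. u n \<in> L2_on D"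
    and Cauchy: "\<And>e. e > 0 \<Longrightarrow> \<exists>N. \<forall>m\<ge>N. \<forall>n\<ge>N. (L2_norm D (\<lambda>x. u m x - u n x))\<^sup>2 < e"
  shows "\<exists>v\<in>L2_on D. (\<lambda>n. (L2_norm D (\<lambda>x. u n x - v x))\<^sup>2) \<longlonglongrightarrow> 0"
proof -
  have [measurable]: "u n \<in> borel_measurable (lebesgue_on D)" for n using L2_onD(1)[OF u] .
  have "\<forall>k. \<exists>N. \<forall>m\<ge>N. \<forall>n\<ge>N. (L2_norm D (\<lambda>x. u m x - u n x))\<^sup>2 < (1 / 4) ^ k"
    using Cauchy by simp
  then obtain N where N: "\<And>k m n. N k \<le> m \<Longrightarrow> N k \<le> n \<Longrightarrow> (L2_norm D (\<lambda>x. u m x - u n x))\<^sup>2 < (1 / 4) ^ k"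
    by metis
  \<comment> \<open>Summing the thresholds makes \<open>r j\<close> at least \<open>N k\<close> for
    every k up to j, so both ends of each increment lie beyond \<open>N k\<close>.\<close>
  define r where "r k = (\<Sum>j\<le>k. N j)" for k
  have rN: "N k \<le> r j" if "k \<le> j" for k j
    unfolding r_def using that by (intro member_le_sum) auto
  define d where "d k x = norm (u (r (Suc k)) x - u (r k) x)" for k x
  have d_int: "integrable (lebesgue_on D) (d k)"
    and d_le: "(\<integral>x. d k x \<partial>lebesgue_on D) \<le> (1 / 2) ^ k * L2_norm D (\<lambda>x. 1 :: real)" for k
  proof -
    have one: "(\<lambda>x. 1 :: real) \<in> L2_on D" by (simp add: L2_on_def)
    have "d k \<in> borel_measurable (lebesgue_on D)" unfolding d_def by measurable
    then have d_L2: "d k \<in> L2_on D"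
      using L2_onD[OF L2_diff[OF u u, of "r (Suc k)" "r k"]] by (simp add: d_def L2_on_def)
    have "L2_norm D (d k) \<le> (1 / 2) ^ k"
    proof (rule power2_le_imp_le)
      have "L2_norm D (d k) = L2_norm D (\<lambda>x. u (r (Suc k)) x - u (r k) x)"
        by (simp add: L2_norm_def d_def)
      then show "(L2_norm D (d k))\<^sup>2 \<le> ((1 / 2) ^ k)\<^sup>2"
        using N[of k "r (Suc k)" "r k"] rN[of k] by (simp add: power2_eq_square flip: power_mult_distrib)
    qed simp
    then have "L2_norm D (d k) * L2_norm D (\<lambda>x. 1 :: real) \<le> (1 / 2) ^ k * L2_norm D (\<lambda>x. 1 :: real)"
      using L2_norm_nonneg by (rule mult_right_mono)
    moreover have "\<bar>\<integral>x. d k x \<partial>lebesgue_on D\<bar> \<le> L2_norm D (d k) * L2_norm D (\<lambda>x. 1 :: real)"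
      using L2_Cauchy_Schwarz[OF d_L2 one] by simp
    ultimately show "(\<integral>x. d k x \<partial>lebesgue_on D) \<le> (1 / 2) ^ k * L2_norm D (\<lambda>x. 1 :: real)" by linarith
    show "integrable (lebesgue_on D) (d k)" using d_L2 by (rule L2_integrable)
  qed
  have [measurable]: "d k \<in> borel_measurable (lebesgue_on D)" for k using d_int by simp
  have d0: "0 \<le> d k x" for k x by (simp add: d_def)
  have "(\<integral>\<^sup>+x. (\<Sum>k. ennreal (d k x)) \<partial>lebesgue_on D) = (\<Sum>k. \<integral>\<^sup>+x. ennreal (d k x) \<partial>lebesgue_on D)"
    by (rule nn_integral_suminf) measurable
  also have "\<dots> = (\<Sum>k. ennreal (\<integral>x. d k x \<partial>lebesgue_on D))"
    using d_int d0 by (simp add: nn_integral_eq_integral)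
  also have "\<dots> \<le> (\<Sum>k. ennreal ((1 / 2) ^ k * L2_norm D (\<lambda>x. 1 :: real)))"
    using d_le by (intro suminf_le ennreal_leI) auto
  also have "\<dots> = ennreal (\<Sum>k. (1 / 2) ^ k * L2_norm D (\<lambda>x. 1 :: real))"
    by (intro suminf_ennreal2) (auto intro!: summable_mult2 summable_geometric mult_nonneg_nonneg L2_norm_nonneg)
  also have "\<dots> < \<infinity>" by simp
  finally have "(\<integral>\<^sup>+x. (\<Sum>k. ennreal (d k x)) \<partial>lebesgue_on D) \<noteq> \<infinity>" by simp
  then have "AE x in lebesgue_on D. (\<Sum>k. ennreal (d k x)) \<noteq> \<infinity>"
    by (rule nn_integral_PInf_AE[rotated]) measurable
  then have conv: "AE x in lebesgue_on D. convergent (\<lambda>k. u (r k) x)"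
  proof eventually_elim
    case (elim x)
    then have "summable (\<lambda>k. d k x)"
      by (intro summable_suminf_not_top d0) (simp add: infinity_ennreal_def)
    then have "summable (\<lambda>k. u (r (Suc k)) x - u (r k) x)"
      unfolding d_def by (rule summable_norm_cancel)
    from summable_LIMSEQ[OF this]
    have "(\<lambda>n. u (r n) x - u (r 0) x) \<longlonglongrightarrow> (\<Sum>k. u (r (Suc k)) x - u (r k) x)"
      by (simp add: sum_lessThan_telescope[of "\<lambda>k. u (r k) x"])
    from tendsto_add[OF this tendsto_const[of "u (r 0) x"]] show ?case
      by (auto simp: convergent_def)
  qed
  define v where "v x = lim (\<lambda>k. u (r k) x)" for x
  have [measurable]: "v \<in> borel_measurable (lebesgue_on D)"
    unfolding v_def by measurable
  have lim: "AE x in lebesgue_on D. (\<lambda>k. u (r k) x) \<longlonglongrightarrow> v x"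
    using conv by eventually_elim (simp add: v_def convergent_LIMSEQ_iff)
  \<comment> \<open>Fatou's lemma is applied in the second index only, with m fixed. The bound
    therefore holds for every m from \<open>N k\<close> on and not just along the
    subsequence.\<close>
  have bound: "(\<lambda>x. u m x - v x) \<in> L2_on D" "(L2_norm D (\<lambda>x. u m x - v x))\<^sup>2 \<le> (1 / 4) ^ k" if m: "N k \<le> m" for m k
  proof -
    have "(\<integral>\<^sup>+x. ennreal ((norm (u m x - v x))\<^sup>2) \<partial>lebesgue_on D) =
        (\<integral>\<^sup>+x. liminf (\<lambda>j. ennreal ((norm (u m x - u (r j) x))\<^sup>2)) \<partial>lebesgue_on D)"
    proof (rule nn_integral_cong_AE)
      show "AE x in lebesgue_on D. ennreal ((norm (u m x - v x))\<^sup>2) = liminf (\<lambda>j. ennreal ((norm (u m x - u (r j) x))\<^sup>2))"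
        using lim
      proof eventually_elim
        case (elim x)
        then show ?case
          by (intro lim_imp_Liminf[symmetric] tendsto_ennrealI tendsto_intros) auto
      qed
    qed
    also have "\<dots> \<le> liminf (\<lambda>j. \<integral>\<^sup>+x. ennreal ((norm (u m x - u (r j) x))\<^sup>2) \<partial>lebesgue_on D)"
      by (rule nn_integral_liminf) measurable
    also have "\<dots> = liminf (\<lambda>j. ennreal ((L2_norm D (\<lambda>x. u m x - u (r j) x))\<^sup>2))"
      using L2_onD(2)[OF L2_diff[OF u u]] by (simp add: nn_integral_eq_integral L2_norm_power2)
    also have "\<dots> \<le> limsup (\<lambda>j. ennreal ((L2_norm D (\<lambda>x. u m x - u (r j) x))\<^sup>2))"
      by (rule Liminf_le_Limsup) simp
    also have "\<dots> \<le> ennreal ((1 / 4) ^ k)"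
    proof (rule Limsup_bounded)
      show "\<forall>\<^sub>F j in sequentially. ennreal ((L2_norm D (\<lambda>x. u m x - u (r j) x))\<^sup>2) \<le> ennreal ((1 / 4) ^ k)"
        using eventually_ge_at_top[of k]
        by eventually_elim (use N[of k m] m rN in \<open>auto intro!: ennreal_leI less_imp_le\<close>)
    qed
    finally have le: "(\<integral>\<^sup>+x. ennreal ((norm (u m x - v x))\<^sup>2) \<partial>lebesgue_on D) \<le> ennreal ((1 / 4) ^ k)" .
    then have int: "integrable (lebesgue_on D) (\<lambda>x. (norm (u m x - v x))\<^sup>2)"
      by (intro integrableI_bounded) (auto simp: less_top[symmetric] top_unique intro: le_less_trans)
    then show "(\<lambda>x. u m x - v x) \<in> L2_on D" by (simp add: L2_on_def)
    show "(L2_norm D (\<lambda>x. u m x - v x))\<^sup>2 \<le> (1 / 4) ^ k"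
      using le int by (simp add: nn_integral_eq_integral L2_norm_power2)
  qed
  have "v \<in> L2_on D"
    using L2_diff[OF u bound(1)[of 0 "N 0"], of "N 0"] by simp
  moreover have "(\<lambda>n. (L2_norm D (\<lambda>x. u n x - v x))\<^sup>2) \<longlonglongrightarrow> 0"
  proof (rule LIMSEQ_I)
    fix e :: real assume "e > 0"
    then obtain k where "(1 / 4) ^ k < e" using real_arch_pow_inv[of e "1 / 4"] by auto
    then show "\<exists>no. \<forall>n\<ge>no. norm ((L2_norm D (\<lambda>x. u n x - v x))\<^sup>2 - 0) < e"
      using bound(2) by (intro exI[of _ "N k"]) (auto intro: le_less_trans)
  qed
  ultimately show ?thesis by blast
qed

lemma L2_inner_tendsto:
  fixes u :: "nat \<Rightarrow> 'a \<Rightarrow> real"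
  assumes "\<And>n. u n \<in> L2_on D" "v \<in> L2_on D" "w \<in> L2_on D"
    and lim: "(\<lambda>n. (L2_norm D (\<lambda>x. u n x - v x))\<^sup>2) \<longlonglongrightarrow> 0"
  shows "(\<lambda>n. \<integral>x. u n x * w x \<partial>lebesgue_on D) \<longlonglongrightarrow> (\<integral>x. v x * w x \<partial>lebesgue_on D)"
proof (rule LIM_zero_cancel, rule Lim_null_comparison)
  show "(\<lambda>n. L2_norm D (\<lambda>x. u n x - v x) * L2_norm D w) \<longlonglongrightarrow> 0"
    using tendsto_real_sqrt[OF lim] by (intro tendsto_mult_left_zero) (simp add: abs_of_nonneg[OF L2_norm_nonneg])
  show "\<forall>\<^sub>F n in sequentially. norm ((\<integral>x. u n x * w x \<partial>lebesgue_on D) - (\<integral>x. v x * w x \<partial>lebesgue_on D))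
      \<le> L2_norm D (\<lambda>x. u n x - v x) * L2_norm D w"
  proof (rule always_eventually, rule allI)
    fix n
    have "(\<integral>x. u n x * w x \<partial>lebesgue_on D) - (\<integral>x. v x * w x \<partial>lebesgue_on D) =
        (\<integral>x. (u n x - v x) * w x \<partial>lebesgue_on D)"
      using assms by (simp add: left_diff_distrib L2_inner_real)
    then show "norm ((\<integral>x. u n x * w x \<partial>lebesgue_on D) - (\<integral>x. v x * w x \<partial>lebesgue_on D))
        \<le> L2_norm D (\<lambda>x. u n x - v x) * L2_norm D w"
      using L2_Cauchy_Schwarz[OF L2_diff[OF assms(1)[of n] assms(2)] assms(3)] by simp
  qed
qed

text \<open>Both sides of the defining identity are L2 pairings with a fixed function, a test
  function or one of its partial derivatives, and are therefore continuous in the function and in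
  the gradient.\<close>

lemma is_weak_gradient_limit:
  assumes u: "\<And>n. u n \<in> L2_on D" "v \<in> L2_on D" "(\<lambda>n. (L2_norm D (\<lambda>x. u n x - v x))\<^sup>2) \<longlonglongrightarrow> 0"
    and g: "\<And>n. g n \<in> L2_on D" "h \<in> L2_on D" "(\<lambda>n. (L2_norm D (\<lambda>x. g n x - h x))\<^sup>2) \<longlonglongrightarrow> 0"
    and weak: "\<And>n. is_weak_gradient D (u n) (g n)"
  shows "is_weak_gradient D v h"
  unfolding is_weak_gradient_def
proof (intro ballI)
  fix \<phi> and i :: 'a assume \<phi>: "\<phi> \<in> test_functions D" and i: "i \<in> Basis"
  have gi: "(\<lambda>n. (L2_norm D (\<lambda>x. g n x \<bullet> i - h x \<bullet> i))\<^sup>2) \<longlonglongrightarrow> 0"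
  proof (rule tendsto_sandwich[OF _ _ tendsto_const g(3)])
    show "\<forall>\<^sub>F n in sequentially. (L2_norm D (\<lambda>x. g n x \<bullet> i - h x \<bullet> i))\<^sup>2 \<le> (L2_norm D (\<lambda>x. g n x - h x))\<^sup>2"
    proof (rule always_eventually, rule allI)
      fix n
      have d: "(\<lambda>x. g n x - h x) \<in> L2_on D" by (intro L2_diff g)
      show "(L2_norm D (\<lambda>x. g n x \<bullet> i - h x \<bullet> i))\<^sup>2 \<le> (L2_norm D (\<lambda>x. g n x - h x))\<^sup>2"
        unfolding L2_norm_power2 inner_diff_left[symmetric]
      proof (rule integral_mono)
        show "(norm ((g n x - h x) \<bullet> i))\<^sup>2 \<le> (norm (g n x - h x))\<^sup>2" for x
          using Basis_le_norm[OF i, of "g n x - h x"] by (intro power_mono) auto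
      qed (use L2_onD(2)[OF d] L2_onD(2)[OF L2_component[OF d i]] in auto)
    qed
  qed simp
  have u_lim: "(\<lambda>n. \<integral>x. u n x * frechet_derivative \<phi> (at x) i \<partial>lebesgue_on D) \<longlonglongrightarrow>
      (\<integral>x. v x * frechet_derivative \<phi> (at x) i \<partial>lebesgue_on D)"
    by (intro L2_inner_tendsto u test_function_L2(3)[OF \<phi> i])
  have eq: "(\<integral>x. u n x * frechet_derivative \<phi> (at x) i \<partial>lebesgue_on D) =
      - (\<integral>x. g n x \<bullet> i * \<phi> x \<partial>lebesgue_on D)" for n
    using weak[of n] \<phi> i by (simp add: is_weak_gradient_def)
  have g_lim: "(\<lambda>n. - (\<integral>x. g n x \<bullet> i * \<phi> x \<partial>lebesgue_on D)) \<longlonglongrightarrow> - (\<integral>x. h x \<bullet> i * \<phi> x \<partial>lebesgue_on D)"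
    by (intro tendsto_minus L2_inner_tendsto L2_component g i test_function_L2(1)[OF \<phi>] gi)
  show "(\<integral>x. v x * frechet_derivative \<phi> (at x) i \<partial>lebesgue_on D) = - (\<integral>x. h x \<bullet> i * \<phi> x \<partial>lebesgue_on D)"
    by (rule LIMSEQ_unique[OF u_lim[unfolded eq] g_lim])
qed

lemma H01_norm_diff:
  assumes "u \<in> H1 D" "v \<in> H1 D"
  shows "H01_norm D (\<lambda>x. u x - v x) = L2_norm D (\<lambda>x. wgrad D u x - wgrad D v x)"
  unfolding H01_norm_def
  using H1_diff[OF assms] by (intro L2_norm_cong_AE L2_diff wgradD(1) assms)

text \<open>The gradients converge by completeness of L2, the functions by the same and the Poincare
  inequality. The members of the sequence are themselves only limits of test functions, so that a
  test function within \<open>inverse (real (Suc n))\<close> of \<open>h n\<close> is chosen for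
  each n to approximate the limit.\<close>

lemma H01_complete:
  assumes h: "\<And>n. h n \<in> H01 D"
    and Cauchy: "\<And>e. e > 0 \<Longrightarrow> \<exists>N. \<forall>m\<ge>N. \<forall>n\<ge>N. (H01_norm D (\<lambda>x. h m x - h n x))\<^sup>2 < e"
  shows "\<exists>u\<in>H01 D. (\<lambda>n. (H01_norm D (\<lambda>x. h n x - u x))\<^sup>2) \<longlonglongrightarrow> 0"
proof -
  note h1 = H01_H1[OF h]
  have Cauchy_grad: "\<exists>N. \<forall>m\<ge>N. \<forall>n\<ge>N. (L2_norm D (\<lambda>x. wgrad D (h m) x - wgrad D (h n) x))\<^sup>2 < e" if "e > 0" for e
    using Cauchy[OF that] h1 by (simp add: H01_norm_diff)
  obtain g where g: "g \<in> L2_on D" "(\<lambda>n. (L2_norm D (\<lambda>x. wgrad D (h n) x - g x))\<^sup>2) \<longlonglongrightarrow> 0"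
    using L2_complete[OF wgradD(1)[OF h1] Cauchy_grad] by blast
  obtain C where C: "C \<ge> 0" "\<And>u. u \<in> H01 D \<Longrightarrow> (L2_norm D u)\<^sup>2 \<le> C * (H01_norm D u)\<^sup>2"
    using poincare by blast
  have Cauchy_h: "\<exists>N. \<forall>m\<ge>N. \<forall>n\<ge>N. (L2_norm D (\<lambda>x. h m x - h n x))\<^sup>2 < e" if "e > 0" for e
  proof -
    have "e / (C + 1) > 0" using that C(1) by simp
    then obtain N where N: "\<And>m n. N \<le> m \<Longrightarrow> N \<le> n \<Longrightarrow> (H01_norm D (\<lambda>x. h m x - h n x))\<^sup>2 < e / (C + 1)"
      using Cauchy by metis
    have "(L2_norm D (\<lambda>x. h m x - h n x))\<^sup>2 < e" if mn: "N \<le> m" "N \<le> n" for m n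
    proof -
      have "(L2_norm D (\<lambda>x. h m x - h n x))\<^sup>2 \<le> C * (H01_norm D (\<lambda>x. h m x - h n x))\<^sup>2"
        by (intro C(2) H01_diff h)
      also have "\<dots> \<le> (C + 1) * (H01_norm D (\<lambda>x. h m x - h n x))\<^sup>2"
        by (intro mult_right_mono) auto
      also have "\<dots> < (C + 1) * (e / (C + 1))"
        using N[OF mn] C(1) by (intro mult_strict_left_mono) auto
      also have "\<dots> = e" using C(1) by simp
      finally show ?thesis .
    qed
    then show ?thesis by blast
  qed
  obtain u where u: "u \<in> L2_on D" "(\<lambda>n. (L2_norm D (\<lambda>x. h n x - u x))\<^sup>2) \<longlonglongrightarrow> 0"
    using L2_complete[OF H1_L2[OF h1] Cauchy_h] by blast
  have weak: "is_weak_gradient D u g"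
    by (rule is_weak_gradient_limit[OF H1_L2[OF h1] u wgradD(1)[OF h1] g wgradD(2)[OF h1]])
  note uH1 = H1I[OF u(1) g(1) weak]
  have eq: "L2_norm D (\<lambda>x. w x - wgrad D u x) = L2_norm D (\<lambda>x. w x - g x)" if "w \<in> L2_on D" for w
    using uH1 that g(1) by (intro L2_norm_cong_AE L2_diff wgradD(1)) auto
  have grad_lim: "(\<lambda>n. (L2_norm D (\<lambda>x. wgrad D (h n) x - wgrad D u x))\<^sup>2) \<longlonglongrightarrow> 0"
    using g(2) by (simp add: eq[OF wgradD(1)[OF h1]])
  define approx where "approx n \<phi> \<longleftrightarrow> \<phi> \<in> test_functions D \<and>
      (L2_norm D (\<lambda>x. \<phi> x - h n x))\<^sup>2 < inverse (real (Suc n)) \<and>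
      (L2_norm D (\<lambda>x. wgrad D \<phi> x - wgrad D (h n) x))\<^sup>2 < inverse (real (Suc n))" for n \<phi>
  have "\<exists>\<phi>. approx n \<phi>" for n
  proof -
    obtain \<phi> where \<phi>: "\<And>k. \<phi> k \<in> test_functions D"
      "(\<lambda>k. (L2_norm D (\<lambda>x. \<phi> k x - h n x))\<^sup>2) \<longlonglongrightarrow> 0"
      "(\<lambda>k. (L2_norm D (\<lambda>x. wgrad D (\<phi> k) x - wgrad D (h n) x))\<^sup>2) \<longlonglongrightarrow> 0"
      using h[of n] by (auto simp: H01_iff)
    have "\<forall>\<^sub>F k in sequentially. (L2_norm D (\<lambda>x. \<phi> k x - h n x))\<^sup>2 < inverse (real (Suc n)) \<and>
      (L2_norm D (\<lambda>x. wgrad D (\<phi> k) x - wgrad D (h n) x))\<^sup>2 < inverse (real (Suc n))"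
      by (intro eventually_conj order_tendstoD(2)[OF \<phi>(2)] order_tendstoD(2)[OF \<phi>(3)]) auto
    from eventually_happens'[OF sequentially_bot this] \<phi>(1) show ?thesis
      unfolding approx_def by blast
  qed
  then obtain \<phi> where "\<And>n. approx n (\<phi> n)" by metis
  then have \<phi>: "\<And>n. \<phi> n \<in> test_functions D"
    "\<And>n. (L2_norm D (\<lambda>x. \<phi> n x - h n x))\<^sup>2 < inverse (real (Suc n))"
    "\<And>n. (L2_norm D (\<lambda>x. wgrad D (\<phi> n) x - wgrad D (h n) x))\<^sup>2 < inverse (real (Suc n))"
    unfolding approx_def by blast+
  have lim2: "(\<lambda>n. 2 * inverse (real (Suc n)) + 2 * a n) \<longlonglongrightarrow> 0" if "a \<longlonglongrightarrow> 0" for a :: "nat \<Rightarrow> real"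
    using tendsto_add[OF tendsto_mult_right_zero[OF LIMSEQ_inverse_real_of_nat] tendsto_mult_right_zero[OF that]] by simp
  note \<phi>1 = test_function_H1(1)[OF \<phi>(1)]
  have "u \<in> H01 D"
    unfolding H01_iff
  proof (intro conjI exI allI)
    show "u \<in> H1 D" by (rule uH1)
    show "\<phi> n \<in> test_functions D" for n by (rule \<phi>)
    show "(\<lambda>n. (L2_norm D (\<lambda>x. \<phi> n x - u x))\<^sup>2) \<longlonglongrightarrow> 0"
    proof (rule tendsto_sandwich[OF _ _ tendsto_const lim2[OF u(2)]])
      have "(L2_norm D (\<lambda>x. \<phi> n x - u x))\<^sup>2 \<le> 2 * inverse (real (Suc n)) + 2 * (L2_norm D (\<lambda>x. h n x - u x))\<^sup>2" for n
        using L2_norm_triangle[OF H1_L2[OF \<phi>1[of n]] H1_L2[OF h1[of n]] u(1)] \<phi>(2)[of n] by linarith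
      then show "\<forall>\<^sub>F n in sequentially. (L2_norm D (\<lambda>x. \<phi> n x - u x))\<^sup>2 \<le>
          2 * inverse (real (Suc n)) + 2 * (L2_norm D (\<lambda>x. h n x - u x))\<^sup>2" by simp
    qed simp
    show "(\<lambda>n. (L2_norm D (\<lambda>x. wgrad D (\<phi> n) x - wgrad D u x))\<^sup>2) \<longlonglongrightarrow> 0"
    proof (rule tendsto_sandwich[OF _ _ tendsto_const lim2[OF grad_lim]])
      have "(L2_norm D (\<lambda>x. wgrad D (\<phi> n) x - wgrad D u x))\<^sup>2 \<le>
          2 * inverse (real (Suc n)) + 2 * (L2_norm D (\<lambda>x. wgrad D (h n) x - wgrad D u x))\<^sup>2" for n
        using L2_norm_triangle[OF wgradD(1)[OF \<phi>1[of n]] wgradD(1)[OF h1[of n]] wgradD(1)[OF uH1(1)]] \<phi>(3)[of n]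
        by linarith
      then show "\<forall>\<^sub>F n in sequentially. (L2_norm D (\<lambda>x. wgrad D (\<phi> n) x - wgrad D u x))\<^sup>2 \<le>
          2 * inverse (real (Suc n)) + 2 * (L2_norm D (\<lambda>x. wgrad D (h n) x - wgrad D u x))\<^sup>2" by simp
    qed simp
  qed
  then show ?thesis
    using grad_lim h1 uH1(1) by (intro bexI[of _ u]) (simp_all add: H01_norm_diff)
qed

end

text \<open>The vectors are representatives and the form is only semidefinite, so the linear
  structure is passed as an operation standing for u + t v, about which no algebraic laws are
  assumed. All that is asked of it is closure and linearity of B and F, and completeness refers to
  the seminorm of B alone.\<close>

lemma symmetric_Riesz:
  fixes V :: "'u set" and add :: "'u \<Rightarrow> real \<Rightarrow> 'u \<Rightarrow> 'u"
    and B :: "'u \<Rightarrow> 'u \<Rightarrow> real" and F :: "'u \<Rightarrow> real"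
  assumes nonempty: "V \<noteq> {}"
    and closed: "\<And>u v t. u \<in> V \<Longrightarrow> v \<in> V \<Longrightarrow> add u t v \<in> V"
    and B_sym: "\<And>u v. u \<in> V \<Longrightarrow> v \<in> V \<Longrightarrow> B u v = B v u"
    and B_add: "\<And>u v w t. u \<in> V \<Longrightarrow> v \<in> V \<Longrightarrow> w \<in> V \<Longrightarrow> B (add u t v) w = B u w + t * B v w"
    and F_add: "\<And>u v t. u \<in> V \<Longrightarrow> v \<in> V \<Longrightarrow> F (add u t v) = F u + t * F v"
    and B_nonneg: "\<And>u. u \<in> V \<Longrightarrow> 0 \<le> B u u"
    and F_bounded: "\<And>u. u \<in> V \<Longrightarrow> (F u)\<^sup>2 \<le> C * B u u"
    and complete: "\<And>X. (\<And>n. X n \<in> V) \<Longrightarrow>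
      (\<And>e. e > 0 \<Longrightarrow> \<exists>N. \<forall>m\<ge>N. \<forall>n\<ge>N. B (add (X m) (- 1) (X n)) (add (X m) (- 1) (X n)) < e) \<Longrightarrow>
      \<exists>u\<in>V. (\<lambda>n. B (add (X n) (- 1) u) (add (X n) (- 1) u)) \<longlonglongrightarrow> 0"
  shows "\<exists>u\<in>V. \<forall>v\<in>V. B u v = F v"
proof -
  \<comment> \<open>This is twice the Ritz energy.\<close>
  define E where "E v = B v v - 2 * F v" for v
  have B_quad: "B (add u t v) (add u t v) = B u u + 2 * t * B u v + t\<^sup>2 * B v v" if "u \<in> V" "v \<in> V" for u v t
    using that closed[OF that, of t] B_add B_sym[of u "add u t v"] B_sym[of v "add u t v"] B_sym[of v u]
    by (simp add: algebra_simps power2_eq_square)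
  have E_quad: "E (add u t v) = E u + 2 * t * (B u v - F v) + t\<^sup>2 * B v v" if "u \<in> V" "v \<in> V" for u v t
    using that by (simp add: E_def B_quad F_add algebra_simps)
  have E_lower: "- (\<bar>C\<bar> + 1) \<le> E v" if "v \<in> V" for v
  proof -
    \<comment> \<open>Adding 1 keeps the Young weight positive whatever C is.\<close>
    define K where "K = \<bar>C\<bar> + 1"
    have "K > 0" by (simp add: K_def)
    have "C * B v v \<le> K * B v v"
      by (intro mult_right_mono B_nonneg that) (simp add: K_def)
    then have "(F v)\<^sup>2 \<le> K * B v v"
      using F_bounded[OF that] by linarith
    then have "(F v)\<^sup>2 / K \<le> B v v" using \<open>K > 0\<close> by (simp add: field_simps)
    moreover have "0 \<le> (F v - K)\<^sup>2 / K" using \<open>K > 0\<close> by simp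
    then have "2 * F v \<le> (F v)\<^sup>2 / K + K" using \<open>K > 0\<close> by (simp add: field_simps power2_eq_square)
    ultimately show ?thesis by (simp add: E_def K_def)
  qed
  have bdd: "bdd_below (E ` V)" using E_lower by (intro bdd_belowI2) auto
  define m where "m = Inf (E ` V)"
  have m: "m \<le> E v" if "v \<in> V" for v
    unfolding m_def using bdd that by (intro cInf_lower) auto
  have "\<exists>v\<in>V. E v < m + inverse (real (Suc n))" for n
    using cInf_lessD[of "E ` V" "m + inverse (real (Suc n))"] nonempty by (auto simp: m_def)
  then obtain X where X: "\<And>n. X n \<in> V" "\<And>n. E (X n) < m + inverse (real (Suc n))" by metis
  have diff: "B (add (X a) (- 1) (X b)) (add (X a) (- 1) (X b)) \<le>
      2 * (inverse (real (Suc a)) + inverse (real (Suc b)))" for a b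
  proof -
    define w where "w = add (X a) (- 1) (X b)"
    have w: "w \<in> V" unfolding w_def by (intro closed X)
    \<comment> \<open>Both arguments stand for the midpoint of \<open>X a\<close> and
      \<open>X b\<close>. They need not be the same element, so the lower bound m is used for each;
      in the sum of the two expansions the terms with \<open>F w\<close> cancel, which leaves the
      parallelogram identity.\<close>
    have "m \<le> E (add (X a) (- 1 / 2) w)" "m \<le> E (add (X b) (1 / 2) w)" using m closed X w by blast+
    then have "2 * m \<le> E (X a) + E (X b) - (B (X a) w - B (X b) w) + B w w / 2"
      using X(1) w by (simp add: E_quad power2_eq_square)
    moreover have "B w w = B (X a) w - B (X b) w"
      using B_add[OF X(1) X(1) w, of a "- 1" b] by (simp add: w_def)
    ultimately show ?thesis
      using X(2)[of a] X(2)[of b] unfolding w_def[symmetric] distrib_left by linarith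
  qed
  have "\<exists>N. \<forall>a\<ge>N. \<forall>b\<ge>N. B (add (X a) (- 1) (X b)) (add (X a) (- 1) (X b)) < e" if "e > 0" for e
  proof -
    obtain N where N: "inverse (real (Suc N)) < e / 4"
      using reals_Archimedean[of "e / 4"] \<open>e > 0\<close> by auto
    have "B (add (X a) (- 1) (X b)) (add (X a) (- 1) (X b)) < e" if "N \<le> a" "N \<le> b" for a b
    proof -
      have "inverse (real (Suc a)) \<le> inverse (real (Suc N))" "inverse (real (Suc b)) \<le> inverse (real (Suc N))"
        using that by (auto intro!: le_imp_inverse_le)
      then have "2 * (inverse (real (Suc a)) + inverse (real (Suc b))) \<le>
          2 * (inverse (real (Suc N)) + inverse (real (Suc N)))"
        by (intro mult_left_mono add_mono) auto
      also have "\<dots> < e" using N by simp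
      finally show ?thesis using diff[of a b] by (rule le_less_trans[rotated])
    qed
    then show ?thesis by blast
  qed
  from complete[OF X(1) this] obtain u where u: "u \<in> V"
    "(\<lambda>n. B (add (X n) (- 1) u) (add (X n) (- 1) u)) \<longlonglongrightarrow> 0" by blast
  have "B u v = F v" if v: "v \<in> V" for v
  proof -
    have sq: "(\<lambda>n. a n) \<longlonglongrightarrow> 0" if "\<And>n. (a n)\<^sup>2 \<le> b n" "b \<longlonglongrightarrow> 0" for a b :: "nat \<Rightarrow> real"
    proof -
      have "(\<lambda>n. (a n)\<^sup>2) \<longlonglongrightarrow> 0"
        by (rule tendsto_sandwich[OF _ _ tendsto_const that(2)]) (use that(1) in auto)
      then show ?thesis by simp
    qed
    \<comment> \<open>\<open>X n\<close> misses the infimum by less than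
      \<open>inverse (real (Suc n))\<close>, so moving from it in the direction v can lower the
      energy by no more than that. The discriminant of this quadratic in t says that
      \<open>X n\<close> almost solves the variational equation.\<close>
    have "(B (X n) v - F v)\<^sup>2 \<le> inverse (real (Suc n)) * B v v" for n
    proof (rule quadratic_nonneg_imp_le)
      show "0 \<le> inverse (real (Suc n)) + 2 * t * (B (X n) v - F v) + t\<^sup>2 * B v v" for t
        using m[OF closed[OF X(1)[of n] v, of t]] X(2)[of n] E_quad[OF X(1)[of n] v, of t] by linarith
    qed (rule B_nonneg[OF v])
    then have 1: "(\<lambda>n. B (X n) v - F v) \<longlonglongrightarrow> 0"
      using tendsto_mult_left_zero[OF LIMSEQ_inverse_real_of_nat] by (rule sq)
    have "(B (X n) v - B u v)\<^sup>2 \<le> B (add (X n) (- 1) u) (add (X n) (- 1) u) * B v v" for n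
    proof (rule quadratic_nonneg_imp_le)
      have w: "add (X n) (- 1) u \<in> V" by (intro closed X u)
      have "B (add (X n) (- 1) u) v = B (X n) v - B u v" using B_add[OF X(1) u(1) v, of n "- 1"] by simp
      then show "0 \<le> B (add (X n) (- 1) u) (add (X n) (- 1) u) + 2 * t * (B (X n) v - B u v) + t\<^sup>2 * B v v" for t
        using B_quad[OF w v, of t] B_nonneg[OF closed[OF w v, of t]] by simp
    qed (rule B_nonneg[OF v])
    then have 2: "(\<lambda>n. B (X n) v - B u v) \<longlonglongrightarrow> 0"
      using tendsto_mult_left_zero[OF u(2)] by (rule sq)
    have "(\<lambda>n. B u v - F v) \<longlonglongrightarrow> 0"
      using tendsto_diff[OF 1 2] by simp
    then show ?thesis by (simp add: LIMSEQ_const_iff)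
  qed
  then show ?thesis using u(1) by blast
qed

section \<open>The weighted form on the ansatz space\<close>

context bounded_domain
begin

lemma H01_sum:
  fixes h :: "nat \<Rightarrow> 'a \<Rightarrow> real"
  assumes "h \<in> {..M} \<rightarrow> H01 D"
  shows "(\<lambda>x. \<Sum>k\<le>M. h k x * c k) \<in> H01 D"
    and "AE x in lebesgue_on D. wgrad D (\<lambda>x. \<Sum>k\<le>M. h k x * c k) x = (\<Sum>k\<le>M. c k *\<^sub>R wgrad D (h k) x)"
proof -
  have "(\<lambda>x. \<Sum>k\<le>M. h k x * c k) \<in> H01 D \<and>
    (AE x in lebesgue_on D. wgrad D (\<lambda>x. \<Sum>k\<le>M. h k x * c k) x = (\<Sum>k\<le>M. c k *\<^sub>R wgrad D (h k) x))"
    using assms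
  proof (induction M)
    case 0
    then have "h 0 \<in> H01 D" by simp
    from H01_scale[OF this, of "c 0"] H1_scale(2)[OF H01_H1[OF this], of "c 0"] show ?case
      by (simp add: mult.commute)
  next
    case (Suc M)
    then have IH: "(\<lambda>x. \<Sum>k\<le>M. h k x * c k) \<in> H01 D"
      "AE x in lebesgue_on D. wgrad D (\<lambda>x. \<Sum>k\<le>M. h k x * c k) x = (\<Sum>k\<le>M. c k *\<^sub>R wgrad D (h k) x)"
      and h: "h (Suc M) \<in> H01 D" by (auto simp: Pi_iff)
    have eq: "(\<lambda>x. \<Sum>k\<le>Suc M. h k x * c k) = (\<lambda>x. (\<Sum>k\<le>M. h k x * c k) + c (Suc M) * h (Suc M) x)"
      by (simp add: mult.commute)
    show ?case
      unfolding eq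
    proof
      show "(\<lambda>x. (\<Sum>k\<le>M. h k x * c k) + c (Suc M) * h (Suc M) x) \<in> H01 D"
        using IH(1) h by (rule H01_add_scale)
      show "AE x in lebesgue_on D. wgrad D (\<lambda>x. (\<Sum>k\<le>M. h k x * c k) + c (Suc M) * h (Suc M) x) x =
          (\<Sum>k\<le>Suc M. c k *\<^sub>R wgrad D (h k) x)"
        using H1_add_scale(2)[OF H01_H1[OF IH(1)] H01_H1[OF h], of "c (Suc M)"] IH(2)
        by eventually_elim simp
    qed
  qed
  then show "(\<lambda>x. \<Sum>k\<le>M. h k x * c k) \<in> H01 D"
    "AE x in lebesgue_on D. wgrad D (\<lambda>x. \<Sum>k\<le>M. h k x * c k) x = (\<Sum>k\<le>M. c k *\<^sub>R wgrad D (h k) x)"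
    by auto
qed

lemma Hm1D:
  assumes "\<psi> \<in> Hm1 D"
  shows "u \<in> H01 D \<Longrightarrow> v \<in> H01 D \<Longrightarrow> \<psi> (\<lambda>x. u x + t * v x) = \<psi> u + t * \<psi> v"
    and "\<exists>C\<ge>0. \<forall>u\<in>H01 D. \<bar>\<psi> u\<bar> \<le> C * H01_norm D u"
proof -
  show "\<psi> (\<lambda>x. u x + t * v x) = \<psi> u + t * \<psi> v" if "u \<in> H01 D" "v \<in> H01 D"
    using assms that H01_scale[OF that(2), of t] by (simp add: Hm1_def)
  obtain C where C: "\<forall>u\<in>H01 D. \<bar>\<psi> u\<bar> \<le> C * H01_norm D u"
    using assms unfolding Hm1_def by blast
  have "\<bar>\<psi> u\<bar> \<le> \<bar>C\<bar> * H01_norm D u" if "u \<in> H01 D" for u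
  proof -
    have "C * H01_norm D u \<le> \<bar>C\<bar> * H01_norm D u"
      by (intro mult_right_mono) (auto simp: H01_norm_def L2_norm_nonneg)
    then show ?thesis using C that by fastforce
  qed
  then show "\<exists>C\<ge>0. \<forall>u\<in>H01 D. \<bar>\<psi> u\<bar> \<le> C * H01_norm D u" by (intro exI[of _ "\<bar>C\<bar>"]) auto
qed

lemma Hm1_sum:
  fixes h :: "nat \<Rightarrow> 'a \<Rightarrow> real"
  assumes \<psi>: "\<psi> \<in> Hm1 D" and "h \<in> {..M} \<rightarrow> H01 D"
  shows "\<psi> (\<lambda>x. \<Sum>k\<le>M. h k x * c k) = (\<Sum>k\<le>M. \<psi> (h k) * c k)"
  using assms(2)
proof (induction M)
  case 0
  then show ?case using \<psi> by (simp add: Hm1_def mult.commute[of _ "c 0"])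
next
  case (Suc M)
  have "\<psi> (\<lambda>x. (\<Sum>k\<le>M. h k x * c k) + c (Suc M) * h (Suc M) x) =
      \<psi> (\<lambda>x. \<Sum>k\<le>M. h k x * c k) + c (Suc M) * \<psi> (h (Suc M))"
    using Suc.prems by (intro Hm1D(1) \<psi> H01_sum(1)) (auto simp: Pi_iff)
  moreover have "h \<in> {..M} \<rightarrow> H01 D" using Suc.prems by (auto simp: Pi_iff)
  ultimately show ?case using Suc.IH by (simp add: mult.commute)
qed

lemma Linf_onD:
  assumes "\<beta> \<in> Linf_on D"
  shows "\<beta> \<in> borel_measurable (lebesgue_on D)" "AE x in lebesgue_on D. \<bar>\<beta> x\<bar> \<le> Linf_norm D \<beta>"
proof -
  show "\<beta> \<in> borel_measurable (lebesgue_on D)" using assms by (simp add: Linf_on_def)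
  let ?e = "esssup (lebesgue_on D) (\<lambda>x. ereal \<bar>\<beta> x\<bar>)"
  have "?e < \<infinity>" using assms by (simp add: Linf_on_def)
  have "AE x in lebesgue_on D. ereal \<bar>\<beta> x\<bar> \<le> ?e" by (rule esssup_AE)
  then show "AE x in lebesgue_on D. \<bar>\<beta> x\<bar> \<le> Linf_norm D \<beta>"
  proof eventually_elim
    case (elim x)
    then show ?case using \<open>?e < \<infinity>\<close> unfolding Linf_norm_def by (cases ?e) auto
  qed
qed

text \<open>Extracts positivity of \<open>bmin y\<close> and nonnegativity of
  \<open>Linf_norm\<close> from statements quantified over almost every x.\<close>

lemma AE_D_constD:
  assumes "AE x in lebesgue_on D. P"
  shows P
proof (rule ccontr)
  assume "\<not> P"
  then have "eventually (\<lambda>x. False) (ae_filter (lebesgue_on D))" using assms by simp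
  then show False
    using emeasure_D_pos unfolding eventually_False ae_filter_eq_bot_iff by blast
qed

lemma Linf_norm_nonneg: "\<beta> \<in> Linf_on D \<Longrightarrow> 0 \<le> Linf_norm D \<beta>"
  by (rule AE_D_constD, rule eventually_mono[OF Linf_onD(2)]) auto

text \<open>The sum of squares is cruder than the product of norms, but it separates g from h, so
  that each can later be split into its modes.\<close>

lemma Linf_weighted:
  fixes g h :: "'a \<Rightarrow> 'b::euclidean_space"
  assumes \<beta>: "\<beta> \<in> Linf_on D" and g: "g \<in> L2_on D" and h: "h \<in> L2_on D"
  shows "integrable (lebesgue_on D) (\<lambda>x. \<beta> x * (g x \<bullet> h x))"
    and "\<bar>\<integral>x. \<beta> x * (g x \<bullet> h x) \<partial>lebesgue_on D\<bar> \<le> Linf_norm D \<beta> * ((L2_norm D g)\<^sup>2 + (L2_norm D h)\<^sup>2)"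
proof -
  note [measurable] = Linf_onD(1)[OF \<beta>] L2_onD(1)[OF g] L2_onD(1)[OF h]
  have int: "integrable (lebesgue_on D) (\<lambda>x. Linf_norm D \<beta> * ((norm (g x))\<^sup>2 + (norm (h x))\<^sup>2))"
    using L2_onD(2)[OF g] L2_onD(2)[OF h] by simp
  have bound: "AE x in lebesgue_on D. \<bar>\<beta> x * (g x \<bullet> h x)\<bar> \<le> Linf_norm D \<beta> * ((norm (g x))\<^sup>2 + (norm (h x))\<^sup>2)"
    using Linf_onD(2)[OF \<beta>]
  proof eventually_elim
    case (elim x)
    have "\<bar>g x \<bullet> h x\<bar> \<le> norm (g x) * norm (h x)" by (rule Cauchy_Schwarz_ineq2)
    also have "\<dots> \<le> (norm (g x))\<^sup>2 + (norm (h x))\<^sup>2"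
      using sum_squares_bound[of "norm (g x)" "norm (h x)"] mult_nonneg_nonneg[OF norm_ge_zero norm_ge_zero, of "g x" "h x"]
      by linarith
    finally show ?case unfolding abs_mult using elim by (intro mult_mono) auto
  qed
  show *: "integrable (lebesgue_on D) (\<lambda>x. \<beta> x * (g x \<bullet> h x))"
    using int by (rule Bochner_Integration.integrable_bound) (measurable, use bound in \<open>auto elim: eventually_mono\<close>)
  have "\<bar>\<integral>x. \<beta> x * (g x \<bullet> h x) \<partial>lebesgue_on D\<bar> \<le> (\<integral>x. \<bar>\<beta> x * (g x \<bullet> h x)\<bar> \<partial>lebesgue_on D)"
    by (rule integral_abs_bound)
  also have "\<dots> \<le> (\<integral>x. Linf_norm D \<beta> * ((norm (g x))\<^sup>2 + (norm (h x))\<^sup>2) \<partial>lebesgue_on D)"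
    using bound int * by (intro integral_mono_AE) auto
  also have "\<dots> = Linf_norm D \<beta> * ((L2_norm D g)\<^sup>2 + (L2_norm D h)\<^sup>2)"
    using L2_onD(2)[OF g] L2_onD(2)[OF h] by (simp add: L2_norm_power2)
  finally show "\<bar>\<integral>x. \<beta> x * (g x \<bullet> h x) \<partial>lebesgue_on D\<bar> \<le> Linf_norm D \<beta> * ((L2_norm D g)\<^sup>2 + (L2_norm D h)\<^sup>2)" .
qed

lemma weighted_lower_bound:
  fixes g :: "'a \<Rightarrow> 'b::euclidean_space"
  assumes \<beta>: "\<beta> \<in> Linf_on D" and g: "g \<in> L2_on D" and m: "AE x in lebesgue_on D. m \<le> \<beta> x"
  shows "m * (L2_norm D g)\<^sup>2 \<le> (\<integral>x. \<beta> x * (g x \<bullet> g x) \<partial>lebesgue_on D)"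
proof -
  have "m * (L2_norm D g)\<^sup>2 = (\<integral>x. m * (g x \<bullet> g x) \<partial>lebesgue_on D)"
    by (simp add: L2_norm_power2 power2_norm_eq_inner)
  also have "\<dots> \<le> (\<integral>x. \<beta> x * (g x \<bullet> g x) \<partial>lebesgue_on D)"
  proof (intro integral_mono_AE)
    show "AE x in lebesgue_on D. m * (g x \<bullet> g x) \<le> \<beta> x * (g x \<bullet> g x)"
      using m by eventually_elim (auto intro: mult_right_mono)
  qed (use Linf_weighted(1)[OF \<beta> g g] L2_inner[OF g g] in auto)
  finally show ?thesis .
qed

text \<open>Cauchy-Schwarz against the constant sequence 1 produces the factor \<open>M + 1\<close>,
  which is harmless because the number of modes is fixed.\<close>

lemma L2_sum:
  fixes g :: "nat \<Rightarrow> 'a \<Rightarrow> 'b::euclidean_space" and c :: "nat \<Rightarrow> real"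
  assumes "g \<in> {..M} \<rightarrow> L2_on D"
  shows "(\<lambda>x. \<Sum>k\<le>M. c k *\<^sub>R g k x) \<in> L2_on D"
    and "(L2_norm D (\<lambda>x. \<Sum>k\<le>M. c k *\<^sub>R g k x))\<^sup>2 \<le> real (M + 1) * (\<Sum>k\<le>M. (c k)\<^sup>2 * (L2_norm D (g k))\<^sup>2)"
proof -
  have g: "g k \<in> L2_on D" if "k \<le> M" for k using assms that by auto
  have "(\<lambda>x. \<Sum>k\<in>A. c k *\<^sub>R g k x) \<in> L2_on D" if "finite A" "A \<subseteq> {..M}" for A
    using that
  proof (induction A rule: finite_induct)
    case empty
    then show ?case by (simp add: L2_on_def)
  next
    case (insert a A)
    then show ?case using L2_add(1)[OF L2_scale(1)[OF g[of a], of "c a"]] by simp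
  qed
  then show *: "(\<lambda>x. \<Sum>k\<le>M. c k *\<^sub>R g k x) \<in> L2_on D" by simp
  have int: "integrable (lebesgue_on D) (\<lambda>x. (c k)\<^sup>2 * (norm (g k x))\<^sup>2)" if "k \<le> M" for k
    using L2_onD(2)[OF g[OF that]] by simp
  have "(norm (\<Sum>k\<le>M. c k *\<^sub>R g k x))\<^sup>2 \<le> real (M + 1) * (\<Sum>k\<le>M. (c k)\<^sup>2 * (norm (g k x))\<^sup>2)" for x
  proof -
    have "(norm (\<Sum>k\<le>M. c k *\<^sub>R g k x))\<^sup>2 \<le> (\<Sum>k\<le>M. 1 * norm (c k *\<^sub>R g k x))\<^sup>2"
      using norm_sum[of "\<lambda>k. c k *\<^sub>R g k x" "{..M}"] by (intro power_mono) auto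
    also have "\<dots> \<le> (\<Sum>k\<le>M. 1\<^sup>2) * (\<Sum>k\<le>M. (norm (c k *\<^sub>R g k x))\<^sup>2)"
      by (rule Cauchy_Schwarz_ineq_sum)
    finally show ?thesis by (simp add: power_mult_distrib)
  qed
  then have "(L2_norm D (\<lambda>x. \<Sum>k\<le>M. c k *\<^sub>R g k x))\<^sup>2 \<le>
      (\<integral>x. real (M + 1) * (\<Sum>k\<le>M. (c k)\<^sup>2 * (norm (g k x))\<^sup>2) \<partial>lebesgue_on D)"
    unfolding L2_norm_power2
    by (intro integral_mono integrable_mult_right Bochner_Integration.integrable_sum int L2_onD(2)[OF *]) auto
  also have "\<dots> = real (M + 1) * (\<Sum>k\<le>M. (c k)\<^sup>2 * (L2_norm D (g k))\<^sup>2)"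
  proof -
    have "(\<integral>x. (\<Sum>k\<le>M. (c k)\<^sup>2 * (norm (g k x))\<^sup>2) \<partial>lebesgue_on D) = (\<Sum>k\<le>M. (c k)\<^sup>2 * (L2_norm D (g k))\<^sup>2)"
      unfolding L2_norm_power2 using int by (subst Bochner_Integration.integral_sum) auto
    then show ?thesis by simp
  qed
  finally show "(L2_norm D (\<lambda>x. \<Sum>k\<le>M. c k *\<^sub>R g k x))\<^sup>2 \<le> real (M + 1) * (\<Sum>k\<le>M. (c k)\<^sup>2 * (L2_norm D (g k))\<^sup>2)" .
qed

end

text \<open>The basis enters only through orthonormality and moments. The fourth moments of
  \<open>pc k\<close> are paired with the square integrability of the essential supremum of
  \<open>b y\<close> and of \<open>inverse (bmin y)\<close>: the former pair gives the upper bound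
  of the form, the latter its coercivity.\<close>

locale galerkin = bounded_domain D + prob_space \<mu>
  for D :: "'a::euclidean_space set" and \<mu> :: "'y measure" +
  fixes pc :: "nat \<Rightarrow> 'y \<Rightarrow> real" and M :: nat
    and b :: "'y \<Rightarrow> 'a \<Rightarrow> real" and bmin :: "'y \<Rightarrow> real"
    and c :: "'y \<Rightarrow> real" and \<psi> :: "nat \<Rightarrow> ('a \<Rightarrow> real) \<Rightarrow> real"
  assumes pc_measurable [measurable]: "\<And>k. pc k \<in> borel_measurable \<mu>"
    and pc_integrable: "\<And>i j. integrable \<mu> (\<lambda>y. pc i y * pc j y)"
    and pc_orthonormal: "\<And>i j. (\<integral>y. pc i y * pc j y \<partial>\<mu>) = (if i = j then 1 else 0)"
    and pc_power4: "\<And>k. integrable \<mu> (\<lambda>y. (pc k y) ^ 4)"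
    and b_measurable [measurable]: "(\<lambda>(y, x). b y x) \<in> borel_measurable (\<mu> \<Otimes>\<^sub>M lebesgue_on D)"
    and b_Linf: "AE y in \<mu>. b y \<in> Linf_on D"
    and b_L2: "integrable (completion \<mu>) (\<lambda>y. (Linf_norm D (b y))\<^sup>2)"
    and bmin_L2: "(\<lambda>y. inverse (bmin y)) \<in> borel_measurable \<mu>" "integrable \<mu> (\<lambda>y. (inverse (bmin y))\<^sup>2)"
    and bmin: "AE y in \<mu>. AE x in lebesgue_on D. 0 < bmin y \<and> bmin y \<le> b y x"
    and c_integrable: "\<And>i j. integrable \<mu> (\<lambda>y. c y * pc i y * pc j y)"
    and \<psi>: "\<And>k. k \<le> M \<Longrightarrow> \<psi> k \<in> Hm1 D"
begin

abbreviation "V \<equiv> L2M pc M (H01 D)"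
abbreviation "B \<equiv> form_B \<mu> D b"
abbreviation "F \<equiv> form_F \<mu> c (\<lambda>y z. \<Sum>k\<le>M. \<psi> k z * pc k y)"

definition expand :: "(nat \<Rightarrow> 'a \<Rightarrow> real) \<Rightarrow> 'y \<Rightarrow> 'a \<Rightarrow> real" where
  "expand h = (\<lambda>y z. \<Sum>k\<le>M. h k z * pc k y)"

definition add :: "('y \<Rightarrow> 'a \<Rightarrow> real) \<Rightarrow> real \<Rightarrow> ('y \<Rightarrow> 'a \<Rightarrow> real) \<Rightarrow> 'y \<Rightarrow> 'a \<Rightarrow> real" where
  "add u t v = (\<lambda>y z. u y z + t * v y z)"

definition inner_form :: "('y \<Rightarrow> 'a \<Rightarrow> real) \<Rightarrow> ('y \<Rightarrow> 'a \<Rightarrow> real) \<Rightarrow> 'y \<Rightarrow> real" where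
  "inner_form u v y = (\<integral>x. b y x * (wgrad D (u y) x \<bullet> wgrad D (v y) x) \<partial>lebesgue_on D)"

lemma B_eq: "B u v = (\<integral>y. inner_form u v y \<partial>\<mu>)"
  by (simp add: form_B_def inner_form_def)

lemma expand_in_V: "h \<in> {..M} \<rightarrow> H01 D \<Longrightarrow> expand h \<in> V"
  by (auto simp: L2M_def expand_def)

lemma V_E:
  assumes "u \<in> V"
  obtains h where "u = expand h" "h \<in> {..M} \<rightarrow> H01 D"
  using assms by (auto simp: L2M_def expand_def Pi_iff)

lemma add_expand: "add (expand h) t (expand g) = expand (\<lambda>k z. h k z + t * g k z)"
  by (auto simp: add_def expand_def fun_eq_iff sum.distrib sum_distrib_left algebra_simps)

lemma V_add: "u \<in> V \<Longrightarrow> v \<in> V \<Longrightarrow> add u t v \<in> V"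
proof -
  assume "u \<in> V" "v \<in> V"
  obtain h where "u = expand h" "h \<in> {..M} \<rightarrow> H01 D"
    using \<open>u \<in> V\<close> by (rule V_E)
  moreover obtain g where "v = expand g" "g \<in> {..M} \<rightarrow> H01 D"
    using \<open>v \<in> V\<close> by (rule V_E)
  ultimately show "add u t v \<in> V" by (auto simp: add_expand intro!: expand_in_V H01_add_scale)
qed

lemma V_H01: "u \<in> V \<Longrightarrow> u y \<in> H01 D"
  by (elim V_E) (simp add: expand_def H01_sum(1))

lemma V_wgrad: "u \<in> V \<Longrightarrow> wgrad D (u y) \<in> L2_on D"
  by (intro wgradD(1) H01_H1 V_H01)

lemma wgrad_expand:
  assumes "h \<in> {..M} \<rightarrow> H01 D"
  shows "AE x in lebesgue_on D. wgrad D (expand h y) x = (\<Sum>k\<le>M. pc k y *\<^sub>R wgrad D (h k) x)"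
  unfolding expand_def using assms by (rule H01_sum(2))

lemma wgrad_L2: "h \<in> {..M} \<rightarrow> H01 D \<Longrightarrow> (\<lambda>k. wgrad D (h k)) \<in> {..M} \<rightarrow> L2_on D"
  by (auto intro!: wgradD(1) H01_H1)

lemma b_section: "y \<in> space \<mu> \<Longrightarrow> b y \<in> borel_measurable (lebesgue_on D)"
  using measurable_compose[OF measurable_Pair1' b_measurable, of y] by simp

text \<open>The gradients in the integrand are chosen separately for each y, so the integrand itself
  gives no access to Fubini's theorem. For each y it agrees a.e. in x with one built from the finite
  sums of \<open>pc k y *\<^sub>R wgrad D (h k) x\<close>, which are jointly measurable.\<close>

lemma inner_form_measurable:
  assumes "u \<in> V" "v \<in> V"
  shows "inner_form u v \<in> borel_measurable \<mu>"
proof -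
  obtain h where u: "u = expand h" and h: "h \<in> {..M} \<rightarrow> H01 D"
    using assms(1) by (rule V_E)
  obtain g where v: "v = expand g" and g: "g \<in> {..M} \<rightarrow> H01 D"
    using assms(2) by (rule V_E)
  let ?G = "\<lambda>h y x. \<Sum>k\<in>{..M}. pc k y *\<^sub>R wgrad D (h k) x"
  have G: "(\<lambda>z. ?G h (fst z) (snd z)) \<in> borel_measurable (\<mu> \<Otimes>\<^sub>M lebesgue_on D)"
    if "h \<in> {..M} \<rightarrow> H01 D" for h
  proof (rule borel_measurable_sum)
    fix k assume "k \<in> {..M}"
    then have [measurable]: "wgrad D (h k) \<in> borel_measurable (lebesgue_on D)"
      using wgrad_L2[OF that] L2_onD(1) by auto
    show "(\<lambda>z. pc k (fst z) *\<^sub>R wgrad D (h k) (snd z)) \<in> borel_measurable (\<mu> \<Otimes>\<^sub>M lebesgue_on D)"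
      by measurable
  qed
  have "(\<lambda>y. \<integral>x. b y x * (?G h y x \<bullet> ?G g y x) \<partial>lebesgue_on D) \<in> borel_measurable \<mu>"
  proof (rule DM.borel_measurable_lebesgue_integral)
    show "(\<lambda>(y, x). b y x * (?G h y x \<bullet> ?G g y x)) \<in> borel_measurable (\<mu> \<Otimes>\<^sub>M lebesgue_on D)"
      using borel_measurable_times[OF b_measurable borel_measurable_inner[OF G[OF h] G[OF g]]]
      by (simp add: case_prod_beta)
  qed
  moreover have "inner_form u v y = (\<integral>x. b y x * (?G h y x \<bullet> ?G g y x) \<partial>lebesgue_on D)" if "y \<in> space \<mu>" for y
    unfolding inner_form_def
  proof (rule integral_cong_AE)
    note [measurable] = b_section[OF that] L2_onD(1)[OF V_wgrad[OF assms(1)]] L2_onD(1)[OF V_wgrad[OF assms(2)]]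
    show "(\<lambda>x. b y x * (wgrad D (u y) x \<bullet> wgrad D (v y) x)) \<in> borel_measurable (lebesgue_on D)" by measurable
    show "(\<lambda>x. b y x * (?G h y x \<bullet> ?G g y x)) \<in> borel_measurable (lebesgue_on D)"
      by (intro borel_measurable_times borel_measurable_inner b_section that L2_onD(1) L2_sum(1) wgrad_L2 h g)
    show "AE x in lebesgue_on D. b y x * (wgrad D (u y) x \<bullet> wgrad D (v y) x) = b y x * (?G h y x \<bullet> ?G g y x)"
      using wgrad_expand[OF h, of y] wgrad_expand[OF g, of y] unfolding u v by eventually_elim simp
  qed
  ultimately show ?thesis by (simp cong: measurable_cong)
qed

lemma wgrad_expand_norm:
  assumes "h \<in> {..M} \<rightarrow> H01 D"
  shows "(L2_norm D (wgrad D (expand h y)))\<^sup>2 \<le> real (M + 1) * (\<Sum>k\<le>M. (pc k y)\<^sup>2 * (H01_norm D (h k))\<^sup>2)"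
proof -
  have "L2_norm D (wgrad D (expand h y)) = L2_norm D (\<lambda>x. \<Sum>k\<le>M. pc k y *\<^sub>R wgrad D (h k) x)"
    by (intro L2_norm_cong_AE L2_sum(1) wgrad_L2 V_wgrad expand_in_V wgrad_expand assms)
  then show ?thesis using L2_sum(2)[OF wgrad_L2[OF assms], of "\<lambda>k. pc k y"] by (simp add: H01_norm_def)
qed

lemma Linf_pc_integrable: "integrable (completion \<mu>) (\<lambda>y. \<bar>Linf_norm D (b y)\<bar> * (pc k y)\<^sup>2)"
proof -
  \<comment> \<open>The hypothesis makes only the square of the norm measurable; its root is the
    absolute value, which is why absolute values accompany \<open>Linf_norm\<close> in the
    estimates.\<close>
  have "(\<lambda>y. sqrt ((Linf_norm D (b y))\<^sup>2)) \<in> borel_measurable (completion \<mu>)"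
    by (rule measurable_compose[OF borel_measurable_integrable[OF b_L2] borel_measurable_sqrt])
  then have [measurable]: "(\<lambda>y. \<bar>Linf_norm D (b y)\<bar>) \<in> borel_measurable (completion \<mu>)" by simp
  have [measurable]: "pc k \<in> borel_measurable (completion \<mu>)" by (rule measurable_completion) simp
  have "integrable (completion \<mu>) (\<lambda>y. (Linf_norm D (b y))\<^sup>2 + (pc k y) ^ 4)"
    using b_L2 pc_power4[of k] by (intro Bochner_Integration.integrable_add) (simp_all add: integrable_completion)
  then show ?thesis
  proof (rule Bochner_Integration.integrable_bound)
    show "AE y in completion \<mu>. norm (\<bar>Linf_norm D (b y)\<bar> * (pc k y)\<^sup>2) \<le> norm ((Linf_norm D (b y))\<^sup>2 + (pc k y) ^ 4)"
    proof (intro AE_I2)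
      show "norm (\<bar>Linf_norm D (b y)\<bar> * (pc k y)\<^sup>2) \<le> norm ((Linf_norm D (b y))\<^sup>2 + (pc k y) ^ 4)" for y
        using abs_mult_le_sum_squares[of "\<bar>Linf_norm D (b y)\<bar>" "(pc k y)\<^sup>2"] by simp
    qed
  qed measurable
qed

lemma inner_form_bound:
  assumes h: "h \<in> {..M} \<rightarrow> H01 D" and g: "g \<in> {..M} \<rightarrow> H01 D"
  shows "AE y in completion \<mu>. \<bar>inner_form (expand h) (expand g) y\<bar> \<le>
    real (M + 1) * (\<Sum>k\<le>M. ((H01_norm D (h k))\<^sup>2 + (H01_norm D (g k))\<^sup>2) * (\<bar>Linf_norm D (b y)\<bar> * (pc k y)\<^sup>2))"
  using AE_completion[OF b_Linf]
proof eventually_elim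
  case (elim y)
  have "\<bar>inner_form (expand h) (expand g) y\<bar> \<le>
      Linf_norm D (b y) * ((L2_norm D (wgrad D (expand h y)))\<^sup>2 + (L2_norm D (wgrad D (expand g y)))\<^sup>2)"
    unfolding inner_form_def by (intro Linf_weighted(2) elim V_wgrad expand_in_V h g)
  also have "\<dots> \<le> Linf_norm D (b y) * (real (M + 1) * (\<Sum>k\<le>M. (pc k y)\<^sup>2 * (H01_norm D (h k))\<^sup>2)
      + real (M + 1) * (\<Sum>k\<le>M. (pc k y)\<^sup>2 * (H01_norm D (g k))\<^sup>2))"
    by (intro mult_left_mono add_mono wgrad_expand_norm h g Linf_norm_nonneg elim)
  also have "\<dots> = real (M + 1) * (\<Sum>k\<le>M. ((H01_norm D (h k))\<^sup>2 + (H01_norm D (g k))\<^sup>2) * (Linf_norm D (b y) * (pc k y)\<^sup>2))"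
    by (simp add: sum_distrib_left sum.distrib algebra_simps)
  finally show ?case using Linf_norm_nonneg[OF elim] by simp
qed

lemma inner_form_bound_integrable:
  "integrable (completion \<mu>) (\<lambda>y. real (M + 1) * (\<Sum>k\<le>M. C k * (\<bar>Linf_norm D (b y)\<bar> * (pc k y)\<^sup>2)))"
  by (intro integrable_mult_right Bochner_Integration.integrable_sum Linf_pc_integrable)

lemma inner_form_integrable_completion:
  assumes "u \<in> V" "v \<in> V"
  shows "integrable (completion \<mu>) (inner_form u v)"
proof -
  obtain h where u: "u = expand h" and h: "h \<in> {..M} \<rightarrow> H01 D"
    using assms(1) by (rule V_E)
  obtain g where v: "v = expand g" and g: "g \<in> {..M} \<rightarrow> H01 D"
    using assms(2) by (rule V_E)
  show ?thesis
    using inner_form_bound_integrable[of "\<lambda>k. (H01_norm D (h k))\<^sup>2 + (H01_norm D (g k))\<^sup>2"]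
  proof (rule Bochner_Integration.integrable_bound)
    show "inner_form u v \<in> borel_measurable (completion \<mu>)"
      by (intro measurable_completion inner_form_measurable assms)
    show "AE y in completion \<mu>. norm (inner_form u v y) \<le> norm (real (M + 1) *
        (\<Sum>k\<le>M. ((H01_norm D (h k))\<^sup>2 + (H01_norm D (g k))\<^sup>2) * (\<bar>Linf_norm D (b y)\<bar> * (pc k y)\<^sup>2)))"
      using inner_form_bound[OF h g]
    proof eventually_elim
      case (elim y)
      show ?case unfolding u v real_norm_def by (rule order_trans[OF elim abs_ge_self])
    qed
  qed
qed

text \<open>The inner integral is measurable for \<mu> itself, so the integrability obtained over
  the completion returns to \<mu>.\<close>

lemma inner_form_integrable:
  assumes "u \<in> V" "v \<in> V"
  shows "integrable \<mu> (inner_form u v)"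
  using inner_form_integrable_completion[OF assms] inner_form_measurable[OF assms]
  by (simp add: integrable_completion)

text \<open>Continuity of the form in the coefficients. It turns convergence of all coefficients in
  the gradient norm back into convergence in energy.\<close>

lemma B_upper:
  "\<exists>C. \<forall>h\<in>{..M} \<rightarrow> H01 D. B (expand h) (expand h) \<le> (\<Sum>k\<le>M. C k * (H01_norm D (h k))\<^sup>2)"
proof (intro exI ballI)
  fix h assume h: "h \<in> {..M} \<rightarrow> H01 D"
  then have V: "expand h \<in> V" by (rule expand_in_V)
  let ?C = "\<lambda>k. (H01_norm D (h k))\<^sup>2 + (H01_norm D (h k))\<^sup>2"
  have "B (expand h) (expand h) = (\<integral>y. inner_form (expand h) (expand h) y \<partial>completion \<mu>)"
    unfolding B_eq by (rule integral_completion[symmetric, OF inner_form_measurable[OF V V]])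
  also have "\<dots> \<le> (\<integral>y. real (M + 1) * (\<Sum>k\<le>M. ?C k * (\<bar>Linf_norm D (b y)\<bar> * (pc k y)\<^sup>2)) \<partial>completion \<mu>)"
  proof (rule integral_mono_AE[OF inner_form_integrable_completion[OF V V] inner_form_bound_integrable])
    show "AE y in completion \<mu>. inner_form (expand h) (expand h) y \<le>
       real (M + 1) * (\<Sum>k\<le>M. ?C k * (\<bar>Linf_norm D (b y)\<bar> * (pc k y)\<^sup>2))"
      using inner_form_bound[OF h h] by eventually_elim (rule abs_le_D1)
  qed
  also have "\<dots> = real (M + 1) * (\<Sum>k\<le>M. ?C k * (\<integral>y. \<bar>Linf_norm D (b y)\<bar> * (pc k y)\<^sup>2 \<partial>completion \<mu>))"
    using Linf_pc_integrable by (simp add: Bochner_Integration.integral_sum)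
  \<comment> \<open>The factor of each squared norm no longer depends on h, which makes it an
    admissible witness; the 2 comes from the two equal summands of \<open>?C k\<close>.\<close>
  also have "\<dots> = (\<Sum>k\<le>M. (2 * real (M + 1) * (\<integral>y. \<bar>Linf_norm D (b y)\<bar> * (pc k y)\<^sup>2 \<partial>completion \<mu>)) * (H01_norm D (h k))\<^sup>2)"
    by (simp add: sum_distrib_left algebra_simps)
  finally show "B (expand h) (expand h) \<le> (\<Sum>k\<le>M. (2 * real (M + 1) * (\<integral>y. \<bar>Linf_norm D (b y)\<bar> * (pc k y)\<^sup>2 \<partial>completion \<mu>)) * (H01_norm D (h k))\<^sup>2)" .
qed

lemma B_sym: "B u v = B v u"
  by (simp add: form_B_def inner_commute)

text \<open>For fixed y the gradient is additive only a.e. in x, which the inner integral does not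
  notice; essential boundedness of \<open>b y\<close> makes the two parts integrable
  separately.\<close>

lemma B_add:
  assumes "u \<in> V" "v \<in> V" "w \<in> V"
  shows "B (add u t v) w = B u w + t * B v w"
proof -
  have "AE y in \<mu>. inner_form (add u t v) w y = inner_form u w y + t * inner_form v w y"
    using b_Linf AE_space
  proof eventually_elim
    case (elim y)
    note int = Linf_weighted(1)[OF elim(1) V_wgrad[OF assms(1)] V_wgrad[OF assms(3)], of y y]
      Linf_weighted(1)[OF elim(1) V_wgrad[OF assms(2)] V_wgrad[OF assms(3)], of y y]
    note [measurable] = b_section[OF elim(2)] L2_onD(1)[OF V_wgrad[OF assms(1)]] L2_onD(1)[OF V_wgrad[OF assms(2)]]
      L2_onD(1)[OF V_wgrad[OF assms(3)]] L2_onD(1)[OF V_wgrad[OF V_add[OF assms(1,2)]]]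
    have "inner_form (add u t v) w y = (\<integral>x. b y x * (wgrad D (u y) x \<bullet> wgrad D (w y) x) +
        t * (b y x * (wgrad D (v y) x \<bullet> wgrad D (w y) x)) \<partial>lebesgue_on D)"
      unfolding inner_form_def
    proof (rule integral_cong_AE)
      show "AE x in lebesgue_on D. b y x * (wgrad D (add u t v y) x \<bullet> wgrad D (w y) x) =
          b y x * (wgrad D (u y) x \<bullet> wgrad D (w y) x) + t * (b y x * (wgrad D (v y) x \<bullet> wgrad D (w y) x))"
        using H1_add_scale(2)[OF H01_H1[OF V_H01[OF assms(1)]] H01_H1[OF V_H01[OF assms(2)]], of y t y]
        unfolding add_def by eventually_elim (simp add: inner_add_left algebra_simps)
    qed measurable
    also have "\<dots> = inner_form u w y + t * inner_form v w y"
      using int by (simp add: inner_form_def)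
    finally show ?case .
  qed
  then have "B (add u t v) w = (\<integral>y. inner_form u w y + t * inner_form v w y \<partial>\<mu>)"
    unfolding B_eq using inner_form_measurable assms V_add
    by (intro integral_cong_AE) (auto intro!: borel_measurable_add borel_measurable_times)
  then show ?thesis
    using inner_form_integrable assms by (simp add: B_eq)
qed

lemma B_nonneg: "0 \<le> B u u"
  unfolding B_eq
proof (rule integral_nonneg_AE)
  show "AE y in \<mu>. 0 \<le> inner_form u u y"
    using bmin
  proof eventually_elim
    case (elim y)
    show ?case
      unfolding inner_form_def
    proof (rule integral_nonneg_AE)
      show "AE x in lebesgue_on D. 0 \<le> b y x * (wgrad D (u y) x \<bullet> wgrad D (u y) x)"
        using elim by eventually_elim auto
    qed
  qed
qed

lemma bmin_pos: "AE y in \<mu>. 0 < bmin y"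
  using bmin
proof eventually_elim
  case (elim y)
  then have "AE x in lebesgue_on D. 0 < bmin y" by eventually_elim simp
  then show ?case by (rule AE_D_constD)
qed

text \<open>The integral is the constant of the weighted Cauchy-Schwarz inequality. Adding 1 allows
  division by it and leaves room for the absorption in the coercivity estimate.\<close>

definition coercivity :: "nat \<Rightarrow> real" where
  "coercivity k = (\<integral>y. (pc k y)\<^sup>2 * inverse (bmin y) \<partial>\<mu>) + 1"

lemma integrable_pc_bmin: "integrable \<mu> (\<lambda>y. (pc k y)\<^sup>2 * inverse (bmin y))"
proof -
  note [measurable] = bmin_L2(1)
  have "integrable \<mu> (\<lambda>y. (pc k y) ^ 4 + (inverse (bmin y))\<^sup>2)"
    using pc_power4 bmin_L2(2) by (rule Bochner_Integration.integrable_add)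
  then show ?thesis
  proof (rule Bochner_Integration.integrable_bound)
    show "AE y in \<mu>. norm ((pc k y)\<^sup>2 * inverse (bmin y)) \<le> norm ((pc k y) ^ 4 + (inverse (bmin y))\<^sup>2)"
    proof (intro AE_I2)
      show "norm ((pc k y)\<^sup>2 * inverse (bmin y)) \<le> norm ((pc k y) ^ 4 + (inverse (bmin y))\<^sup>2)" for y
        using abs_mult_le_sum_squares[of "(pc k y)\<^sup>2" "inverse (bmin y)"] by simp
    qed
  qed measurable
qed

lemma coercivity_pos: "0 < coercivity k"
proof -
  have "0 \<le> (\<integral>y. (pc k y)\<^sup>2 * inverse (bmin y) \<partial>\<mu>)"
  proof (rule integral_nonneg_AE)
    show "AE y in \<mu>. 0 \<le> (pc k y)\<^sup>2 * inverse (bmin y)"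
      using bmin_pos by eventually_elim simp
  qed
  then show ?thesis by (simp add: coercivity_def)
qed

text \<open>Orthonormality recovers the coefficient \<open>h k\<close> as the integral of \<open>pc k\<close> against
  \<open>expand h\<close>; the degenerate weight \<open>bmin\<close> is then absorbed by the moments of \<open>1 / bmin\<close>.\<close>

lemma B_coercive:
  assumes k: "k \<le> M" and h: "h \<in> {..M} \<rightarrow> H01 D"
  shows "(H01_norm D (h k))\<^sup>2 \<le> coercivity k * B (expand h) (expand h)"
proof -
  define T where "T = coercivity k"
  define K where "K = (\<integral>y. (pc k y)\<^sup>2 * inverse (bmin y) \<partial>\<mu>)"
  have TK: "T = K + 1" and T: "T > 0"
    using coercivity_pos[of k] by (simp_all add: T_def K_def coercivity_def)
  have V: "expand h \<in> V" using h by (rule expand_in_V)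
  have g: "wgrad D (h j) \<in> L2_on D" if "j \<le> M" for j using wgrad_L2[OF h] that by auto
  let ?w = "wgrad D (h k)"
  let ?ip = "\<lambda>j. \<integral>x. wgrad D (h j) x \<bullet> ?w x \<partial>lebesgue_on D"
  \<comment> \<open>Pairing in x with the gradient of the k-th coefficient turns the expansion into
    a scalar combination of the \<open>pc j y\<close>, from which orthonormality then selects the
    k-th term.\<close>
  have ip: "(\<integral>x. wgrad D (expand h y) x \<bullet> ?w x \<partial>lebesgue_on D) = (\<Sum>j\<le>M. pc j y * ?ip j)" for y
  proof -
    have "(\<integral>x. wgrad D (expand h y) x \<bullet> ?w x \<partial>lebesgue_on D) =
        (\<integral>x. (\<Sum>j\<le>M. pc j y *\<^sub>R wgrad D (h j) x) \<bullet> ?w x \<partial>lebesgue_on D)"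
    proof (rule integral_cong_AE)
      show "(\<lambda>x. wgrad D (expand h y) x \<bullet> ?w x) \<in> borel_measurable (lebesgue_on D)"
        using L2_inner[OF V_wgrad[OF V] g[OF k]] by simp
      show "(\<lambda>x. (\<Sum>j\<le>M. pc j y *\<^sub>R wgrad D (h j) x) \<bullet> ?w x) \<in> borel_measurable (lebesgue_on D)"
        using L2_inner[OF L2_sum(1)[OF wgrad_L2[OF h]] g[OF k]] by simp
      show "AE x in lebesgue_on D. wgrad D (expand h y) x \<bullet> ?w x = (\<Sum>j\<le>M. pc j y *\<^sub>R wgrad D (h j) x) \<bullet> ?w x"
        using wgrad_expand[OF h, of y] by eventually_elim simp
    qed
    also have "\<dots> = (\<integral>x. (\<Sum>j\<le>M. pc j y * (wgrad D (h j) x \<bullet> ?w x)) \<partial>lebesgue_on D)"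
      by (simp add: inner_sum_left)
    also have "\<dots> = (\<Sum>j\<le>M. pc j y * ?ip j)"
      using L2_inner[OF g g[OF k]] by (subst Bochner_Integration.integral_sum) auto
    finally show ?thesis .
  qed
  have "(\<integral>y. pc k y * (\<Sum>j\<le>M. pc j y * ?ip j) \<partial>\<mu>) = (\<integral>y. (\<Sum>j\<le>M. pc k y * pc j y * ?ip j) \<partial>\<mu>)"
    by (simp add: sum_distrib_left mult.assoc)
  also have "\<dots> = (\<Sum>j\<le>M. (if k = j then 1 else 0) * ?ip j)"
    using pc_integrable by (subst Bochner_Integration.integral_sum) (auto simp: pc_orthonormal)
  also have "\<dots> = ?ip k" using k by (simp add: if_distrib[of "\<lambda>t. t * _"] cong: if_cong)
  also have "\<dots> = (H01_norm D (h k))\<^sup>2"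
    by (simp add: H01_norm_def L2_norm_power2 power2_norm_eq_inner)
  finally have coeff: "(\<integral>y. pc k y * (\<Sum>j\<le>M. pc j y * ?ip j) \<partial>\<mu>) = (H01_norm D (h k))\<^sup>2" .
  have int_coeff: "integrable \<mu> (\<lambda>y. pc k y * (\<Sum>j\<le>M. pc j y * ?ip j))"
    using pc_integrable[of k] by (auto simp: sum_distrib_left mult.assoc[symmetric])
  have "2 * (H01_norm D (h k))\<^sup>2 = (\<integral>y. 2 * (pc k y * (\<Sum>j\<le>M. pc j y * ?ip j)) \<partial>\<mu>)"
    using coeff by simp
  also have "\<dots> \<le> (\<integral>y. T * inner_form (expand h) (expand h) y +
      (H01_norm D (h k))\<^sup>2 / T * ((pc k y)\<^sup>2 * inverse (bmin y)) \<partial>\<mu>)"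
  proof (rule integral_mono_AE)
    show "AE y in \<mu>. 2 * (pc k y * (\<Sum>j\<le>M. pc j y * ?ip j)) \<le> T * inner_form (expand h) (expand h) y +
        (H01_norm D (h k))\<^sup>2 / T * ((pc k y)\<^sup>2 * inverse (bmin y))"
      using bmin_pos bmin b_Linf
    proof eventually_elim
      case (elim y)
      \<comment> \<open>The Young weight depends on y. With the factor \<open>bmin y\<close> the
        first term is dominated by the inner form, and its reciprocal supplies the
        \<open>inverse (bmin y)\<close> of the second.\<close>
      define s where "s = T * bmin y"
      have s: "s > 0" using T elim(1) by (simp add: s_def)
      let ?n = "L2_norm D (wgrad D (expand h y))" and ?m = "H01_norm D (h k)"
      have "bmin y * ?n\<^sup>2 \<le> inner_form (expand h) (expand h) y"
        unfolding inner_form_def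
      proof (intro weighted_lower_bound V_wgrad[OF V] elim(3))
        show "AE x in lebesgue_on D. bmin y \<le> b y x" using elim(2) by eventually_elim simp
      qed
      then have 1: "s * ?n\<^sup>2 \<le> T * inner_form (expand h) (expand h) y"
        using T by (simp add: s_def mult.assoc)
      have "\<bar>\<integral>x. wgrad D (expand h y) x \<bullet> ?w x \<partial>lebesgue_on D\<bar> \<le> ?n * ?m"
        using L2_Cauchy_Schwarz[OF V_wgrad[OF V] g[OF k]] by (simp add: H01_norm_def)
      then have "\<bar>pc k y\<bar> * \<bar>\<Sum>j\<le>M. pc j y * ?ip j\<bar> \<le> \<bar>pc k y\<bar> * (?n * ?m)"
        unfolding ip by (rule mult_left_mono) simp
      then have "2 * (pc k y * (\<Sum>j\<le>M. pc j y * ?ip j)) \<le> 2 * (\<bar>pc k y\<bar> * (?n * ?m))"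
        by (simp flip: abs_mult)
      also have "\<dots> \<le> s * ?n\<^sup>2 + ?m\<^sup>2 * (pc k y)\<^sup>2 / s"
      proof -
        have "0 \<le> (s * ?n - \<bar>pc k y\<bar> * ?m)\<^sup>2 / s" using s by simp
        also have "\<dots> = s * ?n\<^sup>2 - 2 * (\<bar>pc k y\<bar> * (?n * ?m)) + ?m\<^sup>2 * (pc k y)\<^sup>2 / s"
          using s by (simp add: power2_diff power_mult_distrib field_simps power2_eq_square)
        finally show ?thesis by simp
      qed
      also have "?m\<^sup>2 * (pc k y)\<^sup>2 / s = ?m\<^sup>2 / T * ((pc k y)\<^sup>2 * inverse (bmin y))"
        by (simp add: s_def field_simps)
      finally show ?case using 1 by linarith
    qed
  qed (use int_coeff inner_form_integrable[OF V V] integrable_pc_bmin[of k] in auto)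
  also have "\<dots> = T * B (expand h) (expand h) + (H01_norm D (h k))\<^sup>2 / T * K"
    using inner_form_integrable[OF V V] integrable_pc_bmin[of k] by (simp add: B_eq K_def)
  \<comment> \<open>As T = K + 1 exceeds K, this term is at most one of the two copies of the
    squared norm with which the estimate began, and it cancels against that copy.\<close>
  also have "(H01_norm D (h k))\<^sup>2 / T * K \<le> (H01_norm D (h k))\<^sup>2"
  proof -
    have "K / T \<le> 1" using T TK by simp
    from mult_left_mono[OF this, of "(H01_norm D (h k))\<^sup>2"] show ?thesis by simp
  qed
  finally show ?thesis by (simp add: T_def)
qed

text \<open>On the ansatz space the load is a finite combination of numbers: dual pairings of
  coefficients with coefficients, weighted by moments of the basis functions. Linearity and
  boundedness are then read off from the single functionals.\<close>

lemma F_expand: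
  assumes h: "h \<in> {..M} \<rightarrow> H01 D"
  shows "F (expand h) = (\<Sum>k\<le>M. \<Sum>j\<le>M. \<psi> k (h j) * (\<integral>y. c y * pc k y * pc j y \<partial>\<mu>))"
proof -
  have "F (expand h) = (\<integral>y. (\<Sum>k\<le>M. \<Sum>j\<le>M. \<psi> k (h j) * (c y * pc k y * pc j y)) \<partial>\<mu>)"
    unfolding form_F_def
  proof (rule Bochner_Integration.integral_cong)
    fix y
    have "\<psi> k (expand h y) = (\<Sum>j\<le>M. \<psi> k (h j) * pc j y)" if "k \<le> M" for k
      unfolding expand_def using \<psi>[OF that] h by (rule Hm1_sum)
    then show "c y * (\<Sum>k\<le>M. \<psi> k (expand h y) * pc k y) = (\<Sum>k\<le>M. \<Sum>j\<le>M. \<psi> k (h j) * (c y * pc k y * pc j y))"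
      by (simp add: sum_distrib_left sum_distrib_right mult_ac)
  qed simp
  also have "\<dots> = (\<Sum>k\<le>M. \<Sum>j\<le>M. \<psi> k (h j) * (\<integral>y. c y * pc k y * pc j y \<partial>\<mu>))"
    using c_integrable by (simp add: Bochner_Integration.integral_sum)
  finally show ?thesis .
qed

lemma F_add:
  assumes "u \<in> V" "v \<in> V"
  shows "F (add u t v) = F u + t * F v"
proof -
  obtain h where u: "u = expand h" and h: "h \<in> {..M} \<rightarrow> H01 D"
    using assms(1) by (rule V_E)
  obtain g where v: "v = expand g" and g: "g \<in> {..M} \<rightarrow> H01 D"
    using assms(2) by (rule V_E)
  have "F (add u t v) = (\<Sum>k\<le>M. \<Sum>j\<le>M. \<psi> k (\<lambda>z. h j z + t * g j z) * (\<integral>y. c y * pc k y * pc j y \<partial>\<mu>))"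
    unfolding u v add_expand using h g by (intro F_expand) (auto intro!: H01_add_scale)
  also have "\<dots> = (\<Sum>k\<le>M. \<Sum>j\<le>M. (\<psi> k (h j) + t * \<psi> k (g j)) * (\<integral>y. c y * pc k y * pc j y \<partial>\<mu>))"
    using h g \<psi> by (intro sum.cong refl) (auto simp: Hm1D(1) Pi_iff)
  also have "\<dots> = F u + t * F v"
    unfolding u v F_expand[OF h] F_expand[OF g]
    by (simp add: sum.distrib sum_distrib_left algebra_simps)
  finally show ?thesis .
qed

text \<open>Each pairing is bounded by the gradient norm of one coefficient, and coercivity bounds
  that norm by the energy. The square is the form in which the abstract existence result expects
  it.\<close>

lemma F_bounded: "\<exists>C. \<forall>u\<in>V. (F u)\<^sup>2 \<le> C * B u u"
proof -
  have "\<forall>k\<in>{..M}. \<exists>N. 0 \<le> N \<and> (\<forall>u\<in>H01 D. \<bar>\<psi> k u\<bar> \<le> N * H01_norm D u)"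
    using Hm1D(2)[OF \<psi>] by auto
  from bchoice[OF this] obtain N where
    N: "\<forall>k\<in>{..M}. 0 \<le> N k \<and> (\<forall>u\<in>H01 D. \<bar>\<psi> k u\<bar> \<le> N k * H01_norm D u)" ..
  define C where "C = (\<Sum>k\<le>M. \<Sum>j\<le>M. N k * sqrt (coercivity j) * \<bar>\<integral>y. c y * pc k y * pc j y \<partial>\<mu>\<bar>)"
  have "(F u)\<^sup>2 \<le> C\<^sup>2 * B u u" if uV: "u \<in> V" for u
  proof -
    obtain h where u: "u = expand h" and h: "h \<in> {..M} \<rightarrow> H01 D"
      using uV by (rule V_E)
    have "\<bar>F u\<bar> \<le> (\<Sum>k\<le>M. \<bar>\<Sum>j\<le>M. \<psi> k (h j) * (\<integral>y. c y * pc k y * pc j y \<partial>\<mu>)\<bar>)"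
      unfolding u F_expand[OF h] by (rule sum_abs)
    also have "\<dots> \<le> (\<Sum>k\<le>M. \<Sum>j\<le>M. \<bar>\<psi> k (h j) * (\<integral>y. c y * pc k y * pc j y \<partial>\<mu>)\<bar>)"
      by (intro sum_mono sum_abs)
    also have "\<dots> \<le> (\<Sum>k\<le>M. \<Sum>j\<le>M. (N k * (sqrt (coercivity j) * sqrt (B u u))) * \<bar>\<integral>y. c y * pc k y * pc j y \<partial>\<mu>\<bar>)"
    proof (intro sum_mono)
      fix k j assume kj: "k \<in> {..M}" "j \<in> {..M}"
      have "H01_norm D (h j) \<le> sqrt (coercivity j) * sqrt (B u u)"
        using B_coercive[OF _ h, of j] kj unfolding u real_sqrt_mult[symmetric] by (intro real_le_rsqrt) auto
      then have "N k * H01_norm D (h j) \<le> N k * (sqrt (coercivity j) * sqrt (B u u))"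
        using N kj by (intro mult_left_mono) auto
      moreover have "h j \<in> H01 D" using h kj(2) by (rule funcset_mem)
      then have "\<bar>\<psi> k (h j)\<bar> \<le> N k * H01_norm D (h j)" using N kj(1) by blast
      ultimately have "\<bar>\<psi> k (h j)\<bar> \<le> N k * (sqrt (coercivity j) * sqrt (B u u))" by linarith
      then show "\<bar>\<psi> k (h j) * (\<integral>y. c y * pc k y * pc j y \<partial>\<mu>)\<bar> \<le>
          (N k * (sqrt (coercivity j) * sqrt (B u u))) * \<bar>\<integral>y. c y * pc k y * pc j y \<partial>\<mu>\<bar>"
        unfolding abs_mult by (rule mult_right_mono) simp
    qed
    also have "\<dots> = C * sqrt (B u u)"
      by (simp add: C_def sum_distrib_left sum_distrib_right mult_ac)
    finally have "\<bar>F u\<bar>\<^sup>2 \<le> (C * sqrt (B u u))\<^sup>2" by (intro power_mono) auto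
    then show ?thesis using B_nonneg[of u] by (simp add: power_mult_distrib)
  qed
  then show ?thesis by blast
qed

lemma add_minus_expand: "add (expand h) (- 1) (expand g) = expand (\<lambda>k z. h k z - g k z)"
  by (simp add: add_expand)

text \<open>Coercivity makes an energy Cauchy sequence Cauchy in each coefficient,
  \<open>H01 D\<close> supplies the limits of the coefficients, and the upper bound returns to the
  energy.\<close>

lemma V_complete:
  assumes X: "\<And>n. X n \<in> V"
    and Cauchy: "\<And>e. e > 0 \<Longrightarrow> \<exists>N. \<forall>m\<ge>N. \<forall>n\<ge>N. B (add (X m) (- 1) (X n)) (add (X m) (- 1) (X n)) < e"
  shows "\<exists>u\<in>V. (\<lambda>n. B (add (X n) (- 1) u) (add (X n) (- 1) u)) \<longlonglongrightarrow> 0"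
proof -
  have "\<forall>n. \<exists>h. X n = expand h \<and> h \<in> {..M} \<rightarrow> H01 D"
    using V_E[OF X] by metis
  from choice[OF this] obtain h where h: "\<And>n. X n = expand (h n)" "\<And>n. h n \<in> {..M} \<rightarrow> H01 D" by blast
  have hd: "(\<lambda>k z. h m k z - g k z) \<in> {..M} \<rightarrow> H01 D" if "g \<in> {..M} \<rightarrow> H01 D" for m g
    using h(2)[of m] that by (auto intro!: H01_diff)
  have "\<exists>u. u \<in> H01 D \<and> (\<lambda>n. (H01_norm D (\<lambda>x. h n k x - u x))\<^sup>2) \<longlonglongrightarrow> 0" if k: "k \<le> M" for k
    unfolding Bex_def[symmetric]
  proof (rule H01_complete)
    show "h n k \<in> H01 D" for n using h(2)[of n] k by auto
    let ?C = "coercivity k"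
    fix e :: real assume "e > 0"
    then have "e / ?C > 0" using coercivity_pos[of k] by simp
    from Cauchy[OF this] obtain N where N: "\<And>m n. N \<le> m \<Longrightarrow> N \<le> n \<Longrightarrow>
      B (add (X m) (- 1) (X n)) (add (X m) (- 1) (X n)) < e / ?C" by blast
    have "(H01_norm D (\<lambda>x. h m k x - h n k x))\<^sup>2 < e" if mn: "N \<le> m" "N \<le> n" for m n
    proof -
      have "(H01_norm D (\<lambda>x. h m k x - h n k x))\<^sup>2 \<le> ?C * B (add (X m) (- 1) (X n)) (add (X m) (- 1) (X n))"
        using B_coercive[OF k hd[OF h(2)]] by (simp add: h(1) add_minus_expand)
      also have "\<dots> < ?C * (e / ?C)"
        using N[OF mn] coercivity_pos by (rule mult_strict_left_mono)
      also have "\<dots> = e" using coercivity_pos[of k] by simp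
      finally show ?thesis .
    qed
    then show "\<exists>N. \<forall>m\<ge>N. \<forall>n\<ge>N. (H01_norm D (\<lambda>x. h m k x - h n k x))\<^sup>2 < e" by blast
  qed
  then have "\<forall>k\<in>{..M}. \<exists>u. u \<in> H01 D \<and> (\<lambda>n. (H01_norm D (\<lambda>x. h n k x - u x))\<^sup>2) \<longlonglongrightarrow> 0" by simp
  from bchoice[OF this] obtain g where g: "g \<in> {..M} \<rightarrow> H01 D"
    "\<forall>k\<in>{..M}. (\<lambda>n. (H01_norm D (\<lambda>x. h n k x - g k x))\<^sup>2) \<longlonglongrightarrow> 0" by blast
  obtain C where C: "\<And>h. h \<in> {..M} \<rightarrow> H01 D \<Longrightarrow> B (expand h) (expand h) \<le> (\<Sum>k\<le>M. C k * (H01_norm D (h k))\<^sup>2)"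
    using B_upper by blast
  have gV: "expand g \<in> V" using g(1) by (rule expand_in_V)
  have "(\<lambda>n. B (add (X n) (- 1) (expand g)) (add (X n) (- 1) (expand g))) \<longlonglongrightarrow> 0"
  proof (rule tendsto_sandwich[OF _ _ tendsto_const])
    show "\<forall>\<^sub>F n in sequentially. 0 \<le> B (add (X n) (- 1) (expand g)) (add (X n) (- 1) (expand g))"
      using B_nonneg by simp
    have "B (add (X n) (- 1) (expand g)) (add (X n) (- 1) (expand g)) \<le>
        (\<Sum>k\<le>M. C k * (H01_norm D (\<lambda>x. h n k x - g k x))\<^sup>2)" for n
      unfolding h(1) add_minus_expand by (rule C) (rule hd[OF g(1)])
    then show "\<forall>\<^sub>F n in sequentially. B (add (X n) (- 1) (expand g)) (add (X n) (- 1) (expand g)) \<le>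
        (\<Sum>k\<le>M. C k * (H01_norm D (\<lambda>x. h n k x - g k x))\<^sup>2)" by simp
    show "(\<lambda>n. \<Sum>k\<le>M. C k * (H01_norm D (\<lambda>x. h n k x - g k x))\<^sup>2) \<longlonglongrightarrow> 0"
      using g(2) by (intro tendsto_null_sum tendsto_mult_right_zero) auto
  qed
  then show ?thesis using gV by blast
qed

text \<open>The single source of both uniqueness claims: coercivity annihilates the gradients of all
  coefficient differences, and the Poincare inequality the differences themselves.\<close>

lemma B_diff_zero_imp_L2_eq:
  assumes "u \<in> V" "w \<in> V" and zero: "B (add w (- 1) u) (add w (- 1) u) = 0"
  shows "L2_eq \<mu> D w u"
proof -
  obtain h where u: "u = expand h" and h: "h \<in> {..M} \<rightarrow> H01 D"
    using assms(1) by (rule V_E)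
  obtain g where w: "w = expand g" and g: "g \<in> {..M} \<rightarrow> H01 D"
    using assms(2) by (rule V_E)
  have "AE x in lebesgue_on D. g k x = h k x" if k: "k \<le> M" for k
  proof -
    have d: "(\<lambda>k z. g k z - h k z) \<in> {..M} \<rightarrow> H01 D" using g h by (auto intro!: H01_diff)
    then have gh: "(\<lambda>x. g k x - h k x) \<in> H01 D" using k by auto
    from B_coercive[OF k d] have "(H01_norm D (\<lambda>x. g k x - h k x))\<^sup>2 \<le> 0"
      using zero by (simp add: u w add_minus_expand)
    moreover obtain C' where "\<And>u. u \<in> H01 D \<Longrightarrow> (L2_norm D u)\<^sup>2 \<le> C' * (H01_norm D u)\<^sup>2"
      using poincare by blast
    ultimately have "(L2_norm D (\<lambda>x. g k x - h k x))\<^sup>2 \<le> 0" using gh by force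
    then have "(\<integral>x. (norm (g k x - h k x))\<^sup>2 \<partial>lebesgue_on D) \<le> 0"
      by (simp only: L2_norm_power2)
    moreover have "0 \<le> (\<integral>x. (norm (g k x - h k x))\<^sup>2 \<partial>lebesgue_on D)"
      by (intro integral_nonneg_AE) auto
    ultimately have "(\<integral>x. (norm (g k x - h k x))\<^sup>2 \<partial>lebesgue_on D) = 0" by linarith
    then have "AE x in lebesgue_on D. (norm (g k x - h k x))\<^sup>2 = 0"
      using L2_onD(2)[OF H1_L2[OF H01_H1[OF gh]]] by (subst (asm) integral_nonneg_eq_0_iff_AE) auto
    then show ?thesis by eventually_elim simp
  qed
  then have "AE x in lebesgue_on D. \<forall>k\<in>{..M}. g k x = h k x"
    by (intro AE_finite_allI) auto
  \<comment> \<open>The exceptional set comes from the finitely many coefficients and is the same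
    for all y.\<close>
  then have "AE x in lebesgue_on D. w y x = u y x" for y
    by eventually_elim (auto simp: u w expand_def)
  then show ?thesis by (simp add: L2_eq_def)
qed

text \<open>The energy of w exceeds that of a solution u by half the form evaluated at w - u. This
  makes u a minimiser, and any other minimiser, like any other solution, has difference of zero
  energy from u.\<close>

theorem galerkin_ritz:
  "\<exists>u. galerkin_solution B F V u \<and> (\<forall>w. galerkin_solution B F V w \<longrightarrow> L2_eq \<mu> D w u) \<and>
    is_arg_min (ritz_energy B F) (\<lambda>w. w \<in> V) u \<and>
    (\<forall>w. is_arg_min (ritz_energy B F) (\<lambda>w. w \<in> V) w \<longrightarrow> L2_eq \<mu> D w u)"
proof -
  have "expand (\<lambda>_ _. 0) \<in> V" by (intro expand_in_V) (simp add: zero_H01)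
  then have "V \<noteq> {}" by blast
  obtain C where C: "\<And>u. u \<in> V \<Longrightarrow> (F u)\<^sup>2 \<le> C * B u u" using F_bounded by blast
  have "\<exists>u\<in>V. \<forall>v\<in>V. B u v = F v"
  proof (rule symmetric_Riesz[where V = V and B = B and F = F and add = add and C = C])
    show "V \<noteq> {}" by fact
    show "add u t v \<in> V" if "u \<in> V" "v \<in> V" for u v t using that by (rule V_add)
    show "B u v = B v u" for u v by (rule B_sym)
    show "B (add u t v) w = B u w + t * B v w" if "u \<in> V" "v \<in> V" "w \<in> V" for u v w t
      using that by (rule B_add)
    show "F (add u t v) = F u + t * F v" if "u \<in> V" "v \<in> V" for u v t using that by (rule F_add)
    show "0 \<le> B u u" for u by (rule B_nonneg)
    show "(F u)\<^sup>2 \<le> C * B u u" if "u \<in> V" for u using that by (rule C)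
    fix X :: "nat \<Rightarrow> 'y \<Rightarrow> 'a \<Rightarrow> real" assume "\<And>n. X n \<in> V"
      "\<And>e. e > 0 \<Longrightarrow> \<exists>N. \<forall>m\<ge>N. \<forall>n\<ge>N. B (add (X m) (- 1) (X n)) (add (X m) (- 1) (X n)) < e"
    then show "\<exists>u\<in>V. (\<lambda>n. B (add (X n) (- 1) u) (add (X n) (- 1) u)) \<longlonglongrightarrow> 0" by (rule V_complete)
  qed
  then obtain u where u: "u \<in> V" "\<And>v. v \<in> V \<Longrightarrow> B u v = F v" by blast
  have energy: "ritz_energy B F w = ritz_energy B F u + 1 / 2 * B (add w (- 1) u) (add w (- 1) u)" if w: "w \<in> V" for w
  proof -
    let ?d = "add w (- 1) u"
    have d: "?d \<in> V" using w u(1) by (rule V_add)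
    have "B ?d ?d = B w ?d - B u ?d" using B_add[OF w u(1) d, of "- 1"] by simp
    also have "B w ?d = B w w - B u w"
      using B_add[OF w u(1) w, of "- 1"] by (simp add: B_sym[of w ?d])
    also have "B u ?d = B u w - B u u"
      using B_add[OF w u(1) u(1), of "- 1"] by (simp add: B_sym[of u ?d] B_sym[of u w])
    finally show ?thesis using u(2)[OF w] u(2)[OF u(1)] by (simp add: ritz_energy_def algebra_simps)
  qed
  have eq: "L2_eq \<mu> D w u" if "galerkin_solution B F V w" for w
  proof -
    have w: "w \<in> V" "\<And>v. v \<in> V \<Longrightarrow> B w v = F v" using that by (auto simp: galerkin_solution_def)
    have d: "add w (- 1) u \<in> V" using w(1) u(1) by (rule V_add)
    have "B (add w (- 1) u) (add w (- 1) u) = 0"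
      using B_add[OF w(1) u(1) d, of "- 1"] w(2)[OF d] u(2)[OF d] by simp
    then show ?thesis using u(1) w(1) by (intro B_diff_zero_imp_L2_eq)
  qed
  have min: "ritz_energy B F u \<le> ritz_energy B F w" if "w \<in> V" for w
    using energy[OF that] B_nonneg[of "add w (- 1) u"] by simp
  have "L2_eq \<mu> D w u" if "is_arg_min (ritz_energy B F) (\<lambda>w. w \<in> V) w" for w
  proof -
    have w: "w \<in> V" and "\<not> ritz_energy B F u < ritz_energy B F w"
      using that u(1) by (auto simp: is_arg_min_def)
    then have "B (add w (- 1) u) (add w (- 1) u) = 0"
      using energy[OF w] B_nonneg[of "add w (- 1) u"] by simp
    then show ?thesis using u(1) w by (intro B_diff_zero_imp_L2_eq)
  qed
  then show ?thesis
    using u eq min by (intro exI[of _ u]) (auto simp: galerkin_solution_def is_arg_min_def not_less)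
qed

end

section \<open>Polynomial chaos\<close>

lemma integrable_poly:
  fixes X :: "'w \<Rightarrow> real"
  assumes "\<And>k. integrable M (\<lambda>\<omega>. X \<omega> ^ k)"
  shows "integrable M (\<lambda>\<omega>. poly q (X \<omega>))"
  unfolding poly_altdef using assms by (intro Bochner_Integration.integrable_sum integrable_mult_right)

text \<open>A probability measure is required at every index, also from N on, because the theory of
  product probability spaces works with a total family of factors.\<close>

locale polynomial_chaos =
  fixes m :: "nat \<Rightarrow> real measure" and N :: nat and p :: "nat \<Rightarrow> nat \<Rightarrow> real poly"
    and \<alpha> :: "nat \<Rightarrow> nat \<Rightarrow> nat"
  assumes prob: "\<And>n. prob_space (m n)"
    and poly_integrable: "\<And>n q. n < N \<Longrightarrow> integrable (m n) (poly q)"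
    and orthonormal: "\<And>n i j. n < N \<Longrightarrow> (\<integral>t. poly (p n i) t * poly (p n j) t \<partial>m n) = (if i = j then 1 else 0)"
    and enum: "bij_betw \<alpha> UNIV (multi_indices N)"
begin

sublocale product_prob_space m
  using prob by (simp add: product_prob_space_def product_prob_space_axioms_def product_sigma_finite_def
      prob_space_imp_sigma_finite)

abbreviation "\<mu> \<equiv> \<Pi>\<^sub>M n\<in>{..<N}. m n"

lemma product_integrable:
  "integrable \<mu> (\<lambda>y. \<Prod>n<N. poly (q n) (y n))"
  by (rule product_integrable_prod) (auto intro: poly_integrable)

text \<open>A product of tensor polynomials is again a tensor product of one-variable polynomials,
  so integrals of products factorise over the coordinates.\<close>

lemma tensor_poly_mult:
  "tensor_poly N p \<nu> y * tensor_poly N p \<kappa> y = (\<Prod>n<N. poly (p n (\<nu> n) * p n (\<kappa> n)) (y n))"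
  by (simp add: tensor_poly_def prod.distrib)

lemma tensor_poly_integrable:
  "integrable \<mu> (\<lambda>y. tensor_poly N p \<nu> y * tensor_poly N p \<kappa> y)"
  unfolding tensor_poly_mult by (rule product_integrable)

lemma tensor_poly_integrable3:
  "integrable \<mu> (\<lambda>y. tensor_poly N p \<nu> y * tensor_poly N p \<kappa> y * tensor_poly N p \<rho> y)"
  using product_integrable[of "\<lambda>n. p n (\<nu> n) * p n (\<kappa> n) * p n (\<rho> n)"]
  by (simp add: tensor_poly_def prod.distrib)

lemma tensor_poly_power4: "integrable \<mu> (\<lambda>y. (tensor_poly N p \<nu> y) ^ 4)"
  using product_integrable[of "\<lambda>n. p n (\<nu> n) ^ 4"]
  by (simp add: tensor_poly_def prod_power_distrib)

lemma tensor_poly_measurable: "tensor_poly N p \<nu> \<in> borel_measurable \<mu>"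
  unfolding tensor_poly_def using borel_measurable_integrable[OF product_integrable[of "\<lambda>n. p n (\<nu> n)"]] by simp

lemma tensor_poly_orthonormal:
  "(\<integral>y. tensor_poly N p (\<alpha> i) y * tensor_poly N p (\<alpha> j) y \<partial>\<mu>) = (if i = j then 1 else 0)"
proof -
  have "(\<integral>y. tensor_poly N p (\<alpha> i) y * tensor_poly N p (\<alpha> j) y \<partial>\<mu>) =
      (\<Prod>n<N. \<integral>t. poly (p n (\<alpha> i n) * p n (\<alpha> j n)) t \<partial>m n)"
    unfolding tensor_poly_mult by (rule product_integral_prod) (auto intro: poly_integrable simp del: poly_mult)
  also have "\<dots> = (\<Prod>n<N. if \<alpha> i n = \<alpha> j n then 1 else 0)"
    by (intro prod.cong refl) (simp add: orthonormal)
  also have "\<dots> = (if \<forall>n<N. \<alpha> i n = \<alpha> j n then 1 else 0)"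
    by (auto intro!: prod.neutral simp: prod_zero_iff)
  also have "(\<forall>n<N. \<alpha> i n = \<alpha> j n) \<longleftrightarrow> i = j"
  proof
    assume eq: "\<forall>n<N. \<alpha> i n = \<alpha> j n"
    \<comment> \<open>Multi-indices are extensional functions, so agreement below N is equality and
      injectivity of the enumeration applies.\<close>
    have "\<alpha> i \<in> multi_indices N" "\<alpha> j \<in> multi_indices N" using enum by (auto simp: bij_betw_def)
    then have "\<alpha> i = \<alpha> j"
      using eq unfolding multi_indices_def by (intro PiE_ext) auto
    then show "i = j" using enum by (auto simp: bij_betw_def dest: injD)
  qed simp
  finally show ?thesis .
qed

end

lemma Lp_real_inverse_2:
  assumes "(\<lambda>y. inverse (g y)) \<in> Lp_real \<mu> 2"
  shows "(\<lambda>y. inverse (g y)) \<in> borel_measurable \<mu>" "integrable \<mu> (\<lambda>y. (inverse (g y))\<^sup>2)"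
proof -
  show "(\<lambda>y. inverse (g y)) \<in> borel_measurable \<mu>" using assms by (simp add: Lp_real_def)
  show "integrable \<mu> (\<lambda>y. (inverse (g y))\<^sup>2)" using assms by (simp add: Lp_real_def)
qed

theorem theorem3p13:
  fixes Pr :: "'w measure"
    and D :: "(real ^ 'd) set"
    and N P M :: nat
    and \<Gamma> :: "nat \<Rightarrow> real set"
    and Y :: "nat \<Rightarrow> 'w \<Rightarrow> real"
    and \<mu> :: "(nat \<Rightarrow> real) measure"
    and p :: "nat \<Rightarrow> nat \<Rightarrow> real poly"
    and \<alpha> :: "nat \<Rightarrow> nat \<Rightarrow> nat"
    and pc :: "nat \<Rightarrow> (nat \<Rightarrow> real) \<Rightarrow> real"
    and a :: "'w \<Rightarrow> real ^ 'd \<Rightarrow> real"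
    and amin amax :: "'w \<Rightarrow> real"
    and f :: "'w \<Rightarrow> (real ^ 'd \<Rightarrow> real) \<Rightarrow> real"
    and abar abold :: "(nat \<Rightarrow> real) \<Rightarrow> real ^ 'd \<Rightarrow> real"
    and aminbar amaxbar :: "(nat \<Rightarrow> real) \<Rightarrow> real"
    and fbar fM :: "(nat \<Rightarrow> real) \<Rightarrow> (real ^ 'd \<Rightarrow> real) \<Rightarrow> real"
    and B :: "((nat \<Rightarrow> real) \<Rightarrow> real ^ 'd \<Rightarrow> real) \<Rightarrow> ((nat \<Rightarrow> real) \<Rightarrow> real ^ 'd \<Rightarrow> real) \<Rightarrow> real"
    and F :: "((nat \<Rightarrow> real) \<Rightarrow> real ^ 'd \<Rightarrow> real) \<Rightarrow> real"
    and V :: "((nat \<Rightarrow> real) \<Rightarrow> real ^ 'd \<Rightarrow> real) set"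
    and r :: real
  \<comment> \<open>probability space and domain\<close>
  assumes "prob_space Pr" and "complete_measure Pr"
    and "lipschitz_domain D"
  \<comment> \<open>underlying random variables\<close>
    and "N \<ge> 1"
    and "\<And>n. n < N \<Longrightarrow> \<Gamma> n \<in> sets borel"
    and "\<And>n. n < N \<Longrightarrow> Y n \<in> borel_measurable Pr"
    and "\<And>n \<omega>. n < N \<Longrightarrow> \<omega> \<in> space Pr \<Longrightarrow> Y n \<omega> \<in> \<Gamma> n"
    and "prob_space.indep_vars Pr (\<lambda>_. borel) Y {..<N}"
    and "\<And>n. n < N \<Longrightarrow> continuous_on UNIV (cdf (distr Pr borel (Y n)))"
    and "\<And>n k. n < N \<Longrightarrow> integrable Pr (\<lambda>\<omega>. Y n \<omega> ^ k)"
    and "\<And>n. n < N \<Longrightarrow> determinate (distr Pr borel (Y n))"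
    and "\<mu> = (\<Pi>\<^sub>M n\<in>{..<N}. distr Pr (restrict_space borel (\<Gamma> n)) (Y n))"
  \<comment> \<open>polynomial basis and truncation index\<close>
    and "\<And>n. n < N \<Longrightarrow> orthonormal_poly_basis (distr Pr (restrict_space borel (\<Gamma> n)) (Y n)) (p n)"
    and "grlex_enumeration N \<alpha>"
    and "pc = (\<lambda>k. tensor_poly N p (\<alpha> k))"
    and "M + 1 = fact (N + P) div (fact N * fact P)"
  \<comment> \<open>diffusion coefficient, forcing term, and their representations in terms of \<open>Y\<close>\<close>
    and "diffusion_field Pr D a amin amax"
    and "f \<in> bochner_L2 Pr (Hm1 D) (Hm1_norm D)"
    and "(\<lambda>(y, x). abar y x) \<in> borel_measurable (\<mu> \<Otimes>\<^sub>M lebesgue_on D)"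
    and "aminbar \<in> borel_measurable \<mu>" and "amaxbar \<in> borel_measurable \<mu>"
    and "fbar \<in> bochner_L2 \<mu> (Hm1 D) (Hm1_norm D)"
    and "\<And>\<omega> x. \<omega> \<in> space Pr \<Longrightarrow> x \<in> D \<Longrightarrow> a \<omega> x = abar (\<lambda>n\<in>{..<N}. Y n \<omega>) x"
    and "\<And>\<omega>. \<omega> \<in> space Pr \<Longrightarrow> amin \<omega> = aminbar (\<lambda>n\<in>{..<N}. Y n \<omega>)"
    and "\<And>\<omega>. \<omega> \<in> space Pr \<Longrightarrow> amax \<omega> = amaxbar (\<lambda>n\<in>{..<N}. Y n \<omega>)"
    and "\<And>\<omega>. \<omega> \<in> space Pr \<Longrightarrow> f \<omega> = fbar (\<lambda>n\<in>{..<N}. Y n \<omega>)"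
    and "abold = (\<lambda>y x. abar y x / aminbar y)"
    and "abold \<in> bochner_L2 \<mu> (L2_on D) (L2_norm D)"
  \<comment> \<open>standing assumption on truncation, for the coefficient and for the weighted coefficient\<close>
    and "\<exists>bmin bmax. diffusion_field \<mu> D (truncation_fun \<mu> pc M abar) bmin bmax"
    and "\<exists>bmin bmax. diffusion_field \<mu> D (truncation_fun \<mu> pc M abold) bmin bmax"
  \<comment> \<open>ansatz space and truncated weighted forms\<close>
    and "V = L2M pc M (H01 D)"
    and "B = form_B \<mu> D (truncation_fun \<mu> pc M abold)"
    and "F = form_F \<mu> (truncation \<mu> pc M (\<lambda>y. inverse (aminbar y))) fM"
  \<comment> \<open>hypotheses of the theorem\<close>
    and "r > 1" and "(\<lambda>y. amaxbar y / aminbar y) \<in> Lp_real \<mu> r"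
    and "fM \<in> L2M pc M (Hm1 D)"
    and "\<And>y \<phi>. y \<in> space \<mu> \<Longrightarrow> \<phi> \<in> H01 D \<Longrightarrow> fM y \<phi> = truncation_fun \<mu> pc M fbar y \<phi>"
  shows "\<exists>u.
      \<comment> \<open>(1)\<close>
      galerkin_solution B F V u \<and>
      (\<forall>w. galerkin_solution B F V w \<longrightarrow> L2_eq \<mu> D w u) \<and>
      \<comment> \<open>(2)\<close>
      is_arg_min (ritz_energy B F) (\<lambda>w. w \<in> V) u \<and>
      (\<forall>w. is_arg_min (ritz_energy B F) (\<lambda>w. w \<in> V) w \<longrightarrow> L2_eq \<mu> D w u)"
proof -
  interpret Pr: prob_space Pr by fact
  \<comment> \<open>From N on a Dirac measure fills the family up to probability measures at all
    indices; the product over \<open>{..<N}\<close> does not see it.\<close>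
  define m where "m n = (if n < N then distr Pr (restrict_space borel (\<Gamma> n)) (Y n) else return borel 0)" for n
  have Y: "Y n \<in> Pr \<rightarrow>\<^sub>M restrict_space borel (\<Gamma> n)" if "n < N" for n
    using assms(6,7)[OF that] by (intro measurable_restrict_space2) auto
  have \<mu>: "\<mu> = (\<Pi>\<^sub>M n\<in>{..<N}. m n)"
    unfolding assms(12) by (rule PiM_cong) (simp_all add: m_def)
  interpret chaos: polynomial_chaos m N p \<alpha>
  proof (rule polynomial_chaos.intro)
    show "prob_space (m n)" for n
      using Y by (auto simp: m_def intro: Pr.prob_space_distr prob_space_return)
    show "integrable (m n) (poly q)" if n: "n < N" for n q
    proof -
      have "integrable Pr (\<lambda>\<omega>. poly q (Y n \<omega>))" using assms(10)[OF n] by (rule integrable_poly)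
      moreover have "poly q \<in> borel_measurable (restrict_space borel (\<Gamma> n))"
        by (intro measurable_restrict_space1 borel_measurable_continuous_onI continuous_on_poly continuous_on_id)
      ultimately show ?thesis using n Y[OF n] by (simp add: m_def integrable_distr_eq)
    qed
    show "(\<integral>t. poly (p n i) t * poly (p n j) t \<partial>m n) = (if i = j then 1 else 0)" if "n < N" for n i j
      using assms(13)[OF that] that by (simp add: orthonormal_poly_basis_def m_def)
    show "bij_betw \<alpha> UNIV (multi_indices N)" using assms(14) by (simp add: grlex_enumeration_def)
  qed
  have pc: "pc k = tensor_poly N p (\<alpha> k)" for k using assms(15) by simp
  \<comment> \<open>Truncation does not in general preserve pointwise bounds, so the ellipticity of
    the truncated weighted coefficient is taken from the standing assumption on that
    truncation.\<close>
  obtain bmin bmax where b: "diffusion_field \<mu> D (truncation_fun \<mu> pc M abold) bmin bmax" using assms(30) by blast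
  define \<gamma> where "\<gamma> k = (\<integral>t. inverse (aminbar t) * pc k t \<partial>completion \<mu>)" for k
  have c: "truncation \<mu> pc M (\<lambda>y. inverse (aminbar y)) = (\<lambda>y. \<Sum>k\<le>M. \<gamma> k * pc k y)"
    by (simp add: truncation_def \<gamma>_def fun_eq_iff)
  obtain \<psi> where \<psi>: "fM = (\<lambda>y z. \<Sum>k\<le>M. \<psi> k z * pc k y)" "\<forall>k\<le>M. \<psi> k \<in> Hm1 D"
    using assms(36) by (auto simp: L2M_def)
  interpret ritz: galerkin D \<mu> pc M "truncation_fun \<mu> pc M abold" bmin "\<lambda>y. \<Sum>k\<le>M. \<gamma> k * pc k y" \<psi>
  proof (intro galerkin.intro galerkin_axioms.intro bounded_domain.intro)
    show "prob_space \<mu>" unfolding \<mu> by (rule prob_space_PiM) (rule chaos.prob)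
    show "open D" "bounded D" "D \<noteq> {}" using assms(3) by (auto simp: lipschitz_domain_def)
    show "pc k \<in> borel_measurable \<mu>" for k unfolding \<mu> pc by (rule chaos.tensor_poly_measurable)
    show "integrable \<mu> (\<lambda>y. pc i y * pc j y)" for i j unfolding \<mu> pc by (rule chaos.tensor_poly_integrable)
    show "(\<integral>y. pc i y * pc j y \<partial>\<mu>) = (if i = j then 1 else 0)" for i j
      unfolding \<mu> pc by (rule chaos.tensor_poly_orthonormal)
    show "integrable \<mu> (\<lambda>y. pc k y ^ 4)" for k unfolding \<mu> pc by (rule chaos.tensor_poly_power4)
    show "(\<lambda>(y, x). truncation_fun \<mu> pc M abold y x) \<in> borel_measurable (\<mu> \<Otimes>\<^sub>M lebesgue_on D)"
      using b by (simp add: diffusion_field_def)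
    show "AE y in \<mu>. truncation_fun \<mu> pc M abold y \<in> Linf_on D"
      "integrable (completion \<mu>) (\<lambda>y. (Linf_norm D (truncation_fun \<mu> pc M abold y))\<^sup>2)"
      using b by (auto simp: diffusion_field_def bochner_L2_def)
    \<comment> \<open>Of the moments of all orders, the second is the one that pairs with the fourth
      moments of the basis.\<close>
    have "(\<lambda>y. inverse (bmin y)) \<in> Lp_real \<mu> 2" using b by (simp add: diffusion_field_def)
    from Lp_real_inverse_2[OF this]
    show "(\<lambda>y. inverse (bmin y)) \<in> borel_measurable \<mu>" "integrable \<mu> (\<lambda>y. (inverse (bmin y))\<^sup>2)" .
    have "AE y in \<mu>. AE x in lebesgue_on D. 0 < bmin y \<and> bmin y \<le> truncation_fun \<mu> pc M abold y x \<and>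
        truncation_fun \<mu> pc M abold y x \<le> bmax y"
      using b by (simp add: diffusion_field_def)
    then show "AE y in \<mu>. AE x in lebesgue_on D. 0 < bmin y \<and> bmin y \<le> truncation_fun \<mu> pc M abold y x"
      by (elim eventually_mono) auto
    \<comment> \<open>The truncated reciprocal is itself a combination of the \<open>pc k\<close>,
      so the moments in the load are integrals of triple products of tensor polynomials.\<close>
    have "integrable \<mu> (\<lambda>y. \<gamma> k * (pc k y * pc i y * pc j y))" for i j k
      unfolding \<mu> pc by (intro integrable_mult_right chaos.tensor_poly_integrable3)
    then show "integrable \<mu> (\<lambda>y. (\<Sum>k\<le>M. \<gamma> k * pc k y) * pc i y * pc j y)" for i j
      by (simp add: sum_distrib_right mult.assoc)
    show "\<psi> k \<in> Hm1 D" if "k \<le> M" for k using \<psi>(2) that by blast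
  qed
  have F: "F = form_F \<mu> (\<lambda>y. \<Sum>k\<le>M. \<gamma> k * pc k y) (\<lambda>y z. \<Sum>k\<le>M. \<psi> k z * pc k y)"
    using assms(33) c \<psi>(1) by simp
  show ?thesis
    unfolding assms(31,32) F by (rule ritz.galerkin_ritz)
qed

end
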